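(* The assignment $\mathcal{B}:\mathbf{AF}\to\mathbf{BD}$ (defined in the context) is well defined and is a functor from the category of AF algebras to the category of Bratteli diagrams. That is: for every morphism $\varphi$ of $\mathbf{AF}$ the pair $((F_n),(f_n))$ constructed in the context is a premorphism, its equivalence class $\mathcal{B}(\varphi)$ does not depend on the choices made, $\mathcal{B}(\psi\varphi)=\mathcal{B}(\psi)\mathcal{B}(\varphi)$ for composable morphisms, and $\mathcal{B}(\mathrm{id}_{\mathcal A})=\mathrm{id}_{\mathcal{B}(\mathcal A)}$.
   Context: Multiplicity matrices. For a $k_1\times 1$ matrix $V_1$ and a $k_2\times 1$ matrix $V_2$ of strictly positive integers, a multiplicity matrix $E:V_1\to V_2$ is a $k_2\times k_1$ matrix of non-negative integers with $EV_1\le V_2$ entrywise; it is an embedding matrix if no column is zero. For a $*$-homomorphism $\varphi:\mathcal M_{n_1}\oplus\cdots\oplus\mathcal M_{n_k}\to\mathcal M_{m_1}\oplus\cdots\oplus\mathcal M_{m_l}$, $R_\varphi=(a_{ij})$ is the unique $l\times k$ matrix of non-negative integers such that for some unitary $v=(v_1,\dots,v_l)$ of the codomain, $v_i\varphi_i(u_1,\dots,u_k)v_i^*=\mathrm{diag}(u_1^{(a_{i1})},\dots,u_k^{(a_{ik})},0^{(s_i)})$ for all $i$, where $\varphi_i$ is the $i$-th component of $\varphi$ and $u^{(a)}$ denotes $a$ diagonal copies of $u$. Category $\mathbf{BD}$. A (non-zero) Bratteli diagram is a pair $(V,E)=((V_n)_{n\ge1},(E_n)_{n\ge1})$ with $V_n$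 a $k_n\times1$ matrix of strictly positive integers ($k_n\ge1$) and $E_n:V_n\to V_{n+1}$ an embedding matrix; $E_{nm}=E_{m-1}\cdots E_n$ for $n<m$, $E_{nn}=I$. A premorphism $(V,E)\to(W,S)$ is a pair $((F_n),(f_n))$ with $f_1\le f_2\le\cdots$ positive integers, $\sup f_n=\infty$, $F_n:V_n\to W_{f_n}$ multiplicity matrices, and $F_{n+1}E_n=S_{f_nf_{n+1}}F_n$ for all $n$. Composition: $((G_n),(g_n))((F_n),(f_n))=((G_{f_n}F_n)_n,(g_{f_n})_n)$; identity: $((I)_n,(n)_n)$. Premorphisms $((F_n),(f_n)),((G_n),(g_n)):(V,E)\to(W,S)$ are equivalent if and only if for each $n$ there is $m\ge f_n,g_n$ with $S_{f_nm}F_n=S_{g_nm}G_n$. Morphisms of $\mathbf{BD}$ are equivalence classes of premorphisms. There is also a zero diagram $0$, with exactly one morphism to and from each diagram; a composite $B\to0\to C$ of non-zero diagrams is the class of the premorphism with all matrices zero. Category $\mathbf{AF}$. Objects are triples $\mathcal A=(A,(A_n)_{n\ge1},(\varphi_n)_{n\ge1})$ where $A$ is an AF algebra, $(A_n)$ is an increasing sequence of finite dimensional C$^*$-subalgebras with dense union in $A$, and $\varphi_n$ is a $*$-isomorphism of $A_n$ onto an algebra $A_n'=\mathcal M_{m_{n1}}\oplus\cdots\oplus\mathcal M_{m_{nk_n}}$ (with $k_n\ge1$, $m_{ni}\ge1$ when $A\ne0$). A morphism from $(A,(A_n),(\varphi_n))$ to $(B,(B_n),(\psi_n))$ is a $*$-homomorphism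 $A\to B$. The assignment $\mathcal B$. On objects: $\mathcal B(\mathcal A)=((V_n),(E_n))$ with $V_n=(m_{n1},\dots,m_{nk_n})^T$ and $E_n=R_{\varphi_n'}$, where $\varphi_n'=\varphi_{n+1}\varphi_n^{-1}:A_n'\to A_{n+1}'$. On a morphism $\varphi:A\to B$ from $(A,(A_n),(\varphi_n))$ to $(B,(B_n),(\psi_n))$: choose unitaries $u_n\in B^\sim$ ($B^\sim=B$ if $B$ is unital, otherwise the unitization of $B$) and positive integers $f_1\le f_2\le\cdots$ with $\sup f_n=\infty$, $\|u_n-1\|<\frac12$ and $u_n\varphi(A_n)u_n^*\subseteq B_{f_n}$ (such choices exist); put $g_n=(\mathrm{Ad}\,u_n)\circ\varphi|_{A_n}:A_n\to B_{f_n}$ and $F_n=R_{\psi_{f_n}g_n\varphi_n^{-1}}$; $\mathcal B(\varphi)$ is the equivalence class of $((F_n),(f_n))$. The zero algebra is sent to the zero diagram and zero homomorphisms to zero morphisms. *)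

theory Defs
  imports
    "HOL-Analysis.Elementary_Topology"
    "HOL-Library.Product_Plus"
    "Jordan_Normal_Form.Schur_Decomposition"
begin

section \<open>C*-algebras\<close>

text \<open>Algebras are not assumed to be unital, and the zero algebra is allowed. A C*-algebra is
  represented by a type of the following class; \<open>real_normed_algebra\<close> supplies the
  submultiplicative norm and \<open>complete_space\<close> the completeness.\<close>

class cstar_algebra = real_normed_algebra + complete_space +
  fixes scaleC :: "complex \<Rightarrow> 'a \<Rightarrow> 'a"
    and star :: "'a \<Rightarrow> 'a"
  assumes scaleC_add_right: "scaleC z (x + y) = scaleC z x + scaleC z y"
    and scaleC_add_left: "scaleC (z + w) x = scaleC z x + scaleC w x"
    and scaleC_scaleC: "scaleC z (scaleC w x) = scaleC (z * w) x"
    and scaleC_one: "scaleC 1 x = x"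
    and scaleR_eq_scaleC: "scaleR r x = scaleC (complex_of_real r) x"
    and norm_scaleC: "norm (scaleC z x) = cmod z * norm x"
    and mult_scaleC_left: "scaleC z x * y = scaleC z (x * y)"
    and mult_scaleC_right: "x * scaleC z y = scaleC z (x * y)"
    and star_star: "star (star x) = x"
    and star_add: "star (x + y) = star x + star y"
    and star_scaleC: "star (scaleC z x) = scaleC (cnj z) (star x)"
    and star_mult: "star (x * y) = star y * star x"
    and cstar_identity: "norm (star x * x) = (norm x)\<^sup>2"

definition star_hom :: "('a::cstar_algebra \<Rightarrow> 'b::cstar_algebra) \<Rightarrow> bool" where
  "star_hom \<phi> \<longleftrightarrow>
     (\<forall>x y. \<phi> (x + y) = \<phi> x + \<phi> y) \<and>
     (\<forall>z x. \<phi> (scaleC z x) = scaleC z (\<phi> x)) \<and>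
     (\<forall>x y. \<phi> (x * y) = \<phi> x * \<phi> y) \<and>
     (\<forall>x. \<phi> (star x) = star (\<phi> x))"

definition cstar_subalgebra :: "'a::cstar_algebra set \<Rightarrow> bool" where
  "cstar_subalgebra S \<longleftrightarrow>
     0 \<in> S \<and> (\<forall>x\<in>S. \<forall>y\<in>S. x + y \<in> S) \<and> (\<forall>z. \<forall>x\<in>S. scaleC z x \<in> S) \<and>
     (\<forall>x\<in>S. \<forall>y\<in>S. x * y \<in> S) \<and> (\<forall>x\<in>S. star x \<in> S) \<and> closed S"

definition finite_dimensional :: "'a::cstar_algebra set \<Rightarrow> bool" where
  "finite_dimensional S \<longleftrightarrow>
     (\<exists>X. finite X \<and> X \<subseteq> S \<and> (\<forall>y\<in>S. \<exists>c. y = (\<Sum>x\<in>X. scaleC (c x) x)))"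

definition is_zero_algebra :: "'a::cstar_algebra itself \<Rightarrow> bool" where
  "is_zero_algebra _ \<longleftrightarrow> (UNIV :: 'a set) = {0}"

definition unit_element :: "'a::cstar_algebra \<Rightarrow> bool" where
  "unit_element e \<longleftrightarrow> (\<forall>x. e * x = x \<and> x * e = x)"

definition unital :: "'a::cstar_algebra itself \<Rightarrow> bool" where
  "unital _ \<longleftrightarrow> (\<exists>e::'a. unit_element e)"

section \<open>The algebra \<open>B\<^sup>\<sim>\<close>\<close>

text \<open>Elements of \<open>B\<^sup>\<sim>\<close> are pairs \<open>(b, \<lambda>)\<close>, standing for \<open>b + \<lambda> 1\<close>. If \<open>B\<close> is unital then
  \<open>B\<^sup>\<sim> = B\<close>, realised as the pairs with second component \<open>0\<close>. Otherwise \<open>B\<^sup>\<sim>\<close> is the unitization,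
  normed by the action of \<open>b + \<lambda> 1\<close> on \<open>B\<close> by left multiplication. The norm \<open>norm\<close> of the product
  type is never used.\<close>

definition tilde_carrier :: "('b::cstar_algebra \<times> complex) set" where
  "tilde_carrier = (if unital TYPE('b) then UNIV \<times> {0} else UNIV)"

definition tilde_one :: "'b::cstar_algebra \<times> complex" where
  "tilde_one = (if unital TYPE('b) then (THE e. unit_element e, 0) else (0, 1))"

definition tilde_mult ::
    "'b::cstar_algebra \<times> complex \<Rightarrow> 'b \<times> complex \<Rightarrow> 'b \<times> complex" where
  "tilde_mult u v =
     (fst u * fst v + scaleC (snd u) (fst v) + scaleC (snd v) (fst u), snd u * snd v)"

definition tilde_star :: "'b::cstar_algebra \<times> complex \<Rightarrow> 'b \<times> complex" where
  "tilde_star u = (star (fst u), cnj (snd u))"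

definition tilde_norm :: "'b::cstar_algebra \<times> complex \<Rightarrow> real" where
  "tilde_norm u =
     (if unital TYPE('b) then norm (fst u)
      else (SUP c\<in>{c. norm c \<le> 1}. norm (fst u * c + scaleC (snd u) c)))"

definition tilde_unitary :: "'b::cstar_algebra \<times> complex \<Rightarrow> bool" where
  "tilde_unitary u \<longleftrightarrow> u \<in> tilde_carrier \<and>
     tilde_mult u (tilde_star u) = tilde_one \<and> tilde_mult (tilde_star u) u = tilde_one"

text \<open>\<open>B\<close> is an ideal of \<open>B\<^sup>\<sim>\<close>, so \<open>u (b, 0) u\<^sup>*\<close> has second component \<open>0\<close>.\<close>

definition Ad :: "'b::cstar_algebra \<times> complex \<Rightarrow> 'b \<Rightarrow> 'b" where
  "Ad u b = fst (tilde_mult (tilde_mult u (b, 0)) (tilde_star u))"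

section \<open>Direct sums of matrix algebras and the matrix \<open>R\<^sub>\<phi>\<close>\<close>

definition matrix_sum :: "nat vec \<Rightarrow> complex mat list set" where
  "matrix_sum V =
     {xs. length xs = dim_vec V \<and> (\<forall>i<dim_vec V. xs ! i \<in> carrier_mat (V $ i) (V $ i))}"

definition unitary_mat :: "complex mat \<Rightarrow> bool" where
  "unitary_mat v \<longleftrightarrow> dim_row v = dim_col v \<and>
     v * mat_adjoint v = 1\<^sub>m (dim_row v) \<and> mat_adjoint v * v = 1\<^sub>m (dim_row v)"

text \<open>The block matrix \<open>diag(u\<^sub>1\<^sup>(\<^sup>a\<^sup>1\<^sup>), \<dots>, u\<^sub>k\<^sup>(\<^sup>a\<^sup>k\<^sup>), 0\<^sup>(\<^sup>s\<^sup>))\<close>.\<close>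

definition multiplicity_diag :: "(nat \<Rightarrow> nat) \<Rightarrow> nat \<Rightarrow> complex mat list \<Rightarrow> complex mat" where
  "multiplicity_diag a s us =
     diag_block_mat (concat (map (\<lambda>j. replicate (a j) (us ! j)) [0..<length us]) @ [0\<^sub>m s s])"

definition is_multiplicity_of ::
    "nat mat \<Rightarrow> nat vec \<Rightarrow> nat vec \<Rightarrow> (complex mat list \<Rightarrow> complex mat list) \<Rightarrow> bool" where
  "is_multiplicity_of a V W \<phi> \<longleftrightarrow>
     a \<in> carrier_mat (dim_vec W) (dim_vec V) \<and>
     (\<exists>v\<in>matrix_sum W. \<exists>s.
        \<forall>i<dim_vec W. unitary_mat (v ! i) \<and>
          (\<forall>us\<in>matrix_sum V.
             v ! i * (\<phi> us ! i) * mat_adjoint (v ! i) =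
               multiplicity_diag (\<lambda>j. a $$ (i, j)) (s i) us))"

definition multiplicity_of ::
    "nat vec \<Rightarrow> nat vec \<Rightarrow> (complex mat list \<Rightarrow> complex mat list) \<Rightarrow> nat mat" where
  "multiplicity_of V W \<phi> = (THE a. is_multiplicity_of a V W \<phi>)"

section \<open>The category of Bratteli diagrams\<close>

text \<open>Sequences are indexed by the natural numbers starting from \<open>0\<close> instead of \<open>1\<close>.\<close>

definition positive_vec :: "nat vec \<Rightarrow> bool" where
  "positive_vec V \<longleftrightarrow> (\<forall>i<dim_vec V. 0 < V $ i)"

definition multiplicity_matrix :: "nat vec \<Rightarrow> nat mat \<Rightarrow> nat vec \<Rightarrow> bool" where
  "multiplicity_matrix V E W \<longleftrightarrow> E \<in> carrier_mat (dim_vec W) (dim_vec V) \<and> E *\<^sub>v V \<le> W"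

definition embedding_matrix :: "nat vec \<Rightarrow> nat mat \<Rightarrow> nat vec \<Rightarrow> bool" where
  "embedding_matrix V E W \<longleftrightarrow>
     multiplicity_matrix V E W \<and> (\<forall>j<dim_col E. col E j \<noteq> 0\<^sub>v (dim_row E))"

datatype diagram = Zero_Diagram | Diagram "nat \<Rightarrow> nat vec" "nat \<Rightarrow> nat mat"

fun bratteli_diagram :: "diagram \<Rightarrow> bool" where
  "bratteli_diagram Zero_Diagram \<longleftrightarrow> True"
| "bratteli_diagram (Diagram V E) \<longleftrightarrow>
     (\<forall>n. 1 \<le> dim_vec (V n) \<and> positive_vec (V n) \<and> embedding_matrix (V n) (E n) (V (Suc n)))"

text \<open>\<open>step_product V E n k = E\<^sub>n\<^sub>+\<^sub>k\<^sub>-\<^sub>1 \<cdots> E\<^sub>n\<close>, so that \<open>connecting V E n m\<close> is \<open>E\<^sub>n\<^sub>m\<close> for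
  \<open>n \<le> m\<close>; it is only used in that range.\<close>

primrec step_product ::
    "(nat \<Rightarrow> nat vec) \<Rightarrow> (nat \<Rightarrow> nat mat) \<Rightarrow> nat \<Rightarrow> nat \<Rightarrow> nat mat" where
  "step_product V E n 0 = 1\<^sub>m (dim_vec (V n))"
| "step_product V E n (Suc k) = E (n + k) * step_product V E n k"

definition connecting ::
    "(nat \<Rightarrow> nat vec) \<Rightarrow> (nat \<Rightarrow> nat mat) \<Rightarrow> nat \<Rightarrow> nat \<Rightarrow> nat mat" where
  "connecting V E n m = step_product V E n (m - n)"

type_synonym premor = "(nat \<Rightarrow> nat mat) \<times> (nat \<Rightarrow> nat)"

text \<open>Premorphisms exist between non-zero diagrams only.\<close>

fun premorphism :: "diagram \<Rightarrow> diagram \<Rightarrow> premor \<Rightarrow> bool" where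
  "premorphism (Diagram V E) (Diagram W S) (F, f) \<longleftrightarrow>
     mono f \<and> \<not> bdd_above (range f) \<and>
     (\<forall>n. multiplicity_matrix (V n) (F n) (W (f n))) \<and>
     (\<forall>n. F (Suc n) * E n = connecting W S (f n) (f (Suc n)) * F n)"
| "premorphism _ _ _ \<longleftrightarrow> False"

fun premor_equiv :: "diagram \<Rightarrow> premor \<Rightarrow> premor \<Rightarrow> bool" where
  "premor_equiv (Diagram W S) (F, f) (G, g) \<longleftrightarrow>
     (\<forall>n. \<exists>m. f n \<le> m \<and> g n \<le> m \<and> connecting W S (f n) m * F n = connecting W S (g n) m * G n)"
| "premor_equiv Zero_Diagram _ _ \<longleftrightarrow> False"

definition premor_class :: "diagram \<Rightarrow> diagram \<Rightarrow> premor \<Rightarrow> premor set" where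
  "premor_class D D' P = {Q. premorphism D D' Q \<and> premor_equiv D' P Q}"

definition premor_comp :: "premor \<Rightarrow> premor \<Rightarrow> premor" where
  "premor_comp G F = (\<lambda>n. fst G (snd F n) * fst F n, \<lambda>n. snd G (snd F n))"

text \<open>\<open>Null\<close> is the only morphism to and from the zero diagram; \<open>Cls X\<close> is an equivalence class
  of premorphisms between non-zero diagrams.\<close>

datatype bd_morphism = Null | Cls "premor set"

fun bd_hom :: "diagram \<Rightarrow> diagram \<Rightarrow> bd_morphism set" where
  "bd_hom (Diagram V E) (Diagram W S) =
     {Cls (premor_class (Diagram V E) (Diagram W S) P) | P.
        premorphism (Diagram V E) (Diagram W S) P}"
| "bd_hom _ _ = {Null}"

text \<open>The composite \<open>D \<rightarrow> 0 \<rightarrow> D'\<close>.\<close>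

fun bd_zero :: "diagram \<Rightarrow> diagram \<Rightarrow> bd_morphism" where
  "bd_zero (Diagram V E) (Diagram W S) =
     Cls (premor_class (Diagram V E) (Diagram W S)
       (\<lambda>n. 0\<^sub>m (dim_vec (W n)) (dim_vec (V n)), \<lambda>n. n))"
| "bd_zero _ _ = Null"

fun bd_id :: "diagram \<Rightarrow> bd_morphism" where
  "bd_id (Diagram V E) =
     Cls (premor_class (Diagram V E) (Diagram V E) (\<lambda>n. 1\<^sub>m (dim_vec (V n)), \<lambda>n. n))"
| "bd_id Zero_Diagram = Null"

text \<open>\<open>bd_comp D1 D2 D3 g f\<close> is \<open>g \<circ> f\<close> for \<open>f : D1 \<rightarrow> D2\<close> and \<open>g : D2 \<rightarrow> D3\<close>. The composite of two
  classes consists of all premorphisms equivalent to a composite of representatives.\<close>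

fun bd_comp :: "diagram \<Rightarrow> diagram \<Rightarrow> diagram \<Rightarrow> bd_morphism \<Rightarrow> bd_morphism \<Rightarrow> bd_morphism" where
  "bd_comp (Diagram V E) (Diagram W S) (Diagram U T) (Cls Y) (Cls X) =
     Cls (\<Union>F\<in>X. \<Union>G\<in>Y. premor_class (Diagram V E) (Diagram U T) (premor_comp G F))"
| "bd_comp D1 _ D3 _ _ = bd_zero D1 D3"

section \<open>The category of AF algebras\<close>

text \<open>The algebra \<open>A\<close> of an object \<open>(A, (A\<^sub>n), (\<phi>\<^sub>n))\<close> is the type \<open>'a\<close>. The field \<open>sub\<close> is
  \<open>(A\<^sub>n)\<close>, the isomorphism \<open>chart \<A> n\<close> is \<open>\<phi>\<^sub>n\<close> (relevant on \<open>A\<^sub>n\<close> only), and its image is the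
  direct sum of matrix algebras with sizes \<open>sizes \<A> n\<close>. The morphisms between two objects
  are the functions satisfying \<open>star_hom\<close>, with composition \<open>(\<circ>)\<close> and identity \<open>id\<close>.\<close>

record ('a) af_object =
  sub :: "nat \<Rightarrow> 'a set"
  sizes :: "nat \<Rightarrow> nat vec"
  chart :: "nat \<Rightarrow> 'a \<Rightarrow> complex mat list"

definition star_iso_onto ::
    "'a::cstar_algebra set \<Rightarrow> nat vec \<Rightarrow> ('a \<Rightarrow> complex mat list) \<Rightarrow> bool" where
  "star_iso_onto S V \<phi> \<longleftrightarrow>
     bij_betw \<phi> S (matrix_sum V) \<and>
     (\<forall>x\<in>S. \<forall>y\<in>S. \<phi> (x + y) = map2 (+) (\<phi> x) (\<phi> y)) \<and>
     (\<forall>z. \<forall>x\<in>S. \<phi> (scaleC z x) = map (\<lambda>M. z \<cdot>\<^sub>m M) (\<phi> x)) \<and>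
     (\<forall>x\<in>S. \<forall>y\<in>S. \<phi> (x * y) = map2 (*) (\<phi> x) (\<phi> y)) \<and>
     (\<forall>x\<in>S. \<phi> (star x) = map mat_adjoint (\<phi> x))"

definition AF :: "'a::cstar_algebra af_object \<Rightarrow> bool" where
  "AF \<A> \<longleftrightarrow>
     (\<forall>n. cstar_subalgebra (sub \<A> n) \<and> finite_dimensional (sub \<A> n)) \<and>
     (\<forall>n. sub \<A> n \<subseteq> sub \<A> (Suc n)) \<and>
     closure (\<Union>n. sub \<A> n) = UNIV \<and>
     (\<forall>n. star_iso_onto (sub \<A> n) (sizes \<A> n) (chart \<A> n)) \<and>
     (\<forall>n. positive_vec (sizes \<A> n)) \<and>
     (\<not> is_zero_algebra TYPE('a) \<longrightarrow> (\<forall>n. 1 \<le> dim_vec (sizes \<A> n)))"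

section \<open>The assignment \<open>\<B>\<close>\<close>

definition B_obj :: "'a::cstar_algebra af_object \<Rightarrow> diagram" where
  "B_obj \<A> =
     (if is_zero_algebra TYPE('a) then Zero_Diagram
      else Diagram (sizes \<A>)
        (\<lambda>n. multiplicity_of (sizes \<A> n) (sizes \<A> (Suc n))
               (chart \<A> (Suc n) \<circ> inv_into (sub \<A> n) (chart \<A> n))))"

text \<open>The choices \<open>(u\<^sub>n)\<close>, \<open>(f\<^sub>n)\<close> made in the definition of \<open>\<B>(\<phi>)\<close>.\<close>

definition admissible ::
    "'a::cstar_algebra af_object \<Rightarrow> 'b::cstar_algebra af_object \<Rightarrow> ('a \<Rightarrow> 'b) \<Rightarrow>
     (nat \<Rightarrow> 'b \<times> complex) \<Rightarrow> (nat \<Rightarrow> nat) \<Rightarrow> bool" where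
  "admissible \<A> \<B> \<phi> u f \<longleftrightarrow>
     mono f \<and> \<not> bdd_above (range f) \<and>
     (\<forall>n. tilde_unitary (u n) \<and> tilde_norm (u n - tilde_one) < 1/2 \<and>
          (\<lambda>a. Ad (u n) (\<phi> a)) ` sub \<A> n \<subseteq> sub \<B> (f n))"

definition B_premor ::
    "'a::cstar_algebra af_object \<Rightarrow> 'b::cstar_algebra af_object \<Rightarrow> ('a \<Rightarrow> 'b) \<Rightarrow>
     (nat \<Rightarrow> 'b \<times> complex) \<Rightarrow> (nat \<Rightarrow> nat) \<Rightarrow> premor" where
  "B_premor \<A> \<B> \<phi> u f =
     (\<lambda>n. multiplicity_of (sizes \<A> n) (sizes \<B> (f n))
            (chart \<B> (f n) \<circ> Ad (u n) \<circ> \<phi> \<circ> inv_into (sub \<A> n) (chart \<A> n)),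
      f)"

definition B_mor ::
    "'a::cstar_algebra af_object \<Rightarrow> 'b::cstar_algebra af_object \<Rightarrow> ('a \<Rightarrow> 'b) \<Rightarrow> bd_morphism" where
  "B_mor \<A> \<B> \<phi> =
     (if \<phi> = (\<lambda>_. 0) then bd_zero (B_obj \<A>) (B_obj \<B>)
      else let (u, f) = (SOME (u, f). admissible \<A> \<B> \<phi> u f)
           in Cls (premor_class (B_obj \<A>) (B_obj \<B>) (B_premor \<A> \<B> \<phi> u f)))"

end

theory Submission
  imports Defs "HOL-Analysis.Elementary_Metric_Spaces"
begin

text \<open>For minimal projections \<open>p\<close> of the summands of the domain, the entries of \<open>R\<^sub>g\<close> are the traces of
  the components of \<open>g(p)\<close>; so \<open>R\<close> is multiplicative and is determined by traces of projections. If
  \<open>z z\<^sup>*\<close> and \<open>z' z'\<^sup>*\<close> are projections in a finite dimensional algebra and \<open>\<parallel>z - z'\<parallel> < 1\<close>, then they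
  have the same traces. With \<open>z = u \<phi>(p)\<close> this gives the premorphism identity and the independence
  of the choices, and, because *-homomorphisms are contractive, compatibility with composition.

  For the existence of \<open>u\<close>, approximate the matrix units of \<open>\<phi>(A\<^sub>n)\<close> by elements of some \<open>B\<^sub>m\<close> and
  correct these to exact matrix units of \<open>B\<^sub>m\<close>. The two systems are intertwined by an element close
  to 1, whose polar part is \<open>u\<close>. Newton iterations, which stay inside the closed subalgebra \<open>B\<^sub>m\<close>
  and preserve intertwining relations, replace functional calculus throughout.\<close>

section \<open>C*-algebras and the action of \<open>B\<^sup>\<sim>\<close>\<close>

text \<open>Conjugates are never compared directly. For admissible unitaries u and v the obvious
  estimate of \<open>u p u* - v p v*\<close> is by 2, which says nothing about projections, whereas
  the factors \<open>u p\<close> and \<open>v p\<close> differ by less than 1/2 + 1/2 = 1. Exactly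
  this is what equality of traces requires, and it is the reason for working with factors z of
  \<open>z z*\<close>. A composite brings in a third unitary. Independence of the choices has to be
  available before composition is treated, since it allows representatives with a smaller bound; for
  this reason existence is proved for arbitrarily small bounds. The element u \<phi>(p) lies in the
  ideal B and can be mapped by \<psi>. The algebra B~ enters through its left action on B, and its
  own C*-structure is not developed. R is given by an existential statement about unitaries. Traces
  are linear and invariant under conjugation, so they replace that statement by equations between
  numbers.\<close>

instance cstar_algebra \<subseteq> banach ..

section \<open>Elementary rules for scalars, adjoints and norms\<close>

lemma scaleC_zero_right [simp]: "scaleC z (0::'a::cstar_algebra) = 0"
  by (metis add_cancel_left_left scaleC_add_right)

lemma scaleC_zero_left [simp]: "scaleC 0 (x::'a::cstar_algebra) = 0"
  by (metis add_cancel_left_left scaleC_add_left)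

lemma scaleC_minus_right [simp]: "scaleC z (- x) = - scaleC z (x::'a::cstar_algebra)"
  by (metis add.right_inverse add_eq_0_iff scaleC_add_right scaleC_zero_right)

lemma scaleC_minus_left [simp]: "scaleC (- z) x = - scaleC z (x::'a::cstar_algebra)"
  by (metis add.right_inverse add_eq_0_iff scaleC_add_left scaleC_zero_left)

lemma scaleC_diff_right: "scaleC z (x - y) = scaleC z x - scaleC z (y::'a::cstar_algebra)"
  using scaleC_add_right[of z x "- y"] by simp

lemma scaleC_diff_left: "scaleC (z - w) x = scaleC z x - scaleC w (x::'a::cstar_algebra)"
  using scaleC_add_left[of z "- w" x] by simp

lemma star_zero [simp]: "star (0::'a::cstar_algebra) = 0"
  by (metis add_cancel_left_left star_add)

lemma star_minus: "star (- x) = - star (x::'a::cstar_algebra)"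
  by (metis add.right_inverse add_eq_0_iff star_add star_zero)

lemma star_diff: "star (x - y) = star x - star (y::'a::cstar_algebra)"
  using star_add[of x "- y"] by (simp add: star_minus)

lemma star_scaleR: "star (scaleR r x) = scaleR r (star (x::'a::cstar_algebra))"
  by (simp add: scaleR_eq_scaleC star_scaleC)

lemma star_sum: "star (sum f I) = (\<Sum>i\<in>I. star (f i :: 'a::cstar_algebra))"
  by (induction I rule: infinite_finite_induct) (auto simp: star_add)

lemmas star_simps = star_star star_add star_diff star_minus star_mult star_scaleR star_scaleC

lemma norm_star [simp]: "norm (star x) = norm (x::'a::cstar_algebra)"
proof -
  have le: "norm y \<le> norm (star y)" for y :: 'a
  proof (cases "y = 0")
    case False
    have "norm y * norm y \<le> norm (star y) * norm y"
      using cstar_identity[of y] norm_mult_ineq[of "star y" y] by (simp add: power2_eq_square)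
    then show ?thesis using False by simp
  qed simp
  show ?thesis using le[of x] le[of "star x"] by (simp add: star_star)
qed

lemma star_mult_self_eq_0_iff: "star x * x = 0 \<longleftrightarrow> (x::'a::cstar_algebra) = 0"
  using cstar_identity[of x] by auto

lemma norm_mult_star_self: "norm (x * star x) = (norm (x::'a::cstar_algebra))\<^sup>2"
  using cstar_identity[of "star x"] by (simp add: star_star)

lemma bounded_linear_star: "bounded_linear (star :: 'a::cstar_algebra \<Rightarrow> 'a)"
  by (rule bounded_linear_intro[of _ 1]) (auto simp: star_add star_scaleR)

lemmas tendsto_star [tendsto_intros] = bounded_linear.tendsto[OF bounded_linear_star]
lemmas continuous_on_star [continuous_intros] = bounded_linear.continuous_on[OF bounded_linear_star]

lemma norm_projection_le_1:
  fixes p :: "'a::cstar_algebra"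
  assumes "star p = p" "p * p = p"
  shows "norm p \<le> 1"
proof -
  have "norm p = (norm p)\<^sup>2" using cstar_identity[of p] assms by simp
  then show ?thesis by (cases "norm p = 0") (auto simp: power2_eq_square)
qed

text \<open>The pair \<open>u\<close> as a left multiplication operator on the ideal
  \<open>B\<close>. Once unitaries have been constructed, the estimates use \<open>u\<close> through
  this operator, which treats the unital and the non-unital case alike.\<close>

definition tilde_act :: "'b::cstar_algebra \<times> complex \<Rightarrow> 'b \<Rightarrow> 'b" where
  "tilde_act u c = fst u * c + scaleC (snd u) c"

lemma tilde_act_add: "tilde_act u (x + y) = tilde_act u x + tilde_act u y"
  by (simp add: tilde_act_def distrib_left scaleC_add_right)

lemma tilde_act_scaleC: "tilde_act u (scaleC z x) = scaleC z (tilde_act u x)"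
  by (simp add: tilde_act_def mult_scaleC_right scaleC_add_right scaleC_scaleC mult.commute)

lemma tilde_act_zero [simp]: "tilde_act u 0 = 0"
  by (simp add: tilde_act_def)

lemma tilde_act_mult: "tilde_act u x * y = tilde_act u (x * y)"
  by (simp add: tilde_act_def distrib_right mult_scaleC_left mult.assoc)

lemma tilde_act_tilde_mult: "tilde_act (tilde_mult u v) x = tilde_act u (tilde_act v x)"
  by (simp add: tilde_act_def tilde_mult_def distrib_left distrib_right mult_scaleC_left
      mult_scaleC_right scaleC_add_right scaleC_scaleC mult.assoc add_ac)

text \<open>The adjoint relation for the \<open>B\<close>-valued inner product
  \<open>star x * y\<close>; it makes unitaries isometric.\<close>

lemma star_tilde_act_mult: "star (tilde_act u x) * y = star x * tilde_act (tilde_star u) y"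
  by (simp add: tilde_act_def tilde_star_def star_simps distrib_left distrib_right mult_scaleC_left
      mult_scaleC_right mult.assoc)

lemma unit_element_unique: "unit_element e \<Longrightarrow> unit_element f \<Longrightarrow> e = f"
  unfolding unit_element_def by metis

lemma unit_element_the:
  assumes "unital TYPE('b::cstar_algebra)"
  shows "unit_element (THE e::'b. unit_element e)"
  using assms unfolding unital_def by (metis theI' unit_element_unique)

lemma tilde_act_one: "tilde_act (tilde_one :: 'b::cstar_algebra \<times> complex) x = x"
proof (cases "unital TYPE('b)")
  case True
  then have "(THE e::'b. unit_element e) * x = x"
    using unit_element_the[OF True] by (simp add: unit_element_def)
  then show ?thesis using True by (simp add: tilde_act_def tilde_one_def)
qed (simp add: tilde_act_def tilde_one_def scaleC_one)

text \<open>Right multiplication by the adjoint of \<open>u\<close> is \<open>star\<close>, left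
  multiplication by \<open>u\<close>, and \<open>star\<close> again. Conjugation is thus expressed
  by the left action alone.\<close>

lemma Ad_eq: "Ad u x = star (tilde_act u (star (tilde_act u x)))"
  by (simp add: Ad_def tilde_act_def tilde_mult_def tilde_star_def star_simps
      distrib_left distrib_right mult_scaleC_left mult_scaleC_right scaleC_add_right)

text \<open>For a projection \<open>x\<close> this writes its conjugate as \<open>z * star z\<close>
  with z = u x, the form in which traces are compared.\<close>

lemma Ad_mult_star: "Ad u (x * star x) = tilde_act u x * star (tilde_act u x)"
  by (simp add: Ad_eq tilde_act_mult[symmetric] star_simps)

lemma tilde_unitary_act_inverse:
  assumes "tilde_unitary u"
  shows "tilde_act (tilde_star u) (tilde_act u x) = x"
  using assms unfolding tilde_unitary_def by (metis tilde_act_one tilde_act_tilde_mult)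

lemma tilde_unitary_isometric:
  assumes "tilde_unitary u"
  shows "star (tilde_act u x) * tilde_act u y = star x * y"
  by (simp add: assms star_tilde_act_mult tilde_unitary_act_inverse)

lemma norm_tilde_unitary_act:
  assumes "tilde_unitary u"
  shows "norm (tilde_act u x) = norm x"
proof -
  have "(norm (tilde_act u x))\<^sup>2 = (norm x)\<^sup>2"
    by (metis assms cstar_identity tilde_unitary_isometric)
  then show ?thesis by simp
qed

lemma star_hom_Ad:
  assumes "tilde_unitary u"
  shows "star_hom (Ad u)"
  unfolding star_hom_def
proof (intro conjI allI)
  fix x y z
  show "Ad u (x + y) = Ad u x + Ad u y"
    by (simp add: Ad_eq tilde_act_add star_add)
  show "Ad u (scaleC z x) = scaleC z (Ad u x)"
    by (simp add: Ad_eq tilde_act_scaleC star_scaleC)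
  have R: "star (tilde_act u (star a)) * tilde_act u b = a * b" for a b
    using tilde_unitary_isometric[OF assms, of "star a" b] by (simp add: star_star)
  \<comment> \<open>Associativity: with u' the adjoint of u, \<open>LR\<close> says (u a) u' = u (a
    u'), while \<open>R\<close> cancels u' u between two factors.\<close>
  have LR: "star (tilde_act u (star (tilde_act u a))) = tilde_act u (star (tilde_act u (star a)))" for a
    by (simp add: tilde_act_def star_simps distrib_left distrib_right mult_scaleC_left
        mult_scaleC_right scaleC_add_right scaleC_scaleC mult.assoc mult.commute[of "snd u"] add_ac)
  have "Ad u x * Ad u y = tilde_act u x * star (tilde_act u (star y))"
    unfolding Ad_eq LR[of y] R ..
  also have "\<dots> = star (tilde_act u (star (tilde_act u x * y)))"
    by (metis (no_types, lifting) star_mult star_star tilde_act_mult)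
  also have "\<dots> = Ad u (x * y)"
    by (simp add: Ad_eq tilde_act_mult)
  finally show "Ad u (x * y) = Ad u x * Ad u y" ..
  show "Ad u (star x) = star (Ad u x)"
    unfolding Ad_eq LR by (simp add: star_star)
qed

lemma bdd_above_tilde_norm:
  "bdd_above ((\<lambda>c. norm (b * c + scaleC z c)) ` {c::'b::cstar_algebra. norm c \<le> 1})"
proof (rule bdd_aboveI2)
  fix c :: 'b assume "c \<in> {c. norm c \<le> 1}"
  then have c: "norm c \<le> 1" by simp
  have "norm (b * c + scaleC z c) \<le> norm b * norm c + cmod z * norm c"
    by (metis norm_scaleC norm_triangle_mono norm_mult_ineq order_refl)
  also have "\<dots> \<le> norm b * 1 + cmod z * 1"
    by (intro add_mono mult_left_mono) (use c in auto)
  finally show "norm (b * c + scaleC z c) \<le> norm b + cmod z" by simp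
qed

text \<open>\<open>tilde_norm\<close> bounds the left action: by submultiplicativity if
  \<open>B\<close> is unital, and otherwise by rescaling \<open>c\<close> into the unit ball over
  which the supremum is taken.\<close>

lemma norm_tilde_act_le:
  assumes "u \<in> tilde_carrier"
  shows "norm (tilde_act u c) \<le> tilde_norm u * norm (c::'b::cstar_algebra)"
proof (cases "unital TYPE('b)")
  case True
  then show ?thesis using assms
    by (auto simp: tilde_act_def tilde_carrier_def tilde_norm_def norm_mult_ineq)
next
  case False
  show ?thesis
  proof (cases "c = 0")
    case False': False
    let ?d = "scaleR (inverse (norm c)) c"
    have "norm (fst u * ?d + scaleC (snd u) ?d) \<le> tilde_norm u"
      unfolding tilde_norm_def using False False'
      by (auto intro!: cSUP_upper2[where x = ?d] bdd_above_tilde_norm)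
    also have "fst u * ?d + scaleC (snd u) ?d = scaleR (inverse (norm c)) (tilde_act u c)"
      by (simp add: tilde_act_def scaleR_eq_scaleC scaleC_add_right scaleC_scaleC
          mult_scaleC_right mult.commute)
    finally show ?thesis using False' by (simp add: field_simps)
  qed simp
qed

lemma norm_tilde_act_minus_le:
  assumes "tilde_unitary u" "tilde_norm (u - tilde_one) \<le> r"
  shows "norm (tilde_act u c - c) \<le> r * norm (c::'b::cstar_algebra)"
proof -
  have "u - tilde_one \<in> tilde_carrier"
    using assms(1) by (auto simp: tilde_unitary_def tilde_carrier_def tilde_one_def split: if_splits)
  then have "norm (tilde_act (u - tilde_one) c) \<le> tilde_norm (u - tilde_one) * norm c"
    by (rule norm_tilde_act_le)
  also have "\<dots> \<le> r * norm c"
    using assms(2) by (simp add: mult_right_mono)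
  also have "tilde_act (u - tilde_one) c = tilde_act u c - tilde_act tilde_one c"
    by (simp add: tilde_act_def left_diff_distrib scaleC_diff_left)
  finally show ?thesis by (simp add: tilde_act_one)
qed

text \<open>In terms of \<open>b = u - 1\<close>, the equations \<open>u\<^sup>* u = 1\<close> and \<open>u u\<^sup>* = 1\<close> make sense
  without a unit.\<close>

lemma ex_tilde_unitary:
  fixes b :: "'b::cstar_algebra"
  assumes "b + star b + star b * b = 0" "b + star b + b * star b = 0"
  obtains u where "tilde_unitary u" "tilde_norm (u - tilde_one) \<le> norm b"
    "\<And>x. tilde_act u x = x + b * x"
proof (cases "unital TYPE('b)")
  case True
  define e where "e = (THE e::'b. unit_element e)"
  have e: "unit_element e" unfolding e_def by (rule unit_element_the[OF True])
  then have se: "star e = e" unfolding unit_element_def by (metis star_mult star_star)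
  have e1: "e * x = x" "x * e = x" for x using e by (auto simp: unit_element_def)
  show thesis
  proof (rule that[of "(e + b, 0)"])
    have "(e + b) * (e + star b) = e" "(e + star b) * (e + b) = e"
      using assms by (auto simp: distrib_left distrib_right e1 se add_ac)
    then show "tilde_unitary (e + b, 0)"
      by (simp add: tilde_unitary_def tilde_carrier_def tilde_one_def True tilde_mult_def
          tilde_star_def star_add se e_def[symmetric])
    show "tilde_norm ((e + b, 0) - tilde_one) \<le> norm b"
      by (simp add: tilde_norm_def True tilde_one_def e_def[symmetric])
    show "tilde_act (e + b, 0) x = x + b * x" for x
      by (simp add: tilde_act_def distrib_right e1)
  qed
next
  case False
  show thesis
  proof (rule that[of "(b, 1)"])
    show "tilde_unitary (b, 1)"
      using assms by (simp add: tilde_unitary_def tilde_carrier_def tilde_one_def False tilde_mult_def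
          tilde_star_def scaleC_one add_ac)
    have "norm (b * c) \<le> norm b" if "norm c \<le> 1" for c
      by (metis norm_mult_ineq mult_left_mono that norm_ge_zero mult.right_neutral order_trans)
    moreover have "norm (0::'b) \<le> 1" by simp
    then have "{c::'b. norm c \<le> 1} \<noteq> {}" by blast
    ultimately show "tilde_norm ((b, 1) - tilde_one) \<le> norm b"
      by (auto simp: tilde_norm_def False tilde_one_def intro!: cSUP_least)
    show "tilde_act (b, 1) x = x + b * x" for x
      by (simp add: tilde_act_def scaleC_one)
  qed
qed

lemma tilde_unitary_one: "tilde_unitary (tilde_one :: 'b::cstar_algebra \<times> complex)"
  and tilde_norm_zero: "tilde_norm (0 :: 'b \<times> complex) = 0"
proof -
  show "tilde_norm (0 :: 'b \<times> complex) = 0"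
    by (auto simp: tilde_norm_def intro!: cSUP_const)
      (metis norm_zero zero_le_one)
  show "tilde_unitary (tilde_one :: 'b \<times> complex)"
  proof (cases "unital TYPE('b)")
    case True
    define e where "e = (THE e::'b. unit_element e)"
    have e: "unit_element e" unfolding e_def by (rule unit_element_the[OF True])
    then have "star e = e" "e * e = e" unfolding unit_element_def by (metis star_mult star_star)+
    then show ?thesis
      by (simp add: tilde_unitary_def tilde_carrier_def tilde_one_def True tilde_mult_def
          tilde_star_def e_def[symmetric])
  next
    case False
    then show ?thesis
      by (simp add: tilde_unitary_def tilde_carrier_def tilde_one_def tilde_mult_def tilde_star_def)
  qed
qed

lemma Ad_one [simp]: "Ad tilde_one x = x"
  by (simp add: Ad_eq tilde_act_one star_star)

section \<open>Contractivity of *-homomorphisms\<close>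

context
  fixes \<phi> :: "'a::cstar_algebra \<Rightarrow> 'b::cstar_algebra"
  assumes hom: "star_hom \<phi>"
begin

lemma star_hom_add: "\<phi> (x + y) = \<phi> x + \<phi> y"
  and star_hom_scaleC: "\<phi> (scaleC z x) = scaleC z (\<phi> x)"
  and star_hom_mult: "\<phi> (x * y) = \<phi> x * \<phi> y"
  and star_hom_star: "\<phi> (star x) = star (\<phi> x)"
  using hom by (auto simp: star_hom_def)

lemma star_hom_scaleR: "\<phi> (scaleR r x) = scaleR r (\<phi> x)"
  by (simp add: scaleR_eq_scaleC star_hom_scaleC)

lemma star_hom_zero: "\<phi> 0 = 0"
  by (metis add_cancel_left_left star_hom_add)

lemma star_hom_diff: "\<phi> (x - y) = \<phi> x - \<phi> y"
  by (metis add_diff_cancel diff_add_cancel star_hom_add)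

lemma star_hom_sum: "\<phi> (sum f I) = (\<Sum>i\<in>I. \<phi> (f i))"
  by (induction I rule: infinite_finite_induct) (auto simp: star_hom_add star_hom_zero)

text \<open>A self-adjoint \<open>h\<close> with norm less than 1 is the imaginary part of the unitary
  \<open>(1 - c) + i h\<close>, where \<open>(1 - c)\<^sup>2 = 1 - h\<^sup>2\<close>; the image of a unitary is isometric.\<close>

lemma star_hom_selfadjoint_norm_le_1:
  assumes h: "star h = h" and h1: "norm h < 1"
  shows "norm (\<phi> h) \<le> 1"
proof -
  define r where "r = norm (h * h)"
  have "r \<le> norm h * norm h" unfolding r_def by (rule norm_mult_ineq)
  also have "\<dots> < 1" using h1 by (metis abs_norm_cancel abs_square_less_1 power2_eq_square)
  finally have r1: "r < 1" .
  have r0: "0 \<le> r" by (simp add: r_def)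
  \<comment> \<open>The equation (1 - c)^2 = 1 - h^2 rearranges to c = (h^2 + c^2) / 2, a fixed
    point problem for \<open>f\<close>. On the ball of radius r = norm (h h) < 1 the map
    \<open>f\<close> is a contraction with constant r. Self-adjointness and commutation with
    \<open>h\<close> are closed conditions kept by \<open>f\<close>, so placing them in
    \<open>S\<close> passes them on to the fixed point.\<close>
  define S where "S = cball 0 r \<inter> {c. star c = c} \<inter> {c. c * h = h * c}"
  define f where "f c = scaleR (1/2) (h * h + c * c)" for c :: 'a
  have "\<exists>!c\<in>S. f c = c"
  proof (rule Banach_fix)
    have "closed S"
      unfolding S_def
      by (intro closed_Int closed_cball closed_Collect_eq continuous_intros)
    then show "complete S" by (simp add: complete_eq_closed)
    have "0 \<in> S" using r0 by (simp add: S_def)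
    then show "S \<noteq> {}" by blast
    show "0 \<le> r" "r < 1" by fact+
    show "f ` S \<subseteq> S"
    proof clarify
      fix c assume "c \<in> S"
      then have c: "norm c \<le> r" "star c = c" "c * h = h * c" by (auto simp: S_def)
      have "norm (f c) \<le> (norm (h * h) + norm (c * c)) / 2"
        using norm_triangle_ineq[of "h * h" "c * c"] by (simp add: f_def)
      also have "norm (c * c) \<le> norm c * norm c" by (rule norm_mult_ineq)
      also have "\<dots> \<le> r * 1" using c(1) r1 r0 by (intro mult_mono) auto
      finally have "norm (f c) \<le> r" by (simp add: r_def[symmetric])
      moreover have "star (f c) = f c" by (simp add: f_def star_simps c h)
      moreover have "f c * h = h * f c"
        by (simp add: f_def algebra_simps) (metis c(3) mult.assoc)
      ultimately show "f c \<in> S" by (auto simp: S_def)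
    qed
    show "dist (f c) (f d) \<le> r * dist c d" if "c \<in> S" "d \<in> S" for c d
    proof -
      have n: "norm c \<le> r" "norm d \<le> r" using that by (auto simp: S_def)
      have "f c - f d = scaleR (1/2) (c * (c - d) + (c - d) * d)"
        by (simp add: f_def algebra_simps)
      then have "norm (f c - f d) \<le> (norm (c * (c - d)) + norm ((c - d) * d)) / 2"
        using norm_triangle_ineq[of "c * (c - d)" "(c - d) * d"] by simp
      also have "norm (c * (c - d)) \<le> r * norm (c - d)"
        by (meson norm_mult_ineq mult_right_mono n norm_ge_zero order_trans)
      also have "norm ((c - d) * d) \<le> norm (c - d) * r"
        by (meson norm_mult_ineq mult_left_mono n norm_ge_zero order_trans)
      finally show ?thesis by (simp add: dist_norm mult.commute)
    qed
  qed
  then obtain c where c: "c \<in> S" "f c = c" by blast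
  have sc: "star c = c" and ch: "c * h = h * c" using c by (auto simp: S_def)
  have "scaleR 2 (f c) = scaleR 2 c" using c by simp
  then have hh: "h * h + c * c = c + c" by (simp add: f_def scaleR_2)
  define C where "C = \<phi> c"
  define H where "H = \<phi> h"
  have C: "star C = C" "star H = H" "C * H = H * C" "H * H + C * C = C + C"
    unfolding C_def H_def by (metis sc h ch hh star_hom_star star_hom_mult star_hom_add)+
  \<comment> \<open>\<open>u\<close> stands for -((1 - C) + i H) and \<open>v\<close> for its
    adjoint; the sign is harmless. The formal scalar part is used even if \<open>B\<close> has a
    unit: (0, 1) acts on \<open>B\<close> as the identity in either case.\<close>
  define u where "u = (C - scaleC \<i> H, -1 :: complex)"
  define v where "v = (C + scaleC \<i> H, -1 :: complex)"
  have uv: "tilde_act (tilde_star w) (tilde_act w y) = y" if "w = u \<or> w = v" for w y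
  proof -
    have "tilde_mult (tilde_star w) w = (0, 1)"
    proof -
      have i: "scaleC \<i> (scaleC \<i> x) = - x" for x :: 'b
        by (simp add: scaleC_scaleC scaleC_one)
      have CC: "C * C = C + C - H * H" using C(4) by (simp add: eq_diff_eq add.commute)
      show ?thesis using that
        by (auto simp: u_def v_def tilde_mult_def tilde_star_def star_simps C(1-3) CC scaleC_one
            distrib_left distrib_right left_diff_distrib right_diff_distrib mult_scaleC_left
            mult_scaleC_right scaleC_add_right scaleC_diff_right i)
    qed
    then have "tilde_act (tilde_mult (tilde_star w) w) y = y"
      by (simp add: tilde_act_def scaleC_one)
    then show ?thesis by (simp add: tilde_act_tilde_mult)
  qed
  have iso: "norm (tilde_act w y) = norm y" if "w = u \<or> w = v" for w y
  proof -
    have "(norm (tilde_act w y))\<^sup>2 = norm (star y * tilde_act (tilde_star w) (tilde_act w y))"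
      by (metis cstar_identity star_tilde_act_mult)
    then show ?thesis using uv[OF that] by (simp add: cstar_identity)
  qed
  \<comment> \<open>The difference of v H and u H is 2 i H^2, and both operators are isometric. So 2
    norm (H^2) is at most 2 norm H, which for self-adjoint \<open>H\<close> bounds norm H by
    1.\<close>
  have "tilde_act v H - tilde_act u H = scaleC \<i> (H * H) + scaleC \<i> (H * H)"
    by (simp add: tilde_act_def u_def v_def distrib_right left_diff_distrib mult_scaleC_left)
  also have "\<dots> = scaleR 2 (scaleC \<i> (H * H))" by (simp add: scaleR_2)
  finally have "norm (scaleR 2 (scaleC \<i> (H * H))) \<le> norm H + norm H"
    using norm_triangle_ineq4[of "tilde_act v H" "tilde_act u H"] iso by metis
  then have "norm (H * H) \<le> norm H" by (simp add: norm_scaleC)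
  then have "norm H * norm H \<le> norm H"
    using cstar_identity[of H] C by (simp add: power2_eq_square)
  then show ?thesis
    unfolding H_def[symmetric] by (cases "norm H = 0") auto
qed

text \<open>By the C*-identity it suffices to treat \<open>star x * x\<close>, scaled to norm below
  1. The strict bound demanded by the self-adjoint case is paid for with \<epsilon>.\<close>

lemma norm_star_hom_le: "norm (\<phi> x) \<le> norm x"
proof (rule field_le_epsilon)
  fix \<epsilon> :: real assume e: "0 < \<epsilon>"
  define r where "r = norm x + \<epsilon>"
  have r: "r > 0" "norm x < r" using e by (auto simp: r_def add_nonneg_pos)
  define h where "h = scaleR (inverse (r\<^sup>2)) (star x * x)"
  have "norm h = (norm x)\<^sup>2 / r\<^sup>2"
    using r by (simp add: h_def cstar_identity field_simps)
  also have "\<dots> < 1" using r by (simp add: power_strict_mono)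
  finally have "norm (\<phi> h) \<le> 1"
    by (intro star_hom_selfadjoint_norm_le_1) (auto simp: h_def star_simps)
  moreover have "\<phi> h = scaleR (inverse (r\<^sup>2)) (star (\<phi> x) * \<phi> x)"
    by (simp add: h_def star_hom_scaleR star_hom_mult star_hom_star)
  ultimately have "(norm (\<phi> x))\<^sup>2 \<le> r\<^sup>2"
    using r by (simp add: cstar_identity field_simps)
  then show "norm (\<phi> x) \<le> norm x + \<epsilon>"
    using r by (simp add: r_def[symmetric] power2_le_iff_abs_le)
qed

end

lemma star_hom_comp: "star_hom \<psi> \<Longrightarrow> star_hom \<phi> \<Longrightarrow> star_hom (\<psi> \<circ> \<phi>)"
  by (simp add: star_hom_def)

section \<open>Newton iterations\<close>

text \<open>The common part of the three iterations below. \<open>d\<close> is the defect to be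
  removed, \<open>co i\<close> are the coordinates whose limits are wanted, and \<open>P\<close>
  collects the exact properties that a step keeps; the states themselves carry no topology. The
  estimates of \<open>step\<close> are available only near the start. K d \<le> 1/2 makes the defect
  at least halve in each step, so the moves are dominated by a geometric series of sum 2 K d \<le> 1
  and the iteration never leaves that region.\<close>

lemma newton_limit:
  fixes co :: "'i \<Rightarrow> 's \<Rightarrow> 'b::banach"
  assumes P0: "P x0"
    and PN: "\<And>x. P x \<Longrightarrow> P (N x)"
    and d0: "\<And>x. 0 \<le> d x"
    and step: "\<And>x. P x \<Longrightarrow> d x \<le> 1 \<Longrightarrow> (\<forall>i\<in>I. norm (co i x - co i x0) \<le> 1) \<Longrightarrow>
      d (N x) \<le> K * (d x)\<^sup>2 \<and> (\<forall>i\<in>I. norm (co i (N x) - co i x) \<le> K * d x)"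
    and K: "1 \<le> K" "K * d x0 \<le> 1/2"
  obtains X l where "X = (\<lambda>n. (N ^^ n) x0)" "\<And>n. P (X n)"
    "\<And>i. i \<in> I \<Longrightarrow> (\<lambda>n. co i (X n)) \<longlonglongrightarrow> l i"
    "\<And>i. i \<in> I \<Longrightarrow> norm (l i - co i x0) \<le> 2 * K * d x0"
    "(\<lambda>n. d (X n)) \<longlonglongrightarrow> 0"
proof -
  define X where "X n = (N ^^ n) x0" for n
  define D where "D = d x0"
  have D: "0 \<le> D" "K * D \<le> 1/2" using d0 K by (auto simp: D_def)
  have "1 * D \<le> K * D" using K D by (intro mult_right_mono) auto
  then have D1: "D \<le> 1/2" using D by simp
  have X0: "X 0 = x0" and XS: "X (Suc n) = N (X n)" for n by (auto simp: X_def)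
  have PX: "P (X n)" for n by (induction n) (auto simp: X0 XS P0 PN)
  have D2: "D / 2 ^ n \<le> D" for n using D by (simp add: divide_le_eq mult_le_cancel_left1)
  \<comment> \<open>The k-th move is at most K D / 2^k, and 2 K D (1 - 1/2^n) is the sum of the
    first n of these bounds.\<close>
  define near where "near n \<longleftrightarrow> d (X n) \<le> D / 2 ^ n \<and>
      (\<forall>i\<in>I. norm (co i (X n) - co i x0) \<le> 2 * K * D * (1 - 1 / 2 ^ n))" for n
  have st: "d (X (Suc n)) \<le> K * (d (X n))\<^sup>2 \<and>
      (\<forall>i\<in>I. norm (co i (X (Suc n)) - co i (X n)) \<le> K * d (X n))" if "near n" for n
  proof -
    have "2 * K * D * (1 - 1 / 2 ^ n) \<le> 1 * 1"
      using D K(1) by (intro mult_mono) auto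
    then have "\<forall>i\<in>I. norm (co i (X n) - co i x0) \<le> 1" using that by (fastforce simp: near_def)
    moreover have "d (X n) \<le> 1" using that D2[of n] D1 by (simp add: near_def)
    ultimately show ?thesis using step[OF PX[of n]] by (auto simp: XS)
  qed
  have main: "near n" for n
  proof (induction n)
    case 0
    then show ?case by (simp add: near_def X0 D_def)
  next
    case (Suc n)
    note dn = Suc[unfolded near_def]
    have "K * (d (X n))\<^sup>2 = (K * d (X n)) * d (X n)" by (simp add: power2_eq_square)
    also have "\<dots> \<le> (K * D) * d (X n)"
      using dn D2[of n] K d0 by (intro mult_right_mono mult_left_mono) auto
    also have "\<dots> \<le> (1/2) * (D / 2 ^ n)" using D dn d0 by (intro mult_mono) auto
    finally have "d (X (Suc n)) \<le> D / 2 ^ Suc n" using st[OF Suc] by simp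
    moreover have "norm (co i (X (Suc n)) - co i x0) \<le> 2 * K * D * (1 - 1 / 2 ^ Suc n)" if "i \<in> I" for i
    proof -
      have "norm (co i (X (Suc n)) - co i x0) \<le>
          norm (co i (X (Suc n)) - co i (X n)) + norm (co i (X n) - co i x0)"
        using norm_triangle_ineq[of "co i (X (Suc n)) - co i (X n)" "co i (X n) - co i x0"] by simp
      also have "\<dots> \<le> K * d (X n) + 2 * K * D * (1 - 1 / 2 ^ n)"
        using st[OF Suc] dn that by (intro add_mono) auto
      also have "K * d (X n) \<le> K * (D / 2 ^ n)" using dn K by (intro mult_left_mono) auto
      finally show ?thesis by (simp add: field_simps)
    qed
    ultimately show ?case by (simp add: near_def)
  qed
  have lim0: "(\<lambda>n. D / 2 ^ n) \<longlonglongrightarrow> 0"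
    using LIMSEQ_divide_realpow_zero[of 2 D] by simp
  have dlim: "(\<lambda>n. d (X n)) \<longlonglongrightarrow> 0"
    using main d0 by (intro tendsto_sandwich[OF _ _ tendsto_const lim0]) (auto simp: near_def)
  have conv: "\<exists>l. (\<lambda>n. co i (X n)) \<longlonglongrightarrow> l" if i: "i \<in> I" for i
  proof -
    have *: "norm (co i (X (Suc n)) - co i (X n)) \<le> K * D * (1/2) ^ n" for n
    proof -
      have "norm (co i (X (Suc n)) - co i (X n)) \<le> K * d (X n)" using st[OF main[of n]] i by blast
      also have "\<dots> \<le> K * (D / 2 ^ n)"
        using main[of n] K by (intro mult_left_mono) (auto simp: near_def)
      finally show ?thesis by (simp add: field_simps)
    qed
    have "summable (\<lambda>n. K * D * (1/2) ^ n)" by (intro summable_mult summable_geometric) auto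
    then have "summable (\<lambda>n. co i (X (Suc n)) - co i (X n))"
      by (rule summable_comparison_test'[where N = 0]) (use * in auto)
    then have "(\<lambda>n. \<Sum>k<n. co i (X (Suc k)) - co i (X k)) \<longlonglongrightarrow> (\<Sum>k. co i (X (Suc k)) - co i (X k))"
      by (rule summable_LIMSEQ)
    then have "(\<lambda>n. co i (X n) - co i (X 0)) \<longlonglongrightarrow> (\<Sum>k. co i (X (Suc k)) - co i (X k))"
      unfolding sum_lessThan_telescope[of "\<lambda>k. co i (X k)"] .
    from tendsto_add[OF this tendsto_const[of "co i (X 0)"]] show ?thesis by auto
  qed
  then obtain l where l: "\<And>i. i \<in> I \<Longrightarrow> (\<lambda>n. co i (X n)) \<longlonglongrightarrow> l i" by metis
  have "norm (l i - co i x0) \<le> 2 * K * d x0" if i: "i \<in> I" for i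
  proof (rule Lim_bounded)
    show "(\<lambda>n. norm (co i (X n) - co i x0)) \<longlonglongrightarrow> norm (l i - co i x0)"
      by (intro tendsto_intros l i)
    have "2 * K * D * (1 - 1 / 2 ^ n) \<le> 2 * K * D * 1" for n
      using D K by (intro mult_left_mono) auto
    then have "2 * K * D * (1 - 1 / 2 ^ n) \<le> 2 * K * D" for n by simp
    moreover have "norm (co i (X n) - co i x0) \<le> 2 * K * D * (1 - 1 / 2 ^ n)" for n
      using main[of n] i by (simp add: near_def)
    ultimately show "\<forall>n\<ge>0. norm (co i (X n) - co i x0) \<le> 2 * K * d x0"
      unfolding D_def by (blast intro: order_trans)
  qed
  then show thesis using that[of X l] PX l dlim X_def by blast
qed

lemma cstar_subalgebraD:
  assumes "cstar_subalgebra S"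
  shows "0 \<in> S" "\<And>x y. x \<in> S \<Longrightarrow> y \<in> S \<Longrightarrow> x + y \<in> S" "\<And>z x. x \<in> S \<Longrightarrow> scaleC z x \<in> S"
    "\<And>x y. x \<in> S \<Longrightarrow> y \<in> S \<Longrightarrow> x * y \<in> S" "\<And>x. x \<in> S \<Longrightarrow> star x \<in> S" "closed S"
    "\<And>x y. x \<in> S \<Longrightarrow> y \<in> S \<Longrightarrow> x - y \<in> S" "\<And>r x. x \<in> S \<Longrightarrow> scaleR r x \<in> S"
    "\<And>I f. (\<And>i. i \<in> I \<Longrightarrow> f i \<in> S) \<Longrightarrow> sum f I \<in> S"
proof -
  show *: "0 \<in> S" "\<And>x y. x \<in> S \<Longrightarrow> y \<in> S \<Longrightarrow> x + y \<in> S" "\<And>z x. x \<in> S \<Longrightarrow> scaleC z x \<in> S"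
    "\<And>x y. x \<in> S \<Longrightarrow> y \<in> S \<Longrightarrow> x * y \<in> S" "\<And>x. x \<in> S \<Longrightarrow> star x \<in> S" "closed S"
    using assms by (auto simp: cstar_subalgebra_def)
  show "x - y \<in> S" if "x \<in> S" "y \<in> S" for x y
    using *(2)[OF that(1) *(3)[OF that(2), of "-1"]] by (simp add: scaleC_one)
  show "scaleR r x \<in> S" if "x \<in> S" for r x
    using that by (simp add: scaleR_eq_scaleC *)
  show "sum f I \<in> S" if "\<And>i. i \<in> I \<Longrightarrow> f i \<in> S" for I and f :: "'b \<Rightarrow> 'a"
    using that by (induction I rule: infinite_finite_induct) (auto simp: *)
qed

text \<open>Newton's method for \<open>x\<^sup>2 = x\<close>: the map \<open>x \<mapsto> 3 x\<^sup>2 - 2 x\<^sup>3\<close>.\<close>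

lemma ex_projection_near:
  fixes a :: "'a::cstar_algebra"
  assumes D: "cstar_subalgebra D" "a \<in> D" and a: "star a = a" "norm a \<le> 2"
    and small: "norm (a - a * a) \<le> 1/102"
  obtains p where "p \<in> D" "star p = p" "p * p = p" "norm (p - a) \<le> 102 * norm (a - a * a)"
proof -
  note DD = cstar_subalgebraD[OF D(1)]
  define N :: "'a \<Rightarrow> 'a" where "N x = (x * x + x * x + x * x) - (x * x * x + x * x * x)" for x
  \<comment> \<open>With w = x - x^2 the new defect is 3 w^2 + 4 w^3, and both estimates come out
    with constant 7. The larger K = 51 put in its place produces the numbers of the statement: 1/102
    = 1/(2 K) and 102 = 2 K.\<close>
  have step: "norm (N x - N x * N x) \<le> 51 * (norm (x - x * x))\<^sup>2 \<and>
      (\<forall>i\<in>{()}. norm (N x - x) \<le> 51 * norm (x - x * x))"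
    if d1: "norm (x - x * x) \<le> 1" and near: "\<forall>i\<in>{()}. norm (x - a) \<le> 1" for x
  proof -
    define w where "w = x - x * x"
    have nx: "norm x \<le> 3" using near norm_triangle_ineq[of "x - a" a] a by simp
    have "N x - x = (w * x + w * x) - w"
      by (simp add: N_def w_def algebra_simps)
    also have "norm \<dots> \<le> norm (w * x + w * x) + norm w" by (rule norm_triangle_ineq4)
    also have "norm (w * x + w * x) \<le> norm (w * x) + norm (w * x)" by (rule norm_triangle_ineq)
    also have "norm (w * x) \<le> norm w * 3"
      by (meson norm_mult_ineq mult_left_mono nx norm_ge_zero order_trans)
    finally have 1: "norm (N x - x) \<le> 7 * norm w" by simp
    have "N x - N x * N x = (w * w + w * w + w * w) + (w * w * w + w * w * w + w * w * w + w * w * w)"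
      by (simp add: N_def w_def algebra_simps)
    also have "\<dots> = scaleR (1 + 1 + 1) (w * w) + scaleR (1 + 1 + 1 + 1) (w * w * w)"
      by (simp only: scaleR_left_distrib scaleR_one)
    also have "\<dots> = scaleR 3 (w * w) + scaleR 4 (w * w * w)" by simp
    also have "norm \<dots> \<le> 3 * norm (w * w) + 4 * norm (w * w * w)"
      using norm_triangle_ineq[of "scaleR 3 (w * w)" "scaleR 4 (w * w * w)"] by simp
    also have "norm (w * w * w) \<le> norm (w * w) * 1"
      by (meson norm_mult_ineq mult_left_mono d1[folded w_def] norm_ge_zero order_trans)
    also have "norm (w * w) \<le> (norm w)\<^sup>2"
      by (simp add: norm_mult_ineq power2_eq_square)
    finally have "norm (N x - N x * N x) \<le> 7 * (norm w)\<^sup>2" by simp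
    then show ?thesis using 1 by (auto simp: w_def[symmetric] intro: order_trans)
  qed
  obtain X l where X: "X = (\<lambda>n. (N ^^ n) a)" "\<And>n. X n \<in> D \<and> star (X n) = X n"
    "\<And>i. i \<in> {()} \<Longrightarrow> X \<longlonglongrightarrow> l i"
    "\<And>i. i \<in> {()} \<Longrightarrow> norm (l i - a) \<le> 2 * 51 * norm (a - a * a)"
    "(\<lambda>n. norm (X n - X n * X n)) \<longlonglongrightarrow> 0"
  proof (rule newton_limit[where P = "\<lambda>x. x \<in> D \<and> star x = x" and ?x0.0 = a and N = N
        and d = "\<lambda>x. norm (x - x * x)" and I = "{()}" and co = "\<lambda>_ x. x" and K = 51])
    show "N x \<in> D \<and> star (N x) = N x" if "x \<in> D \<and> star x = x" for x
      using that by (simp add: N_def DD star_simps mult.assoc)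
  qed (use D a small step in auto)
  have l: "X \<longlonglongrightarrow> l ()" using X(3) by simp
  show thesis
  proof (rule that[of "l ()"])
    show "l () \<in> D" using closed_sequentially[OF DD(6) _ l] X(2) by blast
    have "(\<lambda>n. star (X n)) \<longlonglongrightarrow> star (l ())" by (intro tendsto_intros l)
    then show "star (l ()) = l ()" using X(2) l LIMSEQ_unique by auto
    have "(\<lambda>n. norm (X n - X n * X n)) \<longlonglongrightarrow> norm (l () - l () * l ())"
      by (intro tendsto_intros l)
    then show "l () * l () = l ()" using X(5) LIMSEQ_unique by fastforce
    show "norm (l () - a) \<le> 102 * norm (a - a * a)" using X(4)[of "()"] by simp
  qed
qed

text \<open>Newton's method for \<open>t\<^sub>a\<^sup>* t\<^sub>b = \<delta>\<^sub>a\<^sub>b p\<^sub>a\<close>. With \<open>y = t\<^sup>* t - diag(p)\<close> as a matrix over the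
  algebra the step is \<open>t \<mapsto> t (1 - y / 2)\<close>, which turns \<open>y\<close> into \<open>(y\<^sup>3 - 3 y\<^sup>2) / 4\<close>.\<close>

lemma ex_partial_isometries_near:
  fixes t0 p :: "'i \<Rightarrow> 'a::cstar_algebra"
  assumes I: "finite I" and D: "cstar_subalgebra D" "\<And>a. a \<in> I \<Longrightarrow> t0 a \<in> D" "\<And>a. a \<in> I \<Longrightarrow> p a \<in> D"
    and p: "\<And>a. a \<in> I \<Longrightarrow> star (p a) = p a" "\<And>a. a \<in> I \<Longrightarrow> p a * p a = p a"
    and t0p: "\<And>a. a \<in> I \<Longrightarrow> t0 a * p a = t0 a"
    and t02: "\<And>a. a \<in> I \<Longrightarrow> norm (t0 a) \<le> 2"
    and defect: "\<delta> = (\<Sum>a\<in>I. \<Sum>b\<in>I. norm (star (t0 a) * t0 b - (if a = b then p a else 0)))"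
    and small: "\<delta> \<le> 1/4"
  obtains t where "\<And>a. a \<in> I \<Longrightarrow> t a \<in> D" "\<And>a. a \<in> I \<Longrightarrow> t a * p a = t a"
    "\<And>a b. a \<in> I \<Longrightarrow> b \<in> I \<Longrightarrow> star (t a) * t b = (if a = b then p a else 0)"
    "\<And>a. a \<in> I \<Longrightarrow> norm (t a - t0 a) \<le> 4 * \<delta>"
proof -
  note DD = cstar_subalgebraD[OF D(1)]
  define y where "y t a b = star (t a) * t b - (if a = b then p a else 0)" for t and a b :: 'i
  define N where "N t b = t b - scaleR (1/2) (\<Sum>a\<in>I. t a * y t a b)" for t and b :: 'i
  define nrm where "nrm u = (\<Sum>a\<in>I. \<Sum>b\<in>I. norm (u a b))" for u :: "'i \<Rightarrow> 'i \<Rightarrow> 'a"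
  define d where "d t = nrm (y t)" for t
  define P where "P t \<longleftrightarrow> (\<forall>a\<in>I. t a \<in> D \<and> t a * p a = t a)" for t :: "'i \<Rightarrow> 'a"
  have pt: "p a * star (t a) = star (t a)" if "P t" "a \<in> I" for t a
    using that p unfolding P_def by (metis star_mult)
  \<comment> \<open>The projections act as units on the entries of \<open>y\<close> from both sides.
    Hence diag(p) behaves like the 1 in the scalar computation (1 - y/2)(1 + y)(1 - y/2) - 1 = (y^3
    - 3 y^2)/4.\<close>
  have yp: "y t a b * p b = y t a b" and py: "p a * y t a b = y t a b"
    if "P t" "a \<in> I" "b \<in> I" for t a b
    using that p pt[OF that(1,2)] unfolding P_def y_def
    by (auto simp: left_diff_distrib right_diff_distrib mult.assoc)
      (metis mult.assoc)+
  have ystar: "star (y t a b) = y t b a" if "a \<in> I" "b \<in> I" for t a b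
    using that p by (auto simp: y_def star_simps)
  have yle: "norm (y t a b) \<le> d t" if "a \<in> I" "b \<in> I" for t a b
  proof -
    have "norm (y t a b) \<le> (\<Sum>b\<in>I. norm (y t a b))" using that I by (intro member_le_sum) auto
    also have "\<dots> \<le> d t" unfolding d_def nrm_def using that I
      by (intro member_le_sum[where f = "\<lambda>a. \<Sum>b\<in>I. norm (y t a b)"]) (auto intro: sum_nonneg)
    finally show ?thesis .
  qed
  have d0: "0 \<le> d t" for t unfolding d_def nrm_def by (intro sum_nonneg) auto
  have PN: "P (N t)" if "P t" for t
    unfolding P_def
  proof (intro ballI conjI)
    fix b assume b: "b \<in> I"
    have "y t a b \<in> D" if "a \<in> I" for a
      using that \<open>P t\<close> b D(3) unfolding y_def P_def by (auto intro!: DD)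
    then show "N t b \<in> D" unfolding N_def using \<open>P t\<close> b by (auto intro!: DD simp: P_def)
    show "N t b * p b = N t b"
      using that b yp[OF that _ b]
      by (simp add: N_def left_diff_distrib sum_distrib_right mult.assoc P_def)
  qed
  define y2 where "y2 t a b = (\<Sum>c\<in>I. y t a c * y t c b)" for t a b
  define y3 where "y3 t a b = (\<Sum>c\<in>I. y t a c * y2 t c b)" for t a b
  have yN: "y (N t) a b = scaleR (1/4) (y3 t a b) - scaleR (3/4) (y2 t a b)"
    if P: "P t" and a: "a \<in> I" and b: "b \<in> I" for t a b
  proof -
    have tt: "star (t a) * t b = y t a b + (if a = b then p a else 0)" for a b
      by (simp add: y_def)
    have A: "(\<Sum>c\<in>I. star (t a) * (t c * x c)) = (\<Sum>c\<in>I. y t a c * x c) + p a * x a"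
      if "a \<in> I" for x a
    proof -
      have "(\<Sum>c\<in>I. star (t a) * (t c * x c)) =
          (\<Sum>c\<in>I. y t a c * x c + (if a = c then p a * x a else 0))"
        by (intro sum.cong) (auto simp: mult.assoc[symmetric] tt distrib_right)
      then show ?thesis using I that by (simp add: sum.distrib)
    qed
    have Z: "(\<Sum>c\<in>I. star (t a) * (t c * y t c b)) = y2 t a b + y t a b" if "a \<in> I" for a
      using A[OF that] py[OF P that b] by (simp add: y2_def)
    have sN: "star (N t a) = star (t a) - scaleR (1/2) (\<Sum>c\<in>I. y t a c * star (t c))"
      using a by (simp add: N_def star_simps star_sum ystar)
    have Z2: "(\<Sum>c\<in>I. y t a c * (star (t c) * t b)) = y2 t a b + y t a b"
    proof -
      have "(\<Sum>c\<in>I. y t a c * (star (t c) * t b)) =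
          (\<Sum>c\<in>I. y t a c * y t c b + (if c = b then y t a b * p b else 0))"
        by (intro sum.cong) (auto simp: tt distrib_left)
      then show ?thesis using I b yp[OF P a b] by (simp add: sum.distrib y2_def)
    qed
    have "star (N t a) * N t b = star (t a) * t b
        - scaleR (1/2) (\<Sum>c\<in>I. star (t a) * (t c * y t c b))
        - scaleR (1/2) (\<Sum>c\<in>I. y t a c * (star (t c) * t b))
        + scaleR (1/4) (\<Sum>c\<in>I. y t a c * (\<Sum>e\<in>I. star (t c) * (t e * y t e b)))"
      unfolding sN unfolding N_def
      by (simp add: left_diff_distrib right_diff_distrib sum_distrib_left sum_distrib_right mult.assoc
          sum_subtractf scaleR_right_diff_distrib flip: scaleR_sum_right)
        (rule sum.swap)
    also have "(\<Sum>c\<in>I. y t a c * (\<Sum>e\<in>I. star (t c) * (t e * y t e b))) = y3 t a b + y2 t a b"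
      by (simp add: Z y3_def y2_def[of t a b] distrib_left sum.distrib cong: sum.cong)
    also have "star (t a) * t b
        - scaleR (1/2) (\<Sum>c\<in>I. star (t a) * (t c * y t c b))
        - scaleR (1/2) (\<Sum>c\<in>I. y t a c * (star (t c) * t b)) + scaleR (1/4) (y3 t a b + y2 t a b) =
      scaleR (1/4) (y3 t a b) - scaleR (3/4) (y2 t a b) + (if a = b then p a else 0)"
      unfolding Z[OF a] Z2 unfolding tt
      by (simp add: algebra_simps) (simp flip: scaleR_left_distrib scaleR_left_diff_distrib add.assoc)
    finally show ?thesis unfolding y_def[of "N t"] by simp
  qed
  \<comment> \<open>The sum of the norms of all entries is submultiplicative for matrix products, so
    \<open>d\<close> obeys the scalar estimate for (y^3 - 3 y^2)/4.\<close>
  have nrm_mult: "nrm (\<lambda>a b. \<Sum>c\<in>I. u a c * v c b) \<le> nrm u * nrm v" for u v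
  proof -
    have "nrm (\<lambda>a b. \<Sum>c\<in>I. u a c * v c b) \<le> (\<Sum>a\<in>I. \<Sum>b\<in>I. \<Sum>c\<in>I. norm (u a c) * norm (v c b))"
      unfolding nrm_def by (intro sum_mono sum_norm_le norm_mult_ineq)
    also have "\<dots> = (\<Sum>a\<in>I. \<Sum>c\<in>I. norm (u a c) * (\<Sum>b\<in>I. norm (v c b)))"
      by (subst sum.swap[where B = I]) (simp add: sum_distrib_left)
    also have "\<dots> \<le> (\<Sum>a\<in>I. \<Sum>c\<in>I. norm (u a c) * nrm v)"
      unfolding nrm_def by (intro sum_mono mult_left_mono
          member_le_sum[where f = "\<lambda>a. \<Sum>b\<in>I. norm (v a b)"]) (auto intro: sum_nonneg I)
    also have "\<dots> = nrm u * nrm v" by (simp add: nrm_def sum_distrib_right)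
    finally show ?thesis .
  qed
  have y2le: "nrm (y2 t) \<le> (d t)\<^sup>2" for t
    using nrm_mult[of "y t" "y t"] by (simp add: y2_def[abs_def] d_def power2_eq_square)
  have y3le: "nrm (y3 t) \<le> d t * (d t)\<^sup>2" for t
    using nrm_mult[of "y t" "y2 t"] mult_left_mono[OF y2le[of t] d0[of t]]
    by (simp add: y3_def[abs_def] d_def)
  \<comment> \<open>The start has norms at most 2 and is left by at most 1, hence the bound 3 and a
    move of at most 3/2 d. The constant K = 2 accounts for 1/4 = 1/(2 K) and 4 = 2 K in the
    statement.\<close>
  have step: "d (N t) \<le> 2 * (d t)\<^sup>2 \<and> (\<forall>i\<in>I. norm (N t i - t i) \<le> 2 * d t)"
    if P: "P t" and d1: "d t \<le> 1" and near: "\<forall>i\<in>I. norm (t i - t0 i) \<le> 1" for t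
  proof (intro conjI ballI)
    have "d (N t) \<le> (\<Sum>a\<in>I. \<Sum>b\<in>I. norm (y3 t a b) / 4 + 3/4 * norm (y2 t a b))"
      unfolding d_def nrm_def
    proof (intro sum_mono)
      fix a b assume "a \<in> I" "b \<in> I"
      then show "norm (y (N t) a b) \<le> norm (y3 t a b) / 4 + 3/4 * norm (y2 t a b)"
        using yN[OF P] norm_triangle_ineq4[of "scaleR (1/4) (y3 t a b)" "scaleR (3/4) (y2 t a b)"]
        by simp
    qed
    also have "\<dots> = nrm (y3 t) / 4 + 3/4 * nrm (y2 t)"
      by (simp add: nrm_def sum.distrib sum_distrib_left sum_divide_distrib)
    also have "\<dots> \<le> d t * (d t)\<^sup>2 / 4 + 3/4 * (d t)\<^sup>2"
      using y2le[of t] y3le[of t] by simp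
    also have "d t * (d t)\<^sup>2 \<le> 1 * (d t)\<^sup>2" using d1 by (intro mult_right_mono) auto
    finally have "d (N t) \<le> 1 * (d t)\<^sup>2" by simp
    also have "\<dots> \<le> 2 * (d t)\<^sup>2" by (intro mult_right_mono) auto
    finally show "d (N t) \<le> 2 * (d t)\<^sup>2" .
    fix b assume b: "b \<in> I"
    have "norm (N t b - t b) = norm (\<Sum>a\<in>I. t a * y t a b) / 2" by (simp add: N_def)
    also have "norm (\<Sum>a\<in>I. t a * y t a b) \<le> (\<Sum>a\<in>I. 3 * norm (y t a b))"
    proof (intro sum_norm_le)
      fix a assume a: "a \<in> I"
      have "norm (t a) \<le> 3"
        using norm_triangle_ineq[of "t a - t0 a" "t0 a"] near t02[OF a] a by fastforce
      then show "norm (t a * y t a b) \<le> 3 * norm (y t a b)"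
        by (meson norm_mult_ineq mult_right_mono norm_ge_zero order_trans)
    qed
    also have "\<dots> \<le> 3 * d t"
      unfolding d_def nrm_def sum_distrib_left[symmetric]
      by (intro mult_left_mono sum_mono member_le_sum) (use b I in auto)
    finally show "norm (N t b - t b) \<le> 2 * d t" using d0[of t] by simp
  qed
  have P0: "P t0" using D t0p by (auto simp: P_def)
  have delta: "\<delta> = d t0" by (simp add: defect d_def nrm_def y_def)
  obtain X l where X: "X = (\<lambda>n. (N ^^ n) t0)" "\<And>n. P (X n)"
    "\<And>i. i \<in> I \<Longrightarrow> (\<lambda>n. X n i) \<longlonglongrightarrow> l i"
    "\<And>i. i \<in> I \<Longrightarrow> norm (l i - t0 i) \<le> 2 * 2 * d t0"
    "(\<lambda>n. d (X n)) \<longlonglongrightarrow> 0"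
    by (rule newton_limit[where P = P and ?x0.0 = t0 and N = N and d = d and I = I
        and co = "\<lambda>i t. t i" and K = 2])
      (use P0 PN d0 step small in \<open>auto simp: delta\<close>)
  show thesis
  proof (rule that[of l])
    fix a assume a: "a \<in> I"
    show "l a \<in> D" using closed_sequentially[OF DD(6) _ X(3)[OF a]] X(2) a by (auto simp: P_def)
    have "(\<lambda>n. X n a * p a) \<longlonglongrightarrow> l a * p a" by (intro tendsto_intros X a)
    then show "l a * p a = l a" using X(2,3) a LIMSEQ_unique unfolding P_def by fastforce
    show "norm (l a - t0 a) \<le> 4 * \<delta>" using X(4)[OF a] by (simp add: delta)
    fix b assume b: "b \<in> I"
    have "(\<lambda>n. norm (y (X n) a b)) \<longlonglongrightarrow> 0"
      by (rule tendsto_sandwich[OF _ _ tendsto_const X(5)]) (auto simp: yle a b)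
    moreover have "(\<lambda>n. norm (y (X n) a b)) \<longlonglongrightarrow> norm (y l a b)"
      unfolding y_def by (intro tendsto_intros X a b)
    ultimately have "y l a b = 0" using LIMSEQ_unique by fastforce
    then show "star (l a) * l b = (if a = b then p a else 0)" by (simp add: y_def)
  qed
qed

text \<open>Newton's method for the polar part of \<open>1 + b\<close>, which is \<open>s \<mapsto> s (3 - s\<^sup>* s) / 2\<close> in terms of
  \<open>s = 1 + b\<close>. The step preserves \<open>s x = f s\<close> for all pairs \<open>(x, f)\<close> of a self-adjoint family.\<close>

lemma ex_unitary_near:
  fixes b0 :: "'a::cstar_algebra"
  assumes R: "\<And>x f. (x, f) \<in> R \<Longrightarrow> (star x, star f) \<in> R"
    "\<And>x f. (x, f) \<in> R \<Longrightarrow> x + b0 * x = f + f * b0"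
    and b0: "norm b0 \<le> 1/20"
  obtains b where "b + star b + star b * b = 0" "b + star b + b * star b = 0"
    "norm b \<le> 21 * norm b0" "\<And>x f. (x, f) \<in> R \<Longrightarrow> x + b * x = f + f * b"
proof -
  \<comment> \<open>For s = 1 + b with adjoint s' these are s' s - 1 and s s' - 1. Both are
    followed, because in an infinite dimensional algebra an isometry need not be unitary.\<close>
  define y where "y b = b + star b + star b * b" for b :: 'a
  define z where "z b = b + star b + b * star b" for b :: 'a
  define N where "N b = b - scaleR (1/2) (y b + b * y b)" for b
  define d where "d b = norm (y b) + norm (z b)" for b
  define P where "P b \<longleftrightarrow> (\<forall>(x, f)\<in>R. x + b * x = f + f * b)" for b
  \<comment> \<open>The same step can be written s (1 - y/2) or (1 - z/2) s. Thus \<open>N\<close>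
    commutes with \<open>star\<close>, and the recursion for \<open>z\<close> is that for
    \<open>y\<close> at the adjoint.\<close>
  have Nz: "N b = b - scaleR (1/2) (z b + z b * b)" for b
    by (simp add: N_def y_def z_def algebra_simps)
  have ystar: "star (y b) = y b" and zstar: "star (z b) = z b" for b
    by (simp_all add: y_def z_def star_simps add_ac)
  have yN: "y (N b) = scaleR (1/4) (y b * y b * y b) - scaleR (3/4) (y b * y b)" for b
  proof -
    define h where "h = scaleR (1/2) (y b)"
    have yh: "y b = h + h" by (simp add: h_def flip: scaleR_left_distrib)
    have hs: "star h = h" by (simp add: h_def star_scaleR ystar)
    have sb: "star b * b = h + h - b - star b" unfolding yh[symmetric] by (simp add: y_def)
    then have sbx: "star b * (b * x) = (h + h - b - star b) * x" for x by (metis mult.assoc)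
    have Nb: "N b = b - h - b * h"
      by (simp add: N_def h_def scaleR_right_distrib)
    have "y (N b) = (h * h * h + h * h * h) - (h * h + h * h + h * h)"
      unfolding y_def[of "N b"] unfolding Nb by (simp add: star_simps hs algebra_simps sb sbx)
    moreover have "h * h * h + h * h * h = scaleR (1/4) (y b * y b * y b)"
      "h * h + h * h + h * h = scaleR (3/4) (y b * y b)"
      by (simp_all add: h_def flip: scaleR_left_distrib)
    ultimately show ?thesis by simp
  qed
  have zy: "z b = y (star b)" for b by (simp add: z_def y_def star_simps add_ac)
  have sN: "star (N b) = N (star b)" for b
    unfolding Nz[of b] by (simp add: N_def star_simps zstar) (simp add: zy)
  have zN: "z (N b) = scaleR (1/4) (z b * z b * z b) - scaleR (3/4) (z b * z b)" for b
    unfolding zy sN yN ..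
  have norm_cubic: "norm (scaleR (1/4) (w * w * w) - scaleR (3/4) (w * w)) \<le> (norm w)\<^sup>2"
    if "norm w \<le> 1" for w :: 'a
  proof -
    have "norm (w * w * w) \<le> norm (w * w) * norm w" by (rule norm_mult_ineq)
    also have "\<dots> \<le> norm (w * w) * 1" using that by (intro mult_left_mono) auto
    finally have "norm (scaleR (1/4) (w * w * w) - scaleR (3/4) (w * w)) \<le> norm (w * w)"
      using norm_triangle_ineq4[of "scaleR (1/4) (w * w * w)" "scaleR (3/4) (w * w)"] by simp
    also have "\<dots> \<le> (norm w)\<^sup>2" by (simp add: norm_mult_ineq power2_eq_square)
    finally show ?thesis .
  qed
  have step: "d (N b) \<le> 2 * (d b)\<^sup>2 \<and> (\<forall>i\<in>{()}. norm (N b - b) \<le> 2 * d b)"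
    if d1: "d b \<le> 1" and near: "\<forall>i\<in>{()}. norm (b - b0) \<le> 1" for b
  proof -
    have "norm (y b) \<le> 1" "norm (z b) \<le> 1"
      using d1 norm_ge_zero[of "y b"] norm_ge_zero[of "z b"] unfolding d_def by linarith+
    then have "d (N b) \<le> (norm (y b))\<^sup>2 + (norm (z b))\<^sup>2"
      unfolding d_def yN zN by (intro add_mono norm_cubic)
    also have "\<dots> \<le> 2 * (d b)\<^sup>2"
      unfolding d_def by (simp add: power2_sum)
    finally have 1: "d (N b) \<le> 2 * (d b)\<^sup>2" .
    have nb: "norm b \<le> 3" using near b0 norm_triangle_ineq[of "b - b0" b0] by simp
    have "norm (N b - b) = norm (y b + b * y b) / 2" by (simp add: N_def)
    also have "\<dots> \<le> (norm (y b) + norm (b * y b)) / 2" by (simp add: norm_triangle_ineq)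
    also have "norm (b * y b) \<le> 3 * norm (y b)"
      by (meson norm_mult_ineq mult_right_mono nb norm_ge_zero order_trans)
    finally have "norm (N b - b) \<le> 2 * norm (y b)" by simp
    also have "\<dots> \<le> 2 * d b" by (simp add: d_def)
    finally show ?thesis using 1 by simp
  qed
  \<comment> \<open>Each of the two defects is at most 5/2 norm b0. With K = 2 this explains 1/20,
    since 2 * 5 / 20 = 1/2, and 21 = 4 * 5 + 1.\<close>
  have db0: "d b0 \<le> 5 * norm b0"
  proof -
    have "norm b0 * norm b0 \<le> norm b0 * (1/2)" using b0 by (intro mult_left_mono) auto
    then have "norm (star b0 * b0) \<le> norm b0 / 2" "norm (b0 * star b0) \<le> norm b0 / 2"
      using cstar_identity[of b0] norm_mult_star_self[of b0] by (auto simp: power2_eq_square)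
    moreover have "norm (y b0) \<le> norm b0 + norm (star b0) + norm (star b0 * b0)"
      "norm (z b0) \<le> norm b0 + norm (star b0) + norm (b0 * star b0)"
      unfolding y_def z_def by (meson norm_triangle_mono norm_triangle_ineq order_refl)+
    ultimately show ?thesis by (simp add: d_def)
  qed
  have P0: "P b0" using R(2) by (auto simp: P_def)
  have PN: "P (N b)" if P: "P b" for b
    unfolding P_def
  proof clarify
    fix x f assume xf: "(x, f) \<in> R"
    have 1: "b * x = f + f * b - x" using P xf by (fastforce simp: P_def eq_diff_eq add.commute)
    \<comment> \<open>The relation for the adjoint pair becomes x s' = s' f after taking adjoints.
      Together with s x = f s it gives s' s x = s' f s = x s' s, so \<open>y b\<close> commutes with
      x and the correction factor 1 - y/2 can be moved past x.\<close>
    have "star x + b * star x = star f + star f * b" using P R(1)[OF xf] by (auto simp: P_def)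
    then have "star (star x + b * star x) = star (star f + star f * b)" by simp
    then have "x + x * star b = f + star b * f" by (simp add: star_simps)
    then have 2: "star b * f = x + x * star b - f" by (simp add: eq_diff_eq add.commute)
    have bx: "b * (x * c) = (f + f * b - x) * c" and sf: "star b * (f * c) = (x + x * star b - f) * c"
      for c using 1 2 by (metis mult.assoc)+
    have comm: "y b * x = x * y b"
      by (simp add: y_def distrib_left distrib_right left_diff_distrib right_diff_distrib
          mult.assoc 1 2 sf)
    have "N b * x = b * x - scaleR (1/2) (x * y b + b * (x * y b))"
      by (simp add: N_def left_diff_distrib distrib_right mult.assoc comm)
    also have "\<dots> = b * x - scaleR (1/2) (f * y b + f * (b * y b))"
      unfolding bx by (simp add: left_diff_distrib distrib_right mult.assoc)
    also have "\<dots> = f + f * N b - x"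
      unfolding 1 by (simp add: N_def right_diff_distrib distrib_left)
    finally show "x + N b * x = f + f * N b" by simp
  qed
  obtain X l where X: "X = (\<lambda>n. (N ^^ n) b0)" "\<And>n. P (X n)"
    "\<And>i. i \<in> {()} \<Longrightarrow> X \<longlonglongrightarrow> l i"
    "\<And>i. i \<in> {()} \<Longrightarrow> norm (l i - b0) \<le> 2 * 2 * d b0"
    "(\<lambda>n. d (X n)) \<longlonglongrightarrow> 0"
    by (rule newton_limit[where P = P and ?x0.0 = b0 and N = N and d = d and I = "{()}"
        and co = "\<lambda>_ x. x" and K = 2])
      (use P0 PN step db0 b0 in \<open>auto simp: d_def\<close>)
  have l: "X \<longlonglongrightarrow> l ()" using X(3) by simp
  have y0: "(\<lambda>n. norm (y (X n))) \<longlonglongrightarrow> 0" and z0: "(\<lambda>n. norm (z (X n))) \<longlonglongrightarrow> 0"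
    by (rule tendsto_sandwich[OF _ _ tendsto_const X(5)]; simp add: d_def)+
  have "(\<lambda>n. norm (y (X n))) \<longlonglongrightarrow> norm (y (l ()))" "(\<lambda>n. norm (z (X n))) \<longlonglongrightarrow> norm (z (l ()))"
    unfolding y_def z_def by (intro tendsto_intros l)+
  with y0 z0 have "y (l ()) = 0" "z (l ()) = 0" using LIMSEQ_unique by fastforce+
  moreover have "norm (l ()) \<le> 21 * norm b0"
    using X(4)[of "()"] db0 norm_triangle_ineq[of "l () - b0" b0] by simp
  moreover have "x + l () * x = f + f * l ()" if "(x, f) \<in> R" for x f
  proof (rule LIMSEQ_unique)
    show "(\<lambda>n. x + X n * x) \<longlonglongrightarrow> x + l () * x" by (intro tendsto_intros l)
    have "(\<lambda>n. f + f * X n) \<longlonglongrightarrow> f + f * l ()" by (intro tendsto_intros l)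
    moreover have "f + f * X n = x + X n * x" for n using X(2)[of n] that by (auto simp: P_def)
    ultimately show "(\<lambda>n. x + X n * x) \<longlonglongrightarrow> f + f * l ()" by simp
  qed
  ultimately show thesis using that[of "l ()"] by (simp add: y_def z_def)
qed

section \<open>Perturbation into a dense union of subalgebras\<close>

text \<open>Turns approximations for every \<eta> into sequences that satisfy \<open>Q\<close>
  throughout and converge. The smallness conditions of the correction lemmas then follow from
  continuity instead of explicit error estimates.\<close>

lemma seq_from_approx:
  fixes F :: "'i \<Rightarrow> 's \<Rightarrow> 'b::real_normed_vector"
  assumes "\<And>\<eta>. 0 < \<eta> \<Longrightarrow> \<exists>x. Q x \<and> (\<forall>a\<in>I. norm (F a x - l a) < (\<eta>::real))"
  shows "\<exists>X :: nat \<Rightarrow> 's. (\<forall>n. Q (X n)) \<and> (\<forall>a\<in>I. (\<lambda>n. F a (X n)) \<longlonglongrightarrow> l a)"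
proof -
  have "\<forall>n. \<exists>x. Q x \<and> (\<forall>a\<in>I. norm (F a x - l a) < 1 / real (Suc n))"
    by (intro allI assms) simp
  then obtain X where X: "\<And>n. Q (X n)" "\<And>n a. a \<in> I \<Longrightarrow> norm (F a (X n) - l a) < 1 / real (Suc n)"
    by metis
  have "(\<lambda>n. F a (X n)) \<longlonglongrightarrow> l a" if "a \<in> I" for a
  proof -
    have "(\<lambda>n. 1 / real (Suc n)) \<longlonglongrightarrow> 0" by (rule LIMSEQ_Suc[OF lim_1_over_n])
    then have "(\<lambda>n. norm (F a (X n) - l a)) \<longlonglongrightarrow> 0"
      by (intro tendsto_sandwich[OF _ _ tendsto_const \<open>_ \<longlonglongrightarrow> 0\<close>])
        (use X(2)[OF that] in \<open>auto intro!: always_eventually less_imp_le\<close>)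
    then show ?thesis using LIM_zero_iff tendsto_norm_zero_iff by blast
  qed
  then show ?thesis using X(1) by blast
qed

text \<open>An index \<open>a\<close> stands for a row of a block and \<open>e a\<close> for the
  matrix unit of that row in column 0: \<open>blk a\<close> is the block, \<open>q\<close> gives its
  minimal projection, and \<open>base\<close> the index of row 0. All matrix units are products
  \<open>e a * star (e a')\<close>, so it is enough to correct the columns. The last conclusion says
  that conjugation by 1 + b moves each of these products into \<open>D m\<close>.\<close>

lemma ex_small_unitary_into_union:
  fixes e :: "'i \<Rightarrow> 'b::cstar_algebra" and blk :: "'i \<Rightarrow> 'j" and base :: "'j \<Rightarrow> 'i" and q :: "'j \<Rightarrow> 'b" and D :: "nat \<Rightarrow> 'b set"
  assumes I: "finite I"
    and e: "\<And>a b. a \<in> I \<Longrightarrow> b \<in> I \<Longrightarrow> star (e a) * e b = (if a = b then q (blk a) else 0)"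
    and q: "\<And>a. a \<in> I \<Longrightarrow> star (q (blk a)) = q (blk a)"
      "\<And>a. a \<in> I \<Longrightarrow> q (blk a) * q (blk a) = q (blk a)"
    and base: "\<And>a. a \<in> I \<Longrightarrow> base (blk a) \<in> I"
      "\<And>a. a \<in> I \<Longrightarrow> e (base (blk a)) = q (blk a)"
    and D: "\<And>m. cstar_subalgebra (D m)" "\<And>m. D m \<subseteq> D (Suc m)" "closure (\<Union>m. D m) = UNIV"
    and \<epsilon>: "0 < \<epsilon>"
  obtains b m where "b + star b + star b * b = 0" "b + star b + b * star b = 0" "norm b < \<epsilon>"
    "\<And>a a' x. a \<in> I \<Longrightarrow> a' \<in> I \<Longrightarrow> blk a = blk a' \<Longrightarrow> x = e a * star (e a') \<Longrightarrow>
      x + b * x + x * star b + b * x * star b \<in> D m"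
proof -
  note DD = cstar_subalgebraD[OF D(1)]
  have Dmono: "D m \<subseteq> D n" if "m \<le> n" for m n
    using D(2) that by (rule lift_Suc_mono_le)
  have qnorm: "norm (q (blk a)) \<le> 1" if "a \<in> I" for a
    using q[OF that] by (rule norm_projection_le_1)
  \<comment> \<open>The difference w of the two sides satisfies
    \<open>star w * w = 0\<close>.\<close>
  have eq: "e a * q (blk a) = e a" if a: "a \<in> I" for a
  proof -
    have "star (e a * q (blk a) - e a) * (e a * q (blk a) - e a) =
        q (blk a) * (star (e a) * e a) * q (blk a) - q (blk a) * (star (e a) * e a)
        - (star (e a) * e a) * q (blk a) + star (e a) * e a"
      by (simp add: star_simps q a algebra_simps)
    also have "\<dots> = 0" using a by (simp add: e q)
    finally show ?thesis by (simp add: star_mult_self_eq_0_iff)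
  qed
  have enorm: "norm (e a) \<le> 1" if "a \<in> I" for a
  proof -
    have "(norm (e a))\<^sup>2 \<le> 1\<^sup>2" using qnorm[OF that] e[OF that that] cstar_identity[of "e a"] by simp
    then show ?thesis by (rule power2_le_imp_le) simp
  qed
  have stage1: "\<exists>mt. (\<forall>a\<in>I. snd mt a \<in> D (fst mt)) \<and> (\<forall>a\<in>I. norm (snd mt a - e a) < \<eta>)"
    if "0 < \<eta>" for \<eta>
  proof -
    have "\<exists>y m. y \<in> D m \<and> norm (y - e a) < \<eta>" for a
    proof -
      have "e a \<in> closure (\<Union>m. D m)" using D(3) by simp
      then show ?thesis using that unfolding closure_approachable dist_norm by blast
    qed
    then obtain t m where t: "\<And>a. t a \<in> D (m a)" "\<And>a. norm (t a - e a) < \<eta>" by metis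
    define M where "M = Max (m ` I)"
    have "t a \<in> D M" if "a \<in> I" for a
    proof -
      have "m a \<le> M" unfolding M_def using that I by (intro Max_ge) auto
      then show ?thesis using t(1)[of a] Dmono by blast
    qed
    then show ?thesis using t(2) by (intro exI[of _ "(M, t)"]) auto
  qed
  \<comment> \<open>The triple is (m, approximate columns, exact projections). The projections are
    made exact before the columns, because the correction of the columns needs prescribed values for
    \<open>star t * t\<close>.\<close>
  define Q2 where "Q2 x \<longleftrightarrow> (\<forall>a\<in>I. fst (snd x) a \<in> D (fst x) \<and> snd (snd x) (blk a) \<in> D (fst x) \<and>
        star (snd (snd x) (blk a)) = snd (snd x) (blk a) \<and>
        snd (snd x) (blk a) * snd (snd x) (blk a) = snd (snd x) (blk a))"
    for x :: "nat \<times> ('i \<Rightarrow> 'b) \<times> ('j \<Rightarrow> 'b)"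
  have stage2: "\<exists>x. Q2 x \<and>
      (\<forall>a\<in>I. norm ((fst (snd x) a, snd (snd x) (blk a)) - (e a, q (blk a))) < \<eta>)"
    if \<eta>: "0 < \<eta>" for \<eta>
  proof -
    obtain mt where mt: "\<And>n. \<forall>a\<in>I. snd (mt n) a \<in> D (fst (mt n))"
      "\<And>a. a \<in> I \<Longrightarrow> (\<lambda>n. snd (mt n) a) \<longlonglongrightarrow> e a"
      using seq_from_approx[where Q = "\<lambda>mt. \<forall>a\<in>I. snd mt a \<in> D (fst mt)"
          and F = "\<lambda>a mt. snd mt a" and l = e and I = I, OF stage1] by auto
    \<comment> \<open>The self-adjoint part of the approximant of \<open>q j\<close>, which is
      itself the column with index \<open>base j\<close>.\<close>
    define A where "A n j = scaleR (1/2) (snd (mt n) (base j) + star (snd (mt n) (base j)))" for n j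
    have A: "star (A n j) = A n j" for n j by (simp add: A_def star_simps add.commute)
    have AD: "A n (blk a) \<in> D (fst (mt n))" if "a \<in> I" for n a
      using mt(1)[of n] base(1)[OF that] by (simp add: A_def DD)
    have Alim: "(\<lambda>n. A n (blk a)) \<longlonglongrightarrow> q (blk a)" if a: "a \<in> I" for a
    proof -
      have "(\<lambda>n. A n (blk a)) \<longlonglongrightarrow> scaleR (1/2) (q (blk a) + star (q (blk a)))"
        unfolding A_def base(2)[OF a, symmetric] by (intro tendsto_intros mt base a)
      then show ?thesis using q(1)[OF a] by (simp flip: scaleR_2)
    qed
    have defect: "(\<lambda>n. norm (A n (blk a) - A n (blk a) * A n (blk a))) \<longlonglongrightarrow> 0" if a: "a \<in> I" for a
    proof -
      have "(\<lambda>n. norm (A n (blk a) - A n (blk a) * A n (blk a))) \<longlonglongrightarrow>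
          norm (q (blk a) - q (blk a) * q (blk a))"
        by (intro tendsto_intros Alim a)
      then show ?thesis using q(2)[OF a] by simp
    qed
    have "eventually (\<lambda>n. \<forall>a\<in>I. norm (A n (blk a)) < 2 \<and>
        norm (A n (blk a) - A n (blk a) * A n (blk a)) < 1/102 \<and>
        norm (A n (blk a) - q (blk a)) + 102 * norm (A n (blk a) - A n (blk a) * A n (blk a)) < \<eta> / 2 \<and>
        norm (snd (mt n) a - e a) < \<eta> / 2) sequentially"
    proof (intro eventually_ball_finite I ballI eventually_conj)
      fix a assume a: "a \<in> I"
      show "eventually (\<lambda>n. norm (A n (blk a)) < 2) sequentially"
        by (rule order_tendstoD(2)[OF tendsto_norm[OF Alim[OF a]]]) (use qnorm[OF a] in simp)
      show "eventually (\<lambda>n. norm (A n (blk a) - A n (blk a) * A n (blk a)) < 1/102) sequentially"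
        by (rule order_tendstoD(2)[OF defect[OF a]]) simp
      have "(\<lambda>n. norm (A n (blk a) - q (blk a)) + 102 * norm (A n (blk a) - A n (blk a) * A n (blk a)))
          \<longlonglongrightarrow> norm (q (blk a) - q (blk a)) + 102 * 0"
        by (intro tendsto_intros Alim defect a)
      then show "eventually (\<lambda>n. norm (A n (blk a) - q (blk a)) +
          102 * norm (A n (blk a) - A n (blk a) * A n (blk a)) < \<eta> / 2) sequentially"
        using \<eta> by (intro order_tendstoD(2)) auto
      have "(\<lambda>n. norm (snd (mt n) a - e a)) \<longlonglongrightarrow> norm (e a - e a)"
        by (intro tendsto_intros mt a)
      then show "eventually (\<lambda>n. norm (snd (mt n) a - e a) < \<eta> / 2) sequentially"
        using \<eta> by (intro order_tendstoD(2)) auto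
    qed
    then obtain n where n: "\<And>a. a \<in> I \<Longrightarrow> norm (A n (blk a)) < 2"
      "\<And>a. a \<in> I \<Longrightarrow> norm (A n (blk a) - A n (blk a) * A n (blk a)) < 1/102"
      "\<And>a. a \<in> I \<Longrightarrow> norm (A n (blk a) - q (blk a)) + 102 * norm (A n (blk a) - A n (blk a) * A n (blk a)) < \<eta> / 2"
      "\<And>a. a \<in> I \<Longrightarrow> norm (snd (mt n) a - e a) < \<eta> / 2"
      using eventually_happens by fastforce
    define m where "m = fst (mt n)"
    have "\<exists>p. p \<in> D m \<and> star p = p \<and> p * p = p \<and> norm (p - q j) < \<eta> / 2" if j: "j \<in> blk ` I" for j
    proof -
      obtain a where a: "a \<in> I" "j = blk a" using j by blast
      obtain p where p: "p \<in> D m" "star p = p" "p * p = p"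
        "norm (p - A n j) \<le> 102 * norm (A n j - A n j * A n j)"
        using ex_projection_near[of "D m" "A n j"] D(1) AD[OF a(1), of n] A n(1,2)[OF a(1)] a(2)
        unfolding m_def by (metis less_imp_le)
      have "norm (p - q j) \<le> norm (p - A n j) + norm (A n j - q j)"
        using norm_triangle_ineq[of "p - A n j" "A n j - q j"] by simp
      also have "\<dots> < \<eta> / 2" using p(4) n(3)[OF a(1)] a(2) by simp
      finally show ?thesis using p by blast
    qed
    then obtain p where p: "\<And>a. a \<in> I \<Longrightarrow> p (blk a) \<in> D m \<and> star (p (blk a)) = p (blk a) \<and>
        p (blk a) * p (blk a) = p (blk a) \<and> norm (p (blk a) - q (blk a)) < \<eta> / 2"
      by (metis imageI)
    have "norm ((snd (mt n) a, p (blk a)) - (e a, q (blk a))) < \<eta>" if a: "a \<in> I" for a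
    proof -
      have "norm (snd (mt n) a - e a, p (blk a) - q (blk a)) \<le>
          norm (snd (mt n) a - e a) + norm (p (blk a) - q (blk a))"
        by (rule norm_Pair_le)
      also have "\<dots> < \<eta>" using p[OF a] n(4)[OF a] by simp
      finally show ?thesis by simp
    qed
    then show ?thesis using p mt(1)[of n]
      by (intro exI[of _ "(m, snd (mt n), p)"]) (auto simp: m_def Q2_def)
  qed
  \<comment> \<open>The projections are no longer listed. Within a block, \<open>star t * t\<close>
    for any column t is a right unit of all columns, and together with orthogonality this is what
    the intertwining argument uses.\<close>
  define Q3 where "Q3 x \<longleftrightarrow> (\<forall>a\<in>I. snd x a \<in> D (fst x)) \<and>
        (\<forall>a\<in>I. \<forall>b\<in>I. (blk a = blk b \<longrightarrow> snd x a * (star (snd x b) * snd x b) = snd x a) \<and>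
        (a \<noteq> b \<longrightarrow> star (snd x a) * snd x b = 0))"
    for x :: "nat \<times> ('i \<Rightarrow> 'b)"
  have stage3: "\<exists>x. Q3 x \<and>
      (\<forall>a\<in>I. norm (snd x a - e a) < \<eta>)"
    if \<eta>: "0 < \<eta>" for \<eta>
  proof -
    obtain X where X2: "\<And>n. Q2 (X n)"
      "\<And>a. a \<in> I \<Longrightarrow> (\<lambda>n. (fst (snd (X n)) a, snd (snd (X n)) (blk a))) \<longlonglongrightarrow> (e a, q (blk a))"
      using seq_from_approx[where F = "\<lambda>a x. (fst (snd x) a, snd (snd x) (blk a))"
          and l = "\<lambda>a. (e a, q (blk a))" and I = I and Q = Q2, OF stage2] by auto
    note X = X2(1)[unfolded Q2_def] X2(2)
    define m where "m n = fst (X n)" for n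
    define p where "p n a = snd (snd (X n)) (blk a)" for n a
    \<comment> \<open>Cutting down by \<open>p\<close> arranges t p = t, as the correction lemma
      demands; the limit is unchanged because e q = e.\<close>
    define t where "t n a = fst (snd (X n)) a * p n a" for n a
    have pD: "p n a \<in> D (m n)" "star (p n a) = p n a" "p n a * p n a = p n a" if "a \<in> I" for n a
      using X(1)[of n] that by (auto simp: p_def m_def)
    have pblk: "p n a = p n b" if "blk a = blk b" for n a b using that by (simp add: p_def)
    have tD: "t n a \<in> D (m n)" "t n a * p n a = t n a" if "a \<in> I" for n a
      using X(1)[of n] pD that by (auto simp: t_def m_def DD mult.assoc)
    have plim: "(\<lambda>n. p n a) \<longlonglongrightarrow> q (blk a)" if "a \<in> I" for a
      using tendsto_snd[OF X(2)[OF that]] by (simp add: p_def)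
    have tlim: "(\<lambda>n. t n a) \<longlonglongrightarrow> e a" if a: "a \<in> I" for a
    proof -
      have "(\<lambda>n. fst (snd (X n)) a) \<longlonglongrightarrow> e a" using tendsto_fst[OF X(2)[OF a]] by simp
      from tendsto_mult[OF this plim[OF a]] show ?thesis by (simp add: t_def eq a)
    qed
    define \<delta> where "\<delta> n = (\<Sum>a\<in>I. \<Sum>b\<in>I. norm (star (t n a) * t n b - (if a = b then p n a else 0)))" for n
    have \<delta>lim: "\<delta> \<longlonglongrightarrow> 0"
    proof -
      have "\<delta> \<longlonglongrightarrow> (\<Sum>a\<in>I. \<Sum>b\<in>I. norm (star (e a) * e b - (if a = b then q (blk a) else 0)))"
        unfolding \<delta>_def
      proof (intro tendsto_sum tendsto_norm tendsto_diff tendsto_mult tendsto_star tlim)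
        fix a b assume "a \<in> I" "b \<in> I"
        then show "(\<lambda>n. if a = b then p n a else 0) \<longlonglongrightarrow> (if a = b then q (blk a) else 0)"
          using plim by (cases "a = b") auto
      qed
      also have "(\<Sum>a\<in>I. \<Sum>b\<in>I. norm (star (e a) * e b - (if a = b then q (blk a) else 0))) = 0"
        by (intro sum.neutral ballI) (use e in auto)
      finally show ?thesis .
    qed
    have "eventually (\<lambda>n. \<delta> n < 1/4 \<and> (\<forall>a\<in>I. norm (t n a) < 2 \<and> 4 * \<delta> n + norm (t n a - e a) < \<eta>)) sequentially"
    proof (intro eventually_conj eventually_ball_finite I ballI)
      show "eventually (\<lambda>n. \<delta> n < 1/4) sequentially" by (rule order_tendstoD(2)[OF \<delta>lim]) simp
      fix a assume a: "a \<in> I"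
      show "eventually (\<lambda>n. norm (t n a) < 2) sequentially"
        by (rule order_tendstoD(2)[OF tendsto_norm[OF tlim[OF a]]]) (use enorm[OF a] in simp)
      have "(\<lambda>n. 4 * \<delta> n + norm (t n a - e a)) \<longlonglongrightarrow> 4 * 0 + norm (e a - e a)"
        by (intro tendsto_intros \<delta>lim tlim a)
      then show "eventually (\<lambda>n. 4 * \<delta> n + norm (t n a - e a) < \<eta>) sequentially"
        using \<eta> by (intro order_tendstoD(2)) auto
    qed
    then obtain n where n: "\<delta> n < 1/4" "\<And>a. a \<in> I \<Longrightarrow> norm (t n a) < 2"
      "\<And>a. a \<in> I \<Longrightarrow> 4 * \<delta> n + norm (t n a - e a) < \<eta>"
      using eventually_happens by fastforce
    obtain s where s: "\<And>a. a \<in> I \<Longrightarrow> s a \<in> D (m n)" "\<And>a. a \<in> I \<Longrightarrow> s a * p n a = s a"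
      "\<And>a b. a \<in> I \<Longrightarrow> b \<in> I \<Longrightarrow> star (s a) * s b = (if a = b then p n a else 0)"
      "\<And>a. a \<in> I \<Longrightarrow> norm (s a - t n a) \<le> 4 * \<delta> n"
      by (rule ex_partial_isometries_near[where ?t0.0 = "t n" and p = "p n" and D = "D (m n)" and I = I])
        (use I D(1) pD tD n in \<open>auto simp: \<delta>_def less_imp_le\<close>)
    have "norm (s a - e a) < \<eta>" if "a \<in> I" for a
    proof -
      have "norm (s a - e a) \<le> norm (s a - t n a) + norm (t n a - e a)"
        using norm_triangle_ineq[of "s a - t n a" "t n a - e a"] by simp
      also have "\<dots> < \<eta>" using s(4)[OF that] n(3)[OF that] by simp
      finally show ?thesis .
    qed
    moreover have "s a * (star (s b) * s b) = s a" if "a \<in> I" "b \<in> I" "blk a = blk b" for a b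
      using s(2)[OF that(1)] s(3)[OF that(2,2)] pblk[OF that(3)] by simp
    then have "Q3 (m n, s)" using s(1,3) by (auto simp: Q3_def)
    ultimately show ?thesis by (intro exI[of _ "(m n, s)"]) simp
  qed
  obtain X where X: "\<And>n. Q3 (X n)" "\<And>a. a \<in> I \<Longrightarrow> (\<lambda>n. snd (X n) a) \<longlonglongrightarrow> e a"
    using seq_from_approx[where F = "\<lambda>a x. snd x a" and l = e and I = I and Q = Q3, OF stage3] by auto
  define t where "t n = snd (X n)" for n
  have tlim: "(\<lambda>n. t n a) \<longlonglongrightarrow> e a" if "a \<in> I" for a using X(2)[OF that] by (simp add: t_def)
  have tD: "t n a \<in> D (fst (X n))" if "a \<in> I" for n a using X(1)[of n] that by (auto simp: t_def Q3_def)
  have tp: "t n a * (star (t n b) * t n b) = t n a" if "a \<in> I" "b \<in> I" "blk a = blk b" for n a b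
    using X(1)[of n] that by (auto simp: t_def Q3_def)
  have tt: "star (t n a) * t n b = 0" if "a \<in> I" "b \<in> I" "a \<noteq> b" for n a b
    using X(1)[of n] that by (auto simp: t_def Q3_def)
  define e0 where "e0 = (\<Sum>a\<in>I. e a * star (e a))"
  define f where "f n = (\<Sum>a\<in>I. t n a * star (t n a))" for n
  \<comment> \<open>\<open>e0\<close> and \<open>f n\<close> are the units of the two systems of
    matrix units, and 1 + b0 is \<Sum> t e' + (1 - f)(1 - e0) with e' the adjoint of e, multiplied
    out so that no unit occurs. It intertwines the systems and tends to 1 because \<open>f\<close>
    tends to \<open>e0\<close>.\<close>
  define b0 where "b0 n = (\<Sum>a\<in>I. t n a * star (e a)) - f n - e0 + f n * e0" for n
  have qe: "q (blk a) * star (e a) = star (e a)" if "a \<in> I" for a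
    using eq[OF that] q[OF that] by (metis star_mult)
  have e0e: "e0 * e a = e a" if a: "a \<in> I" for a
  proof -
    have "e0 * e a = (\<Sum>b\<in>I. if b = a then e a else 0)"
      unfolding e0_def sum_distrib_right by (intro sum.cong) (auto simp: mult.assoc e eq a)
    then show ?thesis using I a by simp
  qed
  have e0e0: "e0 * e0 = e0"
    unfolding e0_def[of] sum_distrib_left
    by (intro sum.cong refl) (simp add: e0e e0_def[symmetric] mult.assoc[symmetric])
  have "b0 \<longlonglongrightarrow> (\<Sum>a\<in>I. e a * star (e a)) - e0 - e0 + e0 * e0"
    unfolding b0_def f_def e0_def by (intro tendsto_intros tlim)
  then have "b0 \<longlonglongrightarrow> 0" by (simp add: e0e0 flip: e0_def)
  then have b0lim: "(\<lambda>n. norm (b0 n)) \<longlonglongrightarrow> 0" by (simp add: tendsto_norm_zero)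
  \<comment> \<open>1/20 is what the polar correction requires and 21 is the factor it
    loses.\<close>
  have "eventually (\<lambda>n. norm (b0 n) < min (1/20) (\<epsilon> / 21)) sequentially"
    by (rule order_tendstoD(2)[OF b0lim]) (use \<epsilon> in auto)
  then obtain n where n: "norm (b0 n) < 1/20" "norm (b0 n) < \<epsilon> / 21"
    using eventually_happens by fastforce
  define R where "R = {(e a * star (e a'), t n a * star (t n a')) | a a'. a \<in> I \<and> a' \<in> I \<and> blk a = blk a'}"
  have sf: "star (t n a) * f n = star (t n a)" if a: "a \<in> I" for a
  proof -
    have "star (t n a) * f n = (\<Sum>b\<in>I. if b = a then star (t n a) * t n a * star (t n a) else 0)"
      unfolding f_def sum_distrib_left by (intro sum.cong) (auto simp: mult.assoc[symmetric] tt a)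
    also have "\<dots> = star (t n a * (star (t n a) * t n a))" using I a by (simp add: star_simps mult.assoc)
    finally show ?thesis using tp[OF a a] by simp
  qed
  \<comment> \<open>Both sides equal \<open>t n a * star (e a')\<close>: on the left 1 + b0 meets
    the column \<open>e a\<close>, on the right it meets the adjoint of
    \<open>t n a'\<close>.\<close>
  have inter: "x + b0 n * x = g + g * b0 n" if xg: "(x, g) \<in> R" for x g
  proof -
    obtain a a' where a: "a \<in> I" "a' \<in> I" "blk a = blk a'"
      and x: "x = e a * star (e a')" and g: "g = t n a * star (t n a')"
      using xg by (auto simp: R_def)
    have "(\<Sum>b\<in>I. t n b * star (e b)) * e a = (\<Sum>b\<in>I. if b = a then t n a * q (blk a) else 0)"
      unfolding sum_distrib_right by (intro sum.cong) (auto simp: mult.assoc e a)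
    then have 1: "(\<Sum>b\<in>I. t n b * star (e b)) * e a = t n a * q (blk a)" using I a by simp
    have "(b0 n) * e a = t n a * q (blk a) - e a"
      unfolding b0_def by (simp add: distrib_right left_diff_distrib 1 e0e mult.assoc a)
    then have "b0 n * x = t n a * q (blk a) * star (e a') - x"
      unfolding x by (simp add: mult.assoc[symmetric] left_diff_distrib)
    then have L: "x + b0 n * x = t n a * star (e a')"
      using qe[OF a(2)] a(3) by (simp add: mult.assoc)
    have "star (t n a') * (\<Sum>b\<in>I. t n b * star (e b)) =
        (\<Sum>b\<in>I. if b = a' then star (t n a') * t n a' * star (e a') else 0)"
      unfolding sum_distrib_left by (intro sum.cong) (auto simp: mult.assoc[symmetric] tt a)
    then have 2: "star (t n a') * (\<Sum>b\<in>I. t n b * star (e b)) = star (t n a') * t n a' * star (e a')"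
      using I a by simp
    have "star (t n a') * b0 n = star (t n a') * t n a' * star (e a') - star (t n a')"
      unfolding b0_def
      by (simp add: distrib_left right_diff_distrib 2 sf a mult.assoc[symmetric])
    then have "g * b0 n = t n a * (star (t n a') * t n a' * star (e a')) - g"
      unfolding g by (simp add: mult.assoc right_diff_distrib)
    also have "t n a * (star (t n a') * t n a' * star (e a')) = t n a * star (e a')"
      using tp[OF a] by (simp add: mult.assoc[symmetric])
    finally show ?thesis using L by simp
  qed
  obtain b where b: "b + star b + star b * b = 0" "b + star b + b * star b = 0"
    "norm b \<le> 21 * norm (b0 n)" "\<And>x g. (x, g) \<in> R \<Longrightarrow> x + b * x = g + g * b"
  proof (rule ex_unitary_near[where ?b0.0 = "b0 n" and R = R])
    show "(star x, star g) \<in> R" if "(x, g) \<in> R" for x g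
      using that by (auto simp: R_def star_simps) metis
  qed (use inter n in auto)
  show thesis
  proof (rule that[of b "fst (X n)"])
    fix a a' x assume a: "a \<in> I" "a' \<in> I" "blk a = blk a'" and x: "x = e a * star (e a')"
    define g where "g = t n a * star (t n a')"
    have "(x, g) \<in> R" using a x by (auto simp: R_def g_def)
    from b(4)[OF this] have bx: "x + b * x = g + g * b" .
    \<comment> \<open>With a prime for the adjoint, this is (1 + b) x (1 + b)' = g (1 + b)(1 + b)' =
      g.\<close>
    have "x + b * x + x * star b + b * x * star b = (x + b * x) + (x + b * x) * star b"
      by (simp add: distrib_right)
    also have "\<dots> = g + g * (b + star b + b * star b)"
      unfolding bx by (simp add: distrib_left distrib_right mult.assoc)
    also have "\<dots> = g" by (simp add: b)
    finally show "x + b * x + x * star b + b * x * star b \<in> D (fst (X n))"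
      using tD a by (simp add: g_def DD)
  qed (use b n in auto)
qed

section \<open>Finite dimensional C*-algebras\<close>

lemma mat_adjoint_carrier: "A \<in> carrier_mat n m \<Longrightarrow> mat_adjoint A \<in> carrier_mat m n"
  by (auto simp: mat_adjoint_def)

lemma mat_adjoint_index:
  "i < dim_col A \<Longrightarrow> j < dim_row A \<Longrightarrow> mat_adjoint A $$ (i, j) = cnj ((A :: complex mat) $$ (j, i))"
  by (auto simp: mat_adjoint_def mat_of_rows_def)

lemma sum_delta_mult:
  fixes f :: "nat \<Rightarrow> 'a::semiring_1"
  shows "(\<Sum>m<n. (if m = l then 1 else 0) * f m) = (if l < n then f l else 0)"
    "(\<Sum>m<n. (if l = m then 1 else 0) * f m) = (if l < n then f l else 0)"
    "(\<Sum>m<n. f m * (if m = l then 1 else 0)) = (if l < n then f l else 0)"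
    "(\<Sum>m<n. f m * (if l = m then 1 else 0)) = (if l < n then f l else 0)"
  by (auto simp: if_distrib[of "\<lambda>x. x * _"] if_distrib[of "\<lambda>x. _ * x"] cong: if_cong)

text \<open>Fewer equations than unknowns. After padding with zero rows to a square matrix, row
  \<open>s\<close> vanishes, so the transpose kills the unit vector \<open>s\<close> and the
  determinant is 0.\<close>

lemma ex_kernel_vector:
  fixes M :: "nat \<Rightarrow> nat \<Rightarrow> complex"
  assumes "s < r"
  obtains c where "\<exists>a<r. c a \<noteq> 0" "\<And>b. b < s \<Longrightarrow> (\<Sum>a<r. M b a * c a) = 0"
proof -
  define A where "A = mat r r (\<lambda>(b, a). if b < s then M b a else 0)"
  have A: "A \<in> carrier_mat r r" by (simp add: A_def)
  have "A\<^sup>T *\<^sub>v unit_vec r s = 0\<^sub>v r"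
    using assms by (intro eq_vecI) (auto simp: A_def)
  moreover have "unit_vec r s \<noteq> (0\<^sub>v r :: complex vec)" using assms by simp
  ultimately have "det (A\<^sup>T) = 0"
    using A by (subst det_0_iff_vec_prod_zero[of _ r]) (auto intro!: exI[of _ "unit_vec r s"])
  then have "det A = 0" using det_transpose[OF A] by simp
  then obtain v where v: "v \<in> carrier_vec r" "v \<noteq> 0\<^sub>v r" "A *\<^sub>v v = 0\<^sub>v r"
    using det_0_iff_vec_prod_zero[OF A] by blast
  show thesis
  proof (rule that[of "\<lambda>a. v $ a"])
    show "\<exists>a<r. v $ a \<noteq> 0"
      using v(1,2) by (metis carrier_vecD eq_vecI index_zero_vec(1) index_zero_vec(2))
    fix b assume b: "b < s"
    have "(A *\<^sub>v v) $ b = (\<Sum>a<r. M b a * v $ a)"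
      using b assms v(1) by (auto simp: A_def scalar_prod_def lessThan_atLeast0 intro!: sum.cong)
    then show "(\<Sum>a<r. M b a * v $ a) = 0" using v(3) b assms by simp
  qed
qed

section \<open>Coordinates, matrix units and traces of a finite dimensional algebra\<close>

locale fd_alg =
  fixes S :: "'a::cstar_algebra set" and V :: "nat vec" and \<chi> :: "'a \<Rightarrow> complex mat list"
  assumes sub: "cstar_subalgebra S" and iso: "star_iso_onto S V \<chi>" and pos: "positive_vec V"
begin

lemmas S_simps [simp] = cstar_subalgebraD[OF sub]

definition ent :: "nat \<Rightarrow> nat \<Rightarrow> nat \<Rightarrow> 'a \<Rightarrow> complex" where
  "ent i k l x = (\<chi> x ! i) $$ (k, l)"

definition of_ent :: "(nat \<Rightarrow> nat \<Rightarrow> nat \<Rightarrow> complex) \<Rightarrow> 'a" where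
  "of_ent f = inv_into S \<chi> (map (\<lambda>i. mat (V $ i) (V $ i) (\<lambda>(k, l). f i k l)) [0..<dim_vec V])"

definition mu :: "nat \<Rightarrow> nat \<Rightarrow> nat \<Rightarrow> 'a" where
  "mu i k l = of_ent (\<lambda>i' k' l'. if i' = i \<and> k' = k \<and> l' = l then 1 else 0)"

definition tr :: "nat \<Rightarrow> 'a \<Rightarrow> complex" where
  "tr i x = (\<Sum>k<V $ i. ent i k k x)"

lemma bij: "bij_betw \<chi> S (matrix_sum V)"
  using iso by (simp add: star_iso_onto_def)

lemma chart_carrier:
  assumes "x \<in> S"
  shows "length (\<chi> x) = dim_vec V" "i < dim_vec V \<Longrightarrow> \<chi> x ! i \<in> carrier_mat (V $ i) (V $ i)"
  using bij_betw_apply[OF bij assms] by (auto simp: matrix_sum_def)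

lemma chart_dim:
  assumes "x \<in> S" "i < dim_vec V"
  shows "dim_row (\<chi> x ! i) = V $ i" "dim_col (\<chi> x ! i) = V $ i"
  using chart_carrier(2)[OF assms] by auto

lemma V_pos: "i < dim_vec V \<Longrightarrow> 0 < V $ i"
  using pos by (simp add: positive_vec_def)

lemma ent_add:
  assumes "x \<in> S" "y \<in> S" "i < dim_vec V" "k < V $ i" "l < V $ i"
  shows "ent i k l (x + y) = ent i k l x + ent i k l y"
  using assms iso chart_carrier(1)[OF assms(1)] chart_carrier(1)[OF assms(2)]
  by (auto simp: ent_def star_iso_onto_def chart_dim)

lemma ent_scaleC:
  assumes "x \<in> S" "i < dim_vec V" "k < V $ i" "l < V $ i"
  shows "ent i k l (scaleC z x) = z * ent i k l x"
  using assms iso chart_carrier(1)[OF assms(1)]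
  by (auto simp: ent_def star_iso_onto_def chart_dim)

lemma ent_mult:
  assumes "x \<in> S" "y \<in> S" "i < dim_vec V" "k < V $ i" "l < V $ i"
  shows "ent i k l (x * y) = (\<Sum>m<V $ i. ent i k m x * ent i m l y)"
  using assms iso chart_carrier(1)[OF assms(1)] chart_carrier(1)[OF assms(2)]
    chart_carrier(2)[OF assms(1,3)] chart_carrier(2)[OF assms(2,3)]
  by (auto simp: ent_def star_iso_onto_def scalar_prod_def lessThan_atLeast0 intro!: sum.cong)

lemma ent_star:
  assumes "x \<in> S" "i < dim_vec V" "k < V $ i" "l < V $ i"
  shows "ent i k l (star x) = cnj (ent i l k x)"
  using assms iso chart_carrier(1)[OF assms(1)] chart_carrier(2)[OF assms(1,2)]
  by (auto simp: ent_def star_iso_onto_def mat_adjoint_index)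

lemma ent_eqI:
  assumes "x \<in> S" "y \<in> S"
    and "\<And>i k l. i < dim_vec V \<Longrightarrow> k < V $ i \<Longrightarrow> l < V $ i \<Longrightarrow> ent i k l x = ent i k l y"
  shows "x = y"
proof -
  have "\<chi> x = \<chi> y"
  proof (rule nth_equalityI)
    fix i assume "i < length (\<chi> x)"
    then have i: "i < dim_vec V" using chart_carrier(1)[OF assms(1)] by simp
    show "\<chi> x ! i = \<chi> y ! i"
      using assms(3)[OF i] chart_carrier(2)[OF assms(1) i] chart_carrier(2)[OF assms(2) i]
      by (intro eq_matI) (auto simp: ent_def)
  qed (simp add: chart_carrier assms)
  then show ?thesis using bij assms(1,2) by (auto simp: bij_betw_def inj_on_def)
qed

lemma chart_of_ent:
  "\<chi> (of_ent f) = map (\<lambda>i. mat (V $ i) (V $ i) (\<lambda>(k, l). f i k l)) [0..<dim_vec V]"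
  unfolding of_ent_def
  by (rule bij_betw_inv_into_right[OF bij]) (simp add: matrix_sum_def)

lemma of_ent_in [simp]: "of_ent f \<in> S"
  unfolding of_ent_def
  by (rule bij_betw_apply[OF bij_betw_inv_into[OF bij]]) (simp add: matrix_sum_def)

lemma ent_of_ent [simp]:
  "i < dim_vec V \<Longrightarrow> k < V $ i \<Longrightarrow> l < V $ i \<Longrightarrow> ent i k l (of_ent f) = f i k l"
  by (simp add: ent_def chart_of_ent)

lemma mu_in [simp]: "mu i k l \<in> S"
  by (simp add: mu_def)

lemma ent_mu:
  assumes "i' < dim_vec V" "k' < V $ i'" "l' < V $ i'"
  shows "ent i' k' l' (mu i k l) = (if i' = i \<and> k' = k \<and> l' = l then 1 else 0)"
  using assms by (simp add: mu_def)

lemma ent_zero: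
  assumes "i < dim_vec V" "k < V $ i" "l < V $ i"
  shows "ent i k l 0 = 0"
  using ent_scaleC[of 0 i k l 0] assms by simp

lemma ent_diff:
  assumes "x \<in> S" "y \<in> S" "i < dim_vec V" "k < V $ i" "l < V $ i"
  shows "ent i k l (x - y) = ent i k l x - ent i k l y"
  using ent_add[of "x - y" y i k l] assms by simp

lemma ent_sum:
  assumes "\<And>a. a \<in> I \<Longrightarrow> f a \<in> S" "i < dim_vec V" "k < V $ i" "l < V $ i"
  shows "ent i k l (sum f I) = (\<Sum>a\<in>I. ent i k l (f a))"
  using assms by (induction I rule: infinite_finite_induct) (auto simp: ent_zero ent_add)

lemma tr_diff: "x \<in> S \<Longrightarrow> y \<in> S \<Longrightarrow> i < dim_vec V \<Longrightarrow> tr i (x - y) = tr i x - tr i y"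
  by (simp add: tr_def ent_diff sum_subtractf)

lemma tr_zero: "i < dim_vec V \<Longrightarrow> tr i 0 = 0"
  by (simp add: tr_def ent_zero)

lemma tr_mult_commute:
  assumes "x \<in> S" "y \<in> S" "i < dim_vec V"
  shows "tr i (x * y) = tr i (y * x)"
proof -
  have "tr i (x * y) = (\<Sum>k<V $ i. \<Sum>m<V $ i. ent i k m x * ent i m k y)"
    using assms by (simp add: tr_def ent_mult)
  also have "\<dots> = (\<Sum>m<V $ i. \<Sum>k<V $ i. ent i k m x * ent i m k y)" by (rule sum.swap)
  also have "\<dots> = tr i (y * x)" using assms by (simp add: tr_def ent_mult mult.commute)
  finally show ?thesis .
qed

lemma tr_mu:
  assumes "i' < dim_vec V" "k < V $ i'"
  shows "tr i' (mu i k l) = (if i' = i \<and> k = l then 1 else 0)"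
proof -
  have "tr i' (mu i k l) = (\<Sum>m<V $ i'. if m = k then (if i' = i \<and> k = l then 1 else 0) else 0)"
    unfolding tr_def using assms by (intro sum.cong) (auto simp: ent_mu)
  then show ?thesis using assms by simp
qed

lemma star_mu: "i < dim_vec V \<Longrightarrow> star (mu i k l) = mu i l k"
  by (rule ent_eqI) (auto simp: ent_star ent_mu)

lemma mu_mult_mult_mu:
  assumes "x \<in> S" "i < dim_vec V" "k < V $ i" "l < V $ i" "m < V $ i" "n < V $ i"
  shows "mu i k l * x * mu i m n = scaleC (ent i l m x) (mu i k n)"
proof (rule ent_eqI)
  fix i' k' l' assume i': "i' < dim_vec V" "k' < V $ i'" "l' < V $ i'"
  have "ent i' k' b (mu i k l * x) = (if i' = i \<and> k' = k then ent i l b x else 0)"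
    if "b < V $ i'" for b
    using i' that assms by (cases "i' = i \<and> k' = k") (auto simp: ent_mult ent_mu sum_delta_mult)
  then have "ent i' k' l' (mu i k l * x * mu i m n) =
      (if i' = i \<and> k' = k \<and> l' = n then ent i l m x else 0)"
    using i' assms by (cases "i' = i \<and> l' = n") (auto simp: ent_mult ent_mu sum_delta_mult)
  then show "ent i' k' l' (mu i k l * x * mu i m n) = ent i' k' l' (scaleC (ent i l m x) (mu i k n))"
    using i' assms by (auto simp: ent_scaleC ent_mu)
qed (use assms in auto)

lemma mu_mult_mu:
  assumes "i < dim_vec V" "k < V $ i" "l < V $ i" "i' < dim_vec V" "k' < V $ i'" "l' < V $ i'"
  shows "mu i k l * mu i' k' l' = (if i = i' \<and> l = k' then mu i k l' else 0)"
proof (rule ent_eqI)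
  fix j a b assume j: "j < dim_vec V" "a < V $ j" "b < V $ j"
  have "ent j a b (mu i k l * mu i' k' l') =
     (if j = i \<and> a = k \<and> j = i' \<and> l = k' \<and> b = l' then 1 else 0)"
    using j assms by (cases "j = i \<and> a = k") (auto simp: ent_mult ent_mu sum_delta_mult)
  then show "ent j a b (mu i k l * mu i' k' l') = ent j a b (if i = i' \<and> l = k' then mu i k l' else 0)"
    using j assms by (auto simp: ent_mu ent_zero)
qed auto

lemma expand:
  assumes "x \<in> S"
  shows "x = (\<Sum>j<dim_vec V. \<Sum>k<V $ j. \<Sum>l<V $ j. scaleC (ent j k l x) (mu j k l))"
proof (rule ent_eqI)
  fix i a b assume i: "i < dim_vec V" "a < V $ i" "b < V $ i"
  have "ent i a b (\<Sum>j<dim_vec V. \<Sum>k<V $ j. \<Sum>l<V $ j. scaleC (ent j k l x) (mu j k l)) =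
    (\<Sum>j<dim_vec V. \<Sum>k<V $ j. \<Sum>l<V $ j. ent j k l x * (if i = j \<and> a = k \<and> b = l then 1 else 0))"
    using i by (simp add: ent_sum ent_scaleC ent_mu)
  also have "\<dots> = (\<Sum>j<dim_vec V. if j = i then ent i a b x else 0)"
  proof (intro sum.cong refl)
    fix j assume "j \<in> {..<dim_vec V}"
    show "(\<Sum>k<V $ j. \<Sum>l<V $ j. ent j k l x * (if i = j \<and> a = k \<and> b = l then 1 else 0)) =
      (if j = i then ent i a b x else 0)"
    proof (cases "j = i")
      case True
      have "(\<Sum>k<V $ j. \<Sum>l<V $ j. ent j k l x * (if i = j \<and> a = k \<and> b = l then 1 else 0)) =
        (\<Sum>k<V $ i. \<Sum>l<V $ i. if l = b then if k = a then ent i a b x else 0 else 0)"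
        using True by (intro sum.cong) auto
      then show ?thesis using True i by simp
    qed auto
  qed
  also have "\<dots> = ent i a b x" using i by simp
  finally show "ent i a b x =
    ent i a b (\<Sum>j<dim_vec V. \<Sum>k<V $ j. \<Sum>l<V $ j. scaleC (ent j k l x) (mu j k l))" ..
qed (use assms in auto)

section \<open>Units of the summands and rank-one decompositions of projections\<close>

definition cen :: "nat \<Rightarrow> 'a" where
  "cen i = of_ent (\<lambda>i' k l. if i' = i \<and> k = l then 1 else 0)"

lemma cen_in [simp]: "cen i \<in> S"
  by (simp add: cen_def)

lemma ent_cen_mult:
  assumes "x \<in> S" "i' < dim_vec V" "k < V $ i'" "l < V $ i'"
  shows "ent i' k l (cen i * x) = (if i' = i then ent i' k l x else 0)"
    "ent i' k l (x * cen i) = (if i' = i then ent i' k l x else 0)"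
proof -
  show "ent i' k l (cen i * x) = (if i' = i then ent i' k l x else 0)"
    "ent i' k l (x * cen i) = (if i' = i then ent i' k l x else 0)"
    using assms by (cases "i' = i"; simp add: ent_mult cen_def sum_delta_mult)+
qed

lemma cen_commute: "x \<in> S \<Longrightarrow> x * cen i = cen i * x"
  by (rule ent_eqI) (auto simp: ent_cen_mult)

lemma cen_cen: "cen i * cen i = cen i"
  by (rule ent_eqI) (auto simp: ent_cen_mult, auto simp: cen_def)

lemma star_cen: "star (cen i) = cen i"
  by (rule ent_eqI) (auto simp: ent_star, auto simp: cen_def)

lemma tr_cen_mult: "x \<in> S \<Longrightarrow> i < dim_vec V \<Longrightarrow> tr i (cen i * x) = tr i x"
  by (simp add: tr_def ent_cen_mult)

lemma cen_projection:
  assumes "p \<in> S" "star p = p" "p * p = p"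
  shows "star (cen i * p) = cen i * p" "(cen i * p) * (cen i * p) = cen i * p"
proof -
  show "star (cen i * p) = cen i * p" by (simp add: star_mult assms star_cen cen_commute)
  have "(cen i * p) * (cen i * p) = (cen i * cen i) * (p * p)"
    by (metis assms(1) cen_commute mult.assoc)
  then show "(cen i * p) * (cen i * p) = cen i * p" by (simp add: assms cen_cen)
qed

text \<open>Reading \<open>p = p * star p\<close> entrywise turns diagonal entries into squared row
  norms. This is the source of positivity for the traces below.\<close>

lemma ent_projection_diag:
  assumes "p \<in> S" "star p = p" "p * p = p" "i < dim_vec V" "k < V $ i"
  shows "ent i k k p = of_real (\<Sum>l<V $ i. (cmod (ent i k l p))\<^sup>2)"
proof -
  have "ent i k k p = ent i k k (p * star p)" using assms by simp
  also have "\<dots> = (\<Sum>l<V $ i. ent i k l p * cnj (ent i k l p))"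
    using assms(1,4,5) by (simp add: ent_mult ent_star del: assms)
  finally show ?thesis by (simp add: complex_norm_square[symmetric])
qed

lemma tr_projection:
  assumes "p \<in> S" "star p = p" "p * p = p" "i < dim_vec V"
  shows "tr i p = of_real (\<Sum>k<V $ i. \<Sum>l<V $ i. (cmod (ent i k l p))\<^sup>2)"
proof -
  have "tr i p = (\<Sum>k<V $ i. of_real (\<Sum>l<V $ i. (cmod (ent i k l p))\<^sup>2))"
    unfolding tr_def by (intro sum.cong refl ent_projection_diag) (use assms in auto)
  then show ?thesis by (simp only: of_real_sum)
qed

lemma ent_zero_if_tr_zero:
  assumes "p \<in> S" "star p = p" "p * p = p" "i < dim_vec V" "tr i p = 0" "k < V $ i" "l < V $ i"
  shows "ent i k l p = 0"
proof -
  have "(\<Sum>k<V $ i. \<Sum>l<V $ i. (cmod (ent i k l p))\<^sup>2) = 0"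
    using tr_projection[OF assms(1-4)] assms(5) by (metis of_real_eq_0_iff)
  then have "(\<Sum>l<V $ i. (cmod (ent i k l p))\<^sup>2) = 0"
    using assms(6) by (subst (asm) sum_nonneg_eq_0_iff) (auto intro: sum_nonneg)
  then show ?thesis using assms(7) by (subst (asm) sum_nonneg_eq_0_iff) auto
qed

text \<open>A nonzero \<open>p\<close> has a diagonal entry c > 0, and x = p e_k0 / sqrt c satisfies
  \<open>star x * x = mu i 0 0\<close>; subtracting \<open>x * star x\<close> lowers the trace by 1.
  The elements \<open>x a\<close> live in column 0 and play the role of an orthonormal basis of the
  range of \<open>p\<close>. That the trace is a natural number is an outcome of this process, so
  the induction runs over an upper bound for it.\<close>

lemma projection_decomposition:
  assumes "i < dim_vec V" "p \<in> S" "star p = p" "p * p = p" "cen i * p = p"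
  obtains r x where "tr i p = of_nat r" "p = (\<Sum>a<r. x a * star (x a))"
    "\<And>a. a < r \<Longrightarrow> x a \<in> S" "\<And>a. a < r \<Longrightarrow> p * x a = x a"
    "\<And>a. a < r \<Longrightarrow> x a * mu i 0 0 = x a"
    "\<And>a b. a < r \<Longrightarrow> b < r \<Longrightarrow> star (x a) * x b = (if a = b then mu i 0 0 else 0)"
proof -
  have "Re (tr i p) < of_nat n \<Longrightarrow> \<exists>r x. tr i p = of_nat r \<and> p = (\<Sum>a<r. x a * star (x a)) \<and>
    (\<forall>a<r. x a \<in> S \<and> p * x a = x a \<and> x a * mu i 0 0 = x a) \<and>
    (\<forall>a<r. \<forall>b<r. star (x a) * x b = (if a = b then mu i 0 0 else 0))" for n
    using assms(2-)
  proof (induction n arbitrary: p)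
    case 0
    then have "0 \<le> Re (tr i p)" using tr_projection[OF 0(2-4) assms(1)] by (simp add: sum_nonneg)
    then show ?case using 0 by simp
  next
    case (Suc n)
    note i = assms(1)
    have v0: "0 < V $ i" by (rule V_pos[OF i])
    show ?case
    proof (cases "p = 0")
      case True
      then show ?thesis by (intro exI[of _ 0]) (simp add: tr_zero i)
    next
      case False
      obtain k where k: "k < V $ i" "ent i k k p \<noteq> 0"
      proof (rule ccontr)
        assume "\<not> thesis"
        then have "\<And>k. k < V $ i \<Longrightarrow> ent i k k p = 0" using that by blast
        then have "tr i p = 0" by (simp add: tr_def)
        then have e: "\<And>k l. k < V $ i \<Longrightarrow> l < V $ i \<Longrightarrow> ent i k l p = 0"
          using ent_zero_if_tr_zero Suc.prems i by blast
        have "p = 0"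
        proof (rule ent_eqI)
          fix i' k l assume *: "i' < dim_vec V" "k < V $ i'" "l < V $ i'"
          have "ent i' k l (cen i * p) = ent i' k l 0"
            using * e Suc.prems(2) by (cases "i' = i") (simp_all add: ent_cen_mult ent_zero)
          then show "ent i' k l p = ent i' k l 0" using Suc.prems(5) by simp
        qed (use Suc.prems in auto)
        with False show False by simp
      qed
      define c where "c = (\<Sum>l<V $ i. (cmod (ent i k l p))\<^sup>2)"
      have c: "ent i k k p = of_real c"
        unfolding c_def by (rule ent_projection_diag) (use Suc.prems i k in auto)
      have "c \<ge> 0" unfolding c_def by (intro sum_nonneg) auto
      then have cpos: "c > 0" using k(2) c by (cases "c = 0") auto
      define x where "x = scaleR (1 / sqrt c) (p * mu i k 0)"
      have xS: "x \<in> S" using Suc.prems by (simp add: x_def)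
      have px: "p * x = x" using Suc.prems(4) by (simp add: x_def mult.assoc[symmetric])
      have xm: "x * mu i 0 0 = x" using i k v0 by (simp add: x_def mult.assoc mu_mult_mu)
      have sx: "star x = scaleR (1 / sqrt c) (mu i 0 k * p)"
        using Suc.prems i by (simp add: x_def star_simps star_mu)
      have "mu i 0 k * p * (p * mu i k 0) = mu i 0 k * p * mu i k 0"
        using Suc.prems(4) by (metis mult.assoc)
      also have "\<dots> = scaleR c (mu i 0 0)"
        using Suc.prems i k v0 by (simp add: mu_mult_mult_mu c scaleR_eq_scaleC)
      finally have xx: "star x * x = mu i 0 0"
        using cpos by (simp add: sx) (simp add: x_def)
      have sxp: "star x * p = star x" using px Suc.prems(3) by (metis star_mult)
      have xxx: "x * star x * x = x" using xx xm by (simp add: mult.assoc)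
      have mx: "mu i 0 0 * star x = star x" using xm star_mu[OF i, of 0 0] by (metis star_mult)
      define p' where "p' = p - x * star x"
      have p': "p' \<in> S" "star p' = p'"
        using Suc.prems xS by (simp_all add: p'_def star_simps)
      have pp': "p * p' = p'" using Suc.prems px by (simp add: p'_def right_diff_distrib mult.assoc[symmetric])
      have "p' * p' = p'"
        by (simp add: p'_def left_diff_distrib right_diff_distrib Suc.prems)
          (metis (no_types, lifting) cancel_comm_monoid_add_class.diff_cancel diff_zero mult.assoc px sxp xxx)
      moreover have cp': "cen i * p' = p'" using Suc.prems pp' by (metis mult.assoc)
      moreover have trp': "tr i p' = tr i p - 1"
        using Suc.prems xS i v0 tr_mult_commute[OF xS _ i, of "star x"]
        by (simp add: p'_def tr_diff xx tr_mu)
      moreover have "Re (tr i p') < of_nat n" using Suc.prems(1) trp' by simp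
      ultimately obtain r y where IH: "tr i p' = of_nat r" "p' = (\<Sum>a<r. y a * star (y a))"
        "\<And>a. a < r \<Longrightarrow> y a \<in> S \<and> p' * y a = y a \<and> y a * mu i 0 0 = y a"
        "\<And>a b. a < r \<Longrightarrow> b < r \<Longrightarrow> star (y a) * y b = (if a = b then mu i 0 0 else 0)"
        using Suc.IH[of p'] p' by blast
      \<comment> \<open>The vectors found for p' satisfy p' y = y, so this one identity makes all of
        them orthogonal to x.\<close>
      have "star x * p' = 0"
        by (simp add: p'_def right_diff_distrib sxp) (simp add: mult.assoc[symmetric] xx mx)
      then have xy: "star x * y a = 0" if "a < r" for a
        using IH(3)[OF that] by (metis mult.assoc mult_zero_left)
      have yx: "star (y a) * x = 0" if "a < r" for a
        using xy[OF that] by (metis star_mult star_star star_zero)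
      have py: "p * y a = y a" if "a < r" for a
        using IH(3)[OF that] pp' by (metis mult.assoc)
      let ?z = "y(r := x)"
      show ?thesis
      proof (intro exI[of _ "Suc r"] exI[of _ ?z] conjI allI impI)
        show "tr i p = of_nat (Suc r)" using trp' IH(1) by simp
        have "(\<Sum>a<Suc r. ?z a * star (?z a)) = (\<Sum>a<r. y a * star (y a)) + x * star x"
          by simp
        then show "p = (\<Sum>a<Suc r. ?z a * star (?z a))"
          unfolding IH(2)[symmetric] by (simp add: p'_def)
      qed (use IH py px xm xS xx xy yx in \<open>auto simp: less_Suc_eq\<close>)
    qed
  qed
  moreover obtain n :: nat where "Re (tr i p) < of_nat n" using reals_Archimedean2 by blast
  ultimately show thesis using that by blast
qed

text \<open>If \<open>q\<close> had larger rank than \<open>q'\<close> in some summand, there would be \<open>e \<noteq> 0\<close> with \<open>q e = e\<close> and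
  \<open>q' e = 0\<close>; then \<open>c = z\<^sup>* e\<close> satisfies \<open>z c = e\<close> and \<open>e\<^sup>* z' c = 0\<close>, so \<open>e\<^sup>* e = e\<^sup>* (z - z') c\<close>,
  which is too small.\<close>

lemma tr_eq_if_close:
  assumes i: "i < dim_vec V"
    and q: "z * star z \<in> S" "(z * star z) * (z * star z) = z * star z"
    and q': "z' * star z' \<in> S" "(z' * star z') * (z' * star z') = z' * star z'"
    and close: "norm (z - z') < 1"
  shows "tr i (z * star z) = tr i (z' * star z')"
proof -
  \<comment> \<open>One inequality between the ranks; the other follows by exchanging z and z'. Only
    \<open>z * star z\<close> and \<open>z' * star z'\<close> lie in \<open>S\<close>: the element
    \<open>e\<close> is found there, while the norm estimate takes place in the ambient
    algebra.\<close>
  have main: "r \<le> s"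
    if i: "i < dim_vec V" and q: "z * star z \<in> S" "(z * star z) * (z * star z) = z * star z"
    and q': "z' * star z' \<in> S" "(z' * star z') * (z' * star z') = z' * star z'"
    and close: "norm (z - z') < 1" and r: "tr i (z * star z) = of_nat r"
    and s: "tr i (z' * star z') = of_nat s" for z z' :: 'a and r s
  proof (rule ccontr)
    assume "\<not> r \<le> s"
    then have sr: "s < r" by simp
    have v0: "0 < V $ i" by (rule V_pos[OF i])
    have st: "star (z * star z) = z * star z" "star (z' * star z') = z' * star z'" by (simp_all add: star_simps)
    have cc: "cen i * (cen i * w) = cen i * w" for w by (metis cen_cen mult.assoc)
    have cq: "cen i * (z * star z) \<in> S" "cen i * (z' * star z') \<in> S" using q(1) q'(1) by simp_all
    obtain r' x where x: "tr i (cen i * (z * star z)) = of_nat r'"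
      "cen i * (z * star z) = (\<Sum>a<r'. x a * star (x a))"
      "\<And>a. a < r' \<Longrightarrow> x a \<in> S" "\<And>a. a < r' \<Longrightarrow> cen i * (z * star z) * x a = x a"
      "\<And>a. a < r' \<Longrightarrow> x a * mu i 0 0 = x a"
      "\<And>a b. a < r' \<Longrightarrow> b < r' \<Longrightarrow> star (x a) * x b = (if a = b then mu i 0 0 else 0)"
      by (rule projection_decomposition[OF i cq(1) cen_projection[OF q(1) st(1) q(2)] cc]) blast
    have rr: "r' = r" using x(1) tr_cen_mult[OF q(1) i] r by simp
    obtain s' y where y: "tr i (cen i * (z' * star z')) = of_nat s'"
      "cen i * (z' * star z') = (\<Sum>a<s'. y a * star (y a))"
      "\<And>a. a < s' \<Longrightarrow> y a \<in> S" "\<And>a. a < s' \<Longrightarrow> cen i * (z' * star z') * y a = y a"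
      "\<And>a. a < s' \<Longrightarrow> y a * mu i 0 0 = y a"
      "\<And>a b. a < s' \<Longrightarrow> b < s' \<Longrightarrow> star (y a) * y b = (if a = b then mu i 0 0 else 0)"
      by (rule projection_decomposition[OF i cq(2) cen_projection[OF q'(1) st(2) q'(2)] cc]) blast
    have ss: "s' = s" using y(1) tr_cen_mult[OF q'(1) i] s by simp
    note x = x[unfolded rr] and y = y[unfolded ss]
    \<comment> \<open>The inner products of the two orthonormal systems. A kernel vector of this s
      by r matrix gives a combination of the \<open>x a\<close> that is orthogonal to all
      \<open>y b\<close>.\<close>
    define M where "M b a = ent i 0 0 (star (y b) * x a)" for b a
    obtain c where c: "\<exists>a<r. c a \<noteq> 0" "\<And>b. b < s \<Longrightarrow> (\<Sum>a<r. M b a * c a) = 0"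
      using ex_kernel_vector[OF sr] by metis
    define e where "e = (\<Sum>a<r. scaleC (c a) (x a))"
    have xe: "star (x a) * e = scaleC (c a) (mu i 0 0)" if "a < r" for a
    proof -
      have "star (x a) * e = (\<Sum>b<r. if b = a then scaleC (c a) (mu i 0 0) else 0)"
        unfolding e_def sum_distrib_left using x(6) that
        by (intro sum.cong) (auto simp: mult_scaleC_right)
      then show ?thesis using that by simp
    qed
    have e0: "e \<noteq> 0"
    proof
      assume "e = 0"
      then have "ent i 0 0 (scaleC (c a) (mu i 0 0)) = 0" if "a < r" for a
        using xe[OF that] i v0 by (simp add: ent_zero flip: xe[OF that])
      then show False using c(1) i v0 by (auto simp: ent_scaleC ent_mu)
    qed
    have cqx: "cen i * x a = x a" "(z * star z) * x a = x a" if "a < r" for a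
    proof -
      have *: "cen i * (z * star z) * x a = x a" "x a \<in> S" using x(3,4)[OF that] by auto
      show "cen i * x a = x a" by (metis * cen_cen mult.assoc)
      show "(z * star z) * x a = x a"
        by (metis * \<open>cen i * x a = x a\<close> q(1) cen_commute mult.assoc)
    qed
    have qe: "z * star z * e = e"
      unfolding e_def sum_distrib_left
      by (intro sum.cong) (auto simp: mult_scaleC_right cqx)
    have ce: "cen i * e = e"
      unfolding e_def sum_distrib_left
      by (intro sum.cong) (auto simp: mult_scaleC_right cqx)
    have yx: "star (y b) * x a = scaleC (M b a) (mu i 0 0)" if "b < s" "a < r" for a b
    proof -
      have "star (y b) * x a = mu i 0 0 * (star (y b) * x a) * mu i 0 0"
        using x(5)[OF that(2)] y(5)[OF that(1)] star_mu[OF i, of 0 0] by (metis mult.assoc star_mult)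
      then show ?thesis
        using mu_mult_mult_mu[of "star (y b) * x a" i 0 0 0 0] x(3)[OF that(2)] y(3)[OF that(1)] i v0
        by (simp add: M_def)
    qed
    have ye: "star (y b) * e = 0" if "b < s" for b
    proof -
      have "star (y b) * e = (\<Sum>a<r. scaleC (M b a * c a) (mu i 0 0))"
        unfolding e_def sum_distrib_left
        by (intro sum.cong) (auto simp: mult_scaleC_right yx that scaleC_scaleC mult.commute)
      also have "\<dots> = scaleC (\<Sum>a<r. M b a * c a) (mu i 0 0)"
        by (induction r) (auto simp: scaleC_add_left)
      finally show ?thesis using c(2)[OF that] by simp
    qed
    have "(z' * star z') * e = (z' * star z') * cen i * e" using ce by (simp add: mult.assoc)
    also have "\<dots> = (\<Sum>a<s. y a * star (y a)) * e" using q'(1) cen_commute y(2) by metis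
    also have "\<dots> = 0" unfolding sum_distrib_right by (intro sum.neutral) (auto simp: mult.assoc ye)
    finally have q'e: "z' * star z' * e = 0" .
    have "star (star z' * e) * (star z' * e) = star e * (z' * star z' * e)"
      by (simp add: star_simps mult.assoc)
    then have z'e: "star z' * e = 0" using q'e star_mult_self_eq_0_iff by fastforce
    \<comment> \<open>This is the element called c in the explanation before the lemma; in the code
      \<open>c\<close> holds the coefficients of \<open>e\<close>.\<close>
    define d where "d = star z * e"
    have zd: "z * d = e" using qe by (simp add: d_def mult.assoc)
    have "star d * d = star e * e" using zd by (simp add: d_def star_simps mult.assoc)
    then have nd: "norm d = norm e"
      by (metis cstar_identity norm_ge_zero power2_eq_imp_eq)
    have "star e * (z' * d) = star (star z' * e) * d" by (simp add: star_simps mult.assoc)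
    then have "star e * e = star e * ((z - z') * d)"
      using z'e zd by (simp add: left_diff_distrib right_diff_distrib)
    then have "norm e * norm e = norm (star e * ((z - z') * d))"
      using cstar_identity[of e] by (simp add: power2_eq_square)
    also have "\<dots> \<le> norm (star e) * norm ((z - z') * d)" by (rule norm_mult_ineq)
    also have "\<dots> \<le> norm (star e) * (norm (z - z') * norm d)"
      by (intro mult_left_mono norm_mult_ineq) simp
    finally have "norm e * norm e \<le> norm e * (norm (z - z') * norm e)" by (simp add: nd)
    then have "norm e * 1 \<le> norm (z - z') * norm e"
      using e0 by (subst (asm) mult_le_cancel_left_pos) auto
    moreover have "norm (z - z') * norm e < 1 * norm e"
      using close e0 by (intro mult_strict_right_mono) auto
    ultimately show False by simp
  qed
  have "\<exists>n. tr i (w * star w) = of_nat n"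
    if w: "w * star w \<in> S" "(w * star w) * (w * star w) = w * star w" for w
  proof -
    have cw: "cen i * (w * star w) \<in> S" "cen i * (cen i * (w * star w)) = cen i * (w * star w)"
      using w(1) by simp (metis cen_cen mult.assoc)
    have sw: "star (w * star w) = w * star w" by (simp add: star_simps)
    obtain n where "tr i (cen i * (w * star w)) = of_nat n"
      by (rule projection_decomposition[OF i cw(1) cen_projection[OF w(1) sw w(2)] cw(2)]) blast
    then show ?thesis using tr_cen_mult[OF w(1) i] by auto
  qed
  then obtain r s where "tr i (z * star z) = of_nat r" "tr i (z' * star z') = of_nat s"
    using q q' by metis
  moreover have "norm (z' - z) < 1" using close by (simp add: norm_minus_commute)
  ultimately have "r = s" using main[of z z' r s] main[of z' z s r] i q q' close by auto
  then show ?thesis using \<open>tr i (z * star z) = of_nat r\<close> \<open>tr i (z' * star z') = of_nat s\<close> by simp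
qed

end

section \<open>Multiplicities of *-homomorphisms\<close>

definition mtrace :: "complex mat \<Rightarrow> complex" where
  "mtrace A = (\<Sum>k<dim_row A. A $$ (k, k))"

lemma mat_mult_index:
  assumes "A \<in> carrier_mat n m" "B \<in> carrier_mat m k" "i < n" "j < k"
  shows "(A * B) $$ (i, j) = (\<Sum>l<m. A $$ (i, l) * B $$ (l, j))"
  using assms by (auto simp: scalar_prod_def lessThan_atLeast0 intro!: sum.cong)

lemma mtrace_mult_commute:
  assumes "A \<in> carrier_mat n m" "B \<in> carrier_mat m n"
  shows "mtrace (A * B) = mtrace (B * A)"
proof -
  have "mtrace (A * B) = (\<Sum>i<n. \<Sum>j<m. A $$ (i, j) * B $$ (j, i))"
    using assms by (auto simp: mtrace_def mat_mult_index simp del: index_mult_mat(1))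
  also have "\<dots> = (\<Sum>j<m. \<Sum>i<n. A $$ (i, j) * B $$ (j, i))" by (rule sum.swap)
  also have "\<dots> = mtrace (B * A)"
    using assms by (auto simp: mtrace_def mat_mult_index mult.commute simp del: index_mult_mat(1))
  finally show ?thesis .
qed

lemma sum_lessThan_add:
  fixes f :: "nat \<Rightarrow> 'a::comm_monoid_add"
  shows "(\<Sum>l<n + m. f l) = (\<Sum>l<n. f l) + (\<Sum>l<m. f (n + l))"
  by (induction m) (auto simp: add_ac)

lemma mtrace_diag_block_mat:
  assumes "Ball (set As) square_mat"
  shows "mtrace (diag_block_mat As) = (\<Sum>A\<leftarrow>As. mtrace A)"
  using assms
proof (induction As)
  case (Cons A As)
  have "square_mat (diag_block_mat As)"
    by (rule diag_block_mat_square) (use Cons in auto)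
  then have sq: "dim_col A = dim_row A" "dim_col (diag_block_mat As) = dim_row (diag_block_mat As)"
    using Cons by auto
  have "mtrace (diag_block_mat (A # As)) = mtrace A + mtrace (diag_block_mat As)"
    using sq by (simp add: mtrace_def Let_def sum_lessThan_add)
  then show ?case using Cons by simp
qed (simp add: mtrace_def)

text \<open>Matrices with \<open>w\<close> rows placed side by side. It assembles a unitary from
  groups of columns, each of which is an intertwiner.\<close>

fun hcat :: "nat \<Rightarrow> complex mat list \<Rightarrow> complex mat" where
  "hcat w [] = mat w 0 (\<lambda>_. 0)"
| "hcat w (U # Us) = mat w (dim_col U + dim_col (hcat w Us))
     (\<lambda>(k, l). if l < dim_col U then U $$ (k, l) else hcat w Us $$ (k, l - dim_col U))"

lemma hcat_dim: "dim_row (hcat w Us) = w" "dim_col (hcat w Us) = (\<Sum>U\<leftarrow>Us. dim_col U)"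
  by (induction Us) auto

text \<open>The congruence assumption confines \<open>f\<close> to the first \<open>w\<close>
  entries of a column, since matrix entries beyond the dimensions are arbitrary.\<close>

lemma sum_hcat_cols:
  fixes f :: "(nat \<Rightarrow> complex) \<Rightarrow> complex"
  assumes f: "\<And>g h. (\<And>k. k < w \<Longrightarrow> g k = h k) \<Longrightarrow> f g = f h"
  shows "(\<Sum>l<dim_col (hcat w Us). f (\<lambda>k. hcat w Us $$ (k, l))) =
    (\<Sum>U\<leftarrow>Us. \<Sum>l<dim_col U. f (\<lambda>k. U $$ (k, l)))"
proof (induction Us)
  case (Cons U Us)
  have dims: "dim_col (hcat w (U # Us)) = dim_col U + dim_col (hcat w Us)" by simp
  have "(\<Sum>l<dim_col (hcat w (U # Us)). f (\<lambda>k. hcat w (U # Us) $$ (k, l))) =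
    (\<Sum>l<dim_col U. f (\<lambda>k. hcat w (U # Us) $$ (k, l))) +
    (\<Sum>l<dim_col (hcat w Us). f (\<lambda>k. hcat w (U # Us) $$ (k, dim_col U + l)))"
    unfolding dims by (rule sum_lessThan_add)
  also have "(\<Sum>l<dim_col U. f (\<lambda>k. hcat w (U # Us) $$ (k, l))) = (\<Sum>l<dim_col U. f (\<lambda>k. U $$ (k, l)))"
    by (intro sum.cong refl f) simp
  also have "(\<Sum>l<dim_col (hcat w Us). f (\<lambda>k. hcat w (U # Us) $$ (k, dim_col U + l))) =
      (\<Sum>l<dim_col (hcat w Us). f (\<lambda>k. hcat w Us $$ (k, l)))"
    by (intro sum.cong refl f) simp
  finally show ?case by (simp add: Cons del: hcat.simps)
qed simp

text \<open>Each group of columns satisfies its own intertwining relation, and the products are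
  compared column by column. If the concatenation is unitary, this is the block diagonalisation of
  \<open>M\<close>.\<close>

lemma mult_hcat:
  assumes "M \<in> carrier_mat w w"
    and "list_all2 (\<lambda>U D. U \<in> carrier_mat w (dim_row D) \<and> square_mat D \<and> M * U = U * D) Us Ds"
  shows "M * hcat w Us = hcat w Us * diag_block_mat Ds"
  using assms(2)
proof (induction rule: list_all2_induct)
  case Nil
  then show ?case using assms(1) by (intro eq_matI) auto
next
  case (Cons U Us D Ds)
  define n where "n = dim_row D"
  define B where "B = diag_block_mat Ds"
  define H where "H = hcat w Us"
  have c: "U \<in> carrier_mat w n" "D \<in> carrier_mat n n" using Cons by (auto simp: n_def)
  have MU: "M * U = U * D" using Cons by simp
  have dims: "(\<Sum>U\<leftarrow>Us. dim_col U) = (\<Sum>D\<leftarrow>Ds. dim_row D)" "(\<Sum>U\<leftarrow>Us. dim_col U) = (\<Sum>D\<leftarrow>Ds. dim_col D)"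
    using Cons(2) by (induction rule: list_all2_induct) auto
  define N where "N = (\<Sum>U\<leftarrow>Us. dim_col U)"
  have B: "B \<in> carrier_mat N N" using dims by (auto simp: B_def N_def dim_diag_block_mat)
  have H: "H \<in> carrier_mat w N" by (auto simp: H_def N_def hcat_dim)
  have MH: "M * H = H * B" using Cons by (simp add: H_def B_def)
  have dcU: "dim_col U = n" using c by simp
  let ?C = "hcat w (U # Us)"
  have C: "?C \<in> carrier_mat w (n + N)" using c by (auto simp: hcat_dim N_def)
  let ?DD = "diag_block_mat (D # Ds)"
  have DD: "?DD = four_block_mat D (0\<^sub>m n N) (0\<^sub>m N n) B"
    using c B by (simp add: Let_def B_def[symmetric])
  show ?case
  proof (rule eq_matI)
    fix k l assume "k < dim_row (?C * ?DD)" "l < dim_col (?C * ?DD)"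
    then have k: "k < w" and l: "l < n + N" using C B c unfolding DD by (auto simp del: hcat.simps)
    have MC: "(M * ?C) $$ (k, l) = (\<Sum>m<w. M $$ (k, m) * ?C $$ (m, l))"
      using assms(1) C k l by (rule mat_mult_index)
    have CD: "(?C * ?DD) $$ (k, l) = (\<Sum>m<n. U $$ (k, m) * ?DD $$ (m, l)) + (\<Sum>m<N. H $$ (k, m) * ?DD $$ (n + m, l))"
    proof -
      have "(?C * ?DD) $$ (k, l) = (\<Sum>m<n + N. ?C $$ (k, m) * ?DD $$ (m, l))"
        using C _ k l by (rule mat_mult_index) (use B c in \<open>simp add: DD del: diag_block_mat.simps\<close>)
      also have "\<dots> = (\<Sum>m<n. ?C $$ (k, m) * ?DD $$ (m, l)) + (\<Sum>m<N. ?C $$ (k, n + m) * ?DD $$ (n + m, l))"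
        by (rule sum_lessThan_add)
      also have "(\<Sum>m<n. ?C $$ (k, m) * ?DD $$ (m, l)) = (\<Sum>m<n. U $$ (k, m) * ?DD $$ (m, l))"
        using k by (intro sum.cong) (auto simp: dcU simp del: diag_block_mat.simps)
      also have "(\<Sum>m<N. ?C $$ (k, n + m) * ?DD $$ (n + m, l)) = (\<Sum>m<N. H $$ (k, m) * ?DD $$ (n + m, l))"
        using k H by (intro sum.cong) (auto simp: dcU H_def[symmetric] simp del: diag_block_mat.simps)
      finally show ?thesis .
    qed
    show "(M * ?C) $$ (k, l) = (?C * ?DD) $$ (k, l)"
    proof (cases "l < n")
      case True
      have "(M * ?C) $$ (k, l) = (M * U) $$ (k, l)"
        unfolding MC using assms(1) c True k
        by (simp add: mat_mult_index dcU del: index_mult_mat(1))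
      moreover have "(?C * ?DD) $$ (k, l) = (U * D) $$ (k, l)"
        unfolding CD unfolding DD using c B True k by (simp add: mat_mult_index del: index_mult_mat(1))
      ultimately show ?thesis using MU by simp
    next
      case False
      have "(M * ?C) $$ (k, l) = (M * H) $$ (k, l - n)"
        unfolding MC using assms(1) c H False k l
        by (simp add: mat_mult_index dcU H_def[symmetric] del: index_mult_mat(1))
      moreover have "(?C * ?DD) $$ (k, l) = (H * B) $$ (k, l - n)"
        unfolding CD unfolding DD using c B H False k l by (simp add: mat_mult_index del: index_mult_mat(1))
      ultimately show ?thesis using MH by simp
    qed
  qed (use assms(1) C B c in \<open>auto simp: DD simp del: hcat.simps diag_block_mat.simps\<close>)
qed

text \<open>The columns turn out to be pairwise orthogonal because their number, computed as a trace,
  is \<open>w\<close>.\<close>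

lemma hcat_unitary:
  assumes rows: "\<And>k k'. k < w \<Longrightarrow> k' < w \<Longrightarrow>
      (\<Sum>U\<leftarrow>Us. \<Sum>l<dim_col U. U $$ (k, l) * cnj (U $$ (k', l))) = (if k = k' then 1 else 0)"
    and cols: "\<And>U l. U \<in> set Us \<Longrightarrow> l < dim_col U \<Longrightarrow> (\<Sum>k<w. U $$ (k, l) * cnj (U $$ (k, l))) = 1"
  shows "hcat w Us \<in> carrier_mat w w" "hcat w Us * mat_adjoint (hcat w Us) = 1\<^sub>m w"
    "mat_adjoint (hcat w Us) * hcat w Us = 1\<^sub>m w"
proof -
  let ?H = "hcat w Us"
  have rowsH: "(\<Sum>l<dim_col ?H. ?H $$ (k, l) * cnj (?H $$ (k', l))) = (if k = k' then 1 else 0)"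
    if "k < w" "k' < w" for k k'
    using sum_hcat_cols[of w "\<lambda>g. g k * cnj (g k')" Us] that rows[OF that] by simp
  have "(of_nat (dim_col ?H) :: complex) = of_nat (\<Sum>U\<leftarrow>Us. dim_col U)" by (simp add: hcat_dim)
  also have "\<dots> = (\<Sum>U\<leftarrow>Us. \<Sum>l<dim_col U. 1)" by (induction Us) auto
  also have "\<dots> = (\<Sum>U\<leftarrow>Us. \<Sum>l<dim_col U. \<Sum>k<w. U $$ (k, l) * cnj (U $$ (k, l)))"
    using cols by (intro arg_cong[where f = sum_list] map_cong refl sum.cong) auto
  also have "\<dots> = (\<Sum>l<dim_col ?H. \<Sum>k<w. ?H $$ (k, l) * cnj (?H $$ (k, l)))"
    by (rule sum_hcat_cols[symmetric, where f = "\<lambda>g. \<Sum>k<w. g k * cnj (g k)"]) simp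
  also have "\<dots> = (\<Sum>k<w. \<Sum>l<dim_col ?H. ?H $$ (k, l) * cnj (?H $$ (k, l)))" by (rule sum.swap)
  also have "\<dots> = (\<Sum>k<w. 1)" by (intro sum.cong) (auto simp: rowsH)
  also have "\<dots> = of_nat w" by simp
  finally have "dim_col ?H = w" using of_nat_eq_iff by blast
  then show H: "?H \<in> carrier_mat w w" by (metis carrier_matI hcat_dim(1))
  show HA: "?H * mat_adjoint ?H = 1\<^sub>m w"
  proof (rule eq_matI)
    fix k k' assume kk: "k < dim_row (1\<^sub>m w)" "k' < dim_col (1\<^sub>m w)"
    have "(?H * mat_adjoint ?H) $$ (k, k') = (\<Sum>l<dim_col ?H. ?H $$ (k, l) * cnj (?H $$ (k', l)))"
      using H kk mat_adjoint_carrier[OF H]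
      by (auto simp: scalar_prod_def lessThan_atLeast0 mat_adjoint_index intro!: sum.cong)
    then show "(?H * mat_adjoint ?H) $$ (k, k') = 1\<^sub>m w $$ (k, k')" using rowsH kk by simp
  qed (use H mat_adjoint_carrier[OF H] in auto)
  show "mat_adjoint ?H * ?H = 1\<^sub>m w"
    by (rule mat_mult_left_right_inverse[OF H mat_adjoint_carrier[OF H] HA])
qed

lemma mat_adjoint_mat_adjoint: "mat_adjoint (mat_adjoint (A :: complex mat)) = A"
proof -
  have A: "A \<in> carrier_mat (dim_row A) (dim_col A)" by simp
  from mat_adjoint_carrier[OF mat_adjoint_carrier[OF A]] mat_adjoint_carrier[OF A] show ?thesis
    by (intro eq_matI) (auto simp: mat_adjoint_index)
qed

text \<open>\<open>g\<close> is a total function constrained on \<open>S\<close> only, so that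
  inclusions, perturbations of a homomorphism by \<open>Ad u\<close>, and composites are instances
  without restricting any function.\<close>

locale fd_hom = A: fd_alg S V \<chi> + B: fd_alg T W \<omega>
  for S :: "'a::cstar_algebra set" and V \<chi> and T :: "'b::cstar_algebra set" and W \<omega> +
  fixes g :: "'a \<Rightarrow> 'b"
  assumes g_in [simp]: "x \<in> S \<Longrightarrow> g x \<in> T"
    and g_add: "x \<in> S \<Longrightarrow> y \<in> S \<Longrightarrow> g (x + y) = g x + g y"
    and g_scaleC: "x \<in> S \<Longrightarrow> g (scaleC z x) = scaleC z (g x)"
    and g_mult: "x \<in> S \<Longrightarrow> y \<in> S \<Longrightarrow> g (x * y) = g x * g y"
    and g_star: "x \<in> S \<Longrightarrow> g (star x) = star (g x)"
begin

lemma g_zero: "g 0 = 0"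
  using g_scaleC[of 0 0] by simp

lemma g_sum: "(\<And>a. a \<in> I \<Longrightarrow> f a \<in> S) \<Longrightarrow> g (sum f I) = (\<Sum>a\<in>I. g (f a))"
  by (induction I rule: infinite_finite_induct) (auto simp: g_zero g_add)

text \<open>Column 0 of summand j carries its standard representation: x e_l0 combines the e_k0 with
  the coefficients in column l of x. The image of this under \<open>g\<close> is the intertwining
  relation for the blocks.\<close>

lemma g_mult_mu:
  assumes "x \<in> S" "j < dim_vec V" "l < V $ j"
  shows "g x * g (A.mu j l 0) = (\<Sum>k<V $ j. scaleC (A.ent j k l x) (g (A.mu j k 0)))"
proof -
  have "x * A.mu j l 0 = (\<Sum>k<V $ j. scaleC (A.ent j k l x) (A.mu j k 0))"
  proof (rule A.ent_eqI)
    fix i a b assume i: "i < dim_vec V" "a < V $ i" "b < V $ i"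
    have "A.ent i a b (x * A.mu j l 0) = (if i = j \<and> b = 0 then A.ent i a l x else 0)"
      using i assms by (cases "i = j \<and> b = 0") (auto simp: A.ent_mult A.ent_mu sum_delta_mult)
    also have "\<dots> = (\<Sum>k<V $ j. A.ent j k l x * A.ent i a b (A.mu j k 0))"
      using i assms by (cases "i = j \<and> b = 0") (auto simp: A.ent_mu sum_delta_mult)
    finally show "A.ent i a b (x * A.mu j l 0) =
        A.ent i a b (\<Sum>k<V $ j. scaleC (A.ent j k l x) (A.mu j k 0))"
      using i by (simp add: A.ent_sum A.ent_scaleC)
  qed (use assms in auto)
  then show ?thesis using assms by (simp add: g_sum g_scaleC flip: g_mult)
qed

text \<open>The standard form of a representation of a direct sum of matrix algebras. In summand i
  of the codomain, the image of the minimal projection of summand j has an orthonormal basis of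
  \<open>r j\<close> vectors; moving one of them by the images of the e_l0 spans a copy of the
  standard representation of summand j. The part orthogonal to the image of the unit gives the zero
  block.\<close>

lemma ex_block_diagonal_column:
  assumes i: "i < dim_vec W"
  shows "\<exists>v a s. v \<in> carrier_mat (W $ i) (W $ i) \<and> unitary_mat v \<and>
    (\<forall>x\<in>S. v * (\<omega> (g x) ! i) * mat_adjoint v = multiplicity_diag a s (\<chi> x))"
proof -
  define w where "w = W $ i"
  have w0: "0 < w" unfolding w_def by (rule B.V_pos[OF i])
  let ?d = "dim_vec V"
  define e where "e j k l = g (A.mu j k l)" for j k l
  have eT [simp]: "e j k l \<in> T" for j k l by (simp add: e_def)
  have e_star: "star (e j k l) = e j l k" if "j < ?d" for j k l
    using that by (simp add: e_def A.star_mu flip: g_star)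
  have e_mult: "e j k l * e j l m = e j k m" if "j < ?d" "k < V $ j" "l < V $ j" "m < V $ j" for j k l m
    using that by (simp add: e_def A.mu_mult_mu flip: g_mult)
  have e_orth: "e j k k * e j' l l = 0" if "j < ?d" "k < V $ j" "j' < ?d" "l < V $ j'" "(j, k) \<noteq> (j', l)" for j k j' l
    using that by (auto simp: e_def A.mu_mult_mu g_zero simp flip: g_mult)
  define p where "p j = B.cen i * e j 0 0" for j
  define Pj where "Pj j r x \<longleftrightarrow> p j = (\<Sum>a<r. x a * star (x a)) \<and> (\<forall>a<r. x a \<in> T \<and> p j * x a = x a \<and>
      x a * B.mu i 0 0 = x a \<and> star (x a) * x a = B.mu i 0 0)" for j and r :: nat and x :: "nat \<Rightarrow> 'b"
  have ex_p: "\<exists>rx. Pj j (fst rx) (snd rx)" if j: "j < ?d" for j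
  proof -
    have v0: "0 < V $ j" by (rule A.V_pos[OF j])
    have pr: "star (e j 0 0) = e j 0 0" "e j 0 0 * e j 0 0 = e j 0 0"
      using j v0 by (simp_all add: e_star e_mult)
    have pT: "p j \<in> T" by (simp add: p_def)
    have cp: "B.cen i * p j = p j" unfolding p_def by (metis B.cen_cen mult.assoc)
    show ?thesis
    proof (rule B.projection_decomposition[OF i pT
          B.cen_projection[OF eT pr, where i = i, folded p_def] cp])
      fix r :: nat and x assume px: "p j = (\<Sum>a<r. x a * star (x a))"
        and x: "\<And>a. a < r \<Longrightarrow> x a \<in> T" "\<And>a. a < r \<Longrightarrow> p j * x a = x a"
        "\<And>a. a < r \<Longrightarrow> x a * B.mu i 0 0 = x a"
        "\<And>a b. a < r \<Longrightarrow> b < r \<Longrightarrow> star (x a) * x b = (if a = b then B.mu i 0 0 else 0)"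
      have "star (x a) * x a = B.mu i 0 0" if "a < r" for a using x(4)[OF that that] by simp
      then have "Pj j r x" unfolding Pj_def using px x(1-3) by blast
      then show ?thesis by (intro exI[of _ "(r, x)"]) simp
    qed
  qed
  then have "\<forall>j. \<exists>rx. j < ?d \<longrightarrow> Pj j (fst rx) (snd rx)" by blast
  then obtain rx where rx: "\<And>j. j < ?d \<Longrightarrow> Pj j (fst (rx j)) (snd (rx j))"
    using choice by metis
  define r where "r j = fst (rx j)" for j
  define x where "x j = snd (rx j)" for j
  have px: "p j = (\<Sum>a<r j. x j a * star (x j a))" if "j < ?d" for j
    using rx[OF that] unfolding Pj_def r_def x_def by blast
  have x: "x j a \<in> T \<and> p j * x j a = x j a \<and> x j a * B.mu i 0 0 = x j a \<and>
      star (x j a) * x j a = B.mu i 0 0" if "j < ?d" "a < r j" for j a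
    using rx[OF that(1)] that(2) unfolding Pj_def r_def x_def by blast
  \<comment> \<open>\<open>E\<close> is the image of the unit of \<open>S\<close>; it need not be
    the unit of the codomain. \<open>Q\<close> below is the part of summand i on which
    \<open>g\<close> vanishes.\<close>
  define E where "E = (\<Sum>j<?d. \<Sum>k<V $ j. e j k k)"
  have E_in: "E \<in> T" unfolding E_def by (intro B.S_simps) auto
  have E_star: "star E = E" unfolding E_def star_sum by (intro sum.cong refl) (simp add: e_star)
  have Ee: "e j k k * E = e j k k" if jk: "j < ?d" "k < V $ j" for j k
  proof -
    have "e j k k * E = (\<Sum>j'<?d. \<Sum>l<V $ j'. e j k k * e j' l l)" by (simp add: E_def sum_distrib_left)
    also have "\<dots> = (\<Sum>j'<?d. \<Sum>l<V $ j'. if l = k then if j' = j then e j k k else 0 else 0)"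
      using jk e_orth[OF jk] e_mult[OF jk(1) jk(2,2,2)] by (intro sum.cong refl) auto
    also have "\<dots> = (\<Sum>j'<?d. if j' = j then e j k k else 0)"
      using jk by (intro sum.cong refl) auto
    finally show ?thesis using jk by simp
  qed
  have EE: "E * E = E"
    unfolding E_def[of] sum_distrib_right by (intro sum.cong refl) (simp add: Ee E_def[symmetric])
  have gE: "g y * E = g y" if y: "y \<in> S" for y
  proof -
    have muE: "e j k l * E = e j k l" if "j < ?d" "k < V $ j" "l < V $ j" for j k l
      using e_mult[of j k l l] Ee[of j l] that by (metis mult.assoc)
    have gy: "g y = (\<Sum>j<?d. \<Sum>k<V $ j. \<Sum>l<V $ j. scaleC (A.ent j k l y) (e j k l))"
      by (subst A.expand[OF y]) (simp add: g_sum g_scaleC e_def)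
    have "g y * E = (\<Sum>j<?d. \<Sum>k<V $ j. \<Sum>l<V $ j. scaleC (A.ent j k l y) (e j k l * E))"
      unfolding gy by (simp add: sum_distrib_right mult_scaleC_left)
    also have "\<dots> = g y" unfolding gy by (intro sum.cong refl) (simp add: muE)
    finally show ?thesis .
  qed
  define Q where "Q = B.cen i - B.cen i * E"
  have QT: "Q \<in> T" using E_in by (simp add: Q_def)
  have cE: "E * B.cen i = B.cen i * E" using E_in by (rule B.cen_commute)
  have QQ: "Q * Q = Q"
    by (simp add: Q_def left_diff_distrib right_diff_distrib mult.assoc B.cen_cen)
      (metis (no_types, opaque_lifting) B.cen_cen EE cE diff_zero cancel_comm_monoid_add_class.diff_cancel mult.assoc)
  have Qs: "star Q = Q" by (simp add: Q_def star_simps B.star_cen E_star cE)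
  have cQ: "B.cen i * Q = Q" by (simp add: Q_def right_diff_distrib B.cen_cen flip: mult.assoc)
  have gQ: "g y * Q = 0" if "y \<in> S" for y
    using gE[OF that] that by (simp add: Q_def right_diff_distrib B.cen_commute mult.assoc)
      (metis B.cen_commute E_in cE g_in mult.assoc)
  obtain s y where y: "B.tr i Q = of_nat s" "Q = (\<Sum>a<s. y a * star (y a))"
    "\<And>a. a < s \<Longrightarrow> y a \<in> T" "\<And>a. a < s \<Longrightarrow> Q * y a = y a"
    "\<And>a. a < s \<Longrightarrow> y a * B.mu i 0 0 = y a"
    "\<And>a b. a < s \<Longrightarrow> b < s \<Longrightarrow> star (y a) * y b = (if a = b then B.mu i 0 0 else 0)"
    by (rule B.projection_decomposition[OF i QT Qs QQ cQ]) blast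
  \<comment> \<open>An element supported in column 0 is a vector, and \<open>z * star z\<close> is
    its rank-one matrix. Sums over columns of the future unitary thus become entries of elements of
    \<open>T\<close>.\<close>
  have col: "B.ent i k k' (z * star z) = B.ent i k 0 z * cnj (B.ent i k' 0 z)"
    if "z \<in> T" "z * B.mu i 0 0 = z" "k < w" "k' < w" for z k k'
  proof -
    have 0: "B.ent i a m z = 0" if "a < w" "m < w" "m \<noteq> 0" for a m
    proof -
      have "B.ent i a m (z * B.mu i 0 0) = 0"
        using \<open>z \<in> T\<close> i w0 that by (simp add: B.ent_mult B.ent_mu w_def[symmetric])
      then show ?thesis using \<open>z * B.mu i 0 0 = z\<close> by simp
    qed
    have "B.ent i k k' (z * star z) = (\<Sum>m<w. B.ent i k m z * cnj (B.ent i k' m z))"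
      using that i by (simp add: B.ent_mult B.ent_star w_def)
    also have "\<dots> = (\<Sum>m<w. if m = 0 then B.ent i k 0 z * cnj (B.ent i k' 0 z) else 0)"
      using 0 that by (intro sum.cong) auto
    finally show ?thesis using w0 by simp
  qed
  have unit: "(\<Sum>k<w. B.ent i k 0 z * cnj (B.ent i k 0 z)) = 1" if "z \<in> T" "star z * z = B.mu i 0 0" for z
  proof -
    have "(\<Sum>k<w. B.ent i k 0 z * cnj (B.ent i k 0 z)) = B.ent i 0 0 (star z * z)"
      using that(1) i w0 by (simp add: B.ent_mult B.ent_star w_def mult.commute)
    then show ?thesis using that i w0 by (simp add: B.ent_mu w_def)
  qed
  \<comment> \<open>\<open>c j a l\<close> is basis vector l in copy a of the standard
    representation of summand j; the columns of \<open>U j a\<close> are these vectors.\<close>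
  define c where "c j a l = e j l 0 * x j a" for j a l
  define U where "U j a = mat w (V $ j) (\<lambda>(k, l). B.ent i k 0 (c j a l))" for j a
  define UQ where "UQ = mat w s (\<lambda>(k, l). B.ent i k 0 (y l))"
  define Us where "Us = concat (map (\<lambda>j. map (U j) [0..<r j]) [0..<?d]) @ [UQ]"
  have exT: "c j a l \<in> T" "c j a l * B.mu i 0 0 = c j a l"
    "star (c j a l) * c j a l = B.mu i 0 0"
    if ja: "j < ?d" "a < r j" "l < V $ j" for j a l
  proof -
    have v0: "0 < V $ j" by (rule A.V_pos[OF ja(1)])
    note xx = x[OF ja(1,2)]
    show "c j a l \<in> T" "c j a l * B.mu i 0 0 = c j a l"
      using xx by (simp_all add: c_def mult.assoc)
    have "e j 0 0 * p j = p j"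
      unfolding p_def by (metis B.cen_commute e_mult eT ja(1) mult.assoc v0)
    then have ex: "e j 0 0 * x j a = x j a" using xx by (metis mult.assoc)
    have "star (c j a l) * c j a l = star (x j a) * (e j 0 l * e j l 0 * x j a)"
      using ja by (simp add: c_def star_mult e_star mult.assoc)
    then show "star (c j a l) * c j a l = B.mu i 0 0"
      using ja v0 xx by (simp add: e_mult ex)
  qed
  \<comment> \<open>Completeness of the system: the rank-one matrices of all columns add up to
    \<open>cen i * E + Q = cen i\<close>, the unit of summand i.\<close>
  have rows: "(\<Sum>U\<leftarrow>Us. \<Sum>l<dim_col U. U $$ (k, l) * cnj (U $$ (k', l))) = (if k = k' then 1 else 0)"
    if k: "k < w" "k' < w" for k k'
  proof -
    have "(\<Sum>U\<leftarrow>Us. \<Sum>l<dim_col U. U $$ (k, l) * cnj (U $$ (k', l))) =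
      (\<Sum>j<?d. \<Sum>a<r j. \<Sum>l<V $ j. U j a $$ (k, l) * cnj (U j a $$ (k', l))) +
      (\<Sum>l<s. UQ $$ (k, l) * cnj (UQ $$ (k', l)))"
    proof -
      have 1: "(\<Sum>U\<leftarrow>concat (map F [0..<n]). f U) = (\<Sum>j<n. \<Sum>U\<leftarrow>F j. f U)"
        for F :: "nat \<Rightarrow> complex mat list" and f :: "complex mat \<Rightarrow> complex" and n
        by (induction n) auto
      have 2: "(\<Sum>U\<leftarrow>map F [0..<n]. f U) = (\<Sum>a<n. f (F a))"
        for F :: "nat \<Rightarrow> complex mat" and f :: "complex mat \<Rightarrow> complex" and n
        by (induction n) auto
      show ?thesis unfolding Us_def by (simp add: 1 2 del: map_map) (simp add: U_def UQ_def)
    qed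
    also have "(\<Sum>j<?d. \<Sum>a<r j. \<Sum>l<V $ j. U j a $$ (k, l) * cnj (U j a $$ (k', l))) =
      (\<Sum>j<?d. \<Sum>a<r j. \<Sum>l<V $ j. B.ent i k k' (c j a l * star (c j a l)))"
      using k exT by (intro sum.cong refl) (simp add: U_def col)
    also have "\<dots> = (\<Sum>j<?d. \<Sum>l<V $ j. \<Sum>a<r j. B.ent i k k' (c j a l * star (c j a l)))"
      by (intro sum.cong refl sum.swap)
    also have "\<dots> = (\<Sum>j<?d. \<Sum>l<V $ j. B.ent i k k' (B.cen i * e j l l))"
    proof (intro sum.cong refl)
      fix j l assume "j \<in> {..<?d}" "l \<in> {..<V $ j}"
      then have jl: "j < ?d" "l < V $ j" by auto
      have v0: "0 < V $ j" by (rule A.V_pos[OF jl(1)])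
      have "(\<Sum>a<r j. B.ent i k k' (c j a l * star (c j a l))) =
        B.ent i k k' (\<Sum>a<r j. c j a l * star (c j a l))"
        using exT jl i k by (subst B.ent_sum) (auto simp: w_def)
      also have "(\<Sum>a<r j. c j a l * star (c j a l)) = e j l 0 * p j * e j 0 l"
        using jl by (simp add: c_def px sum_distrib_left sum_distrib_right star_mult e_star mult.assoc)
      also have "\<dots> = B.cen i * e j l l"
        unfolding p_def by (metis B.cen_commute e_mult eT jl v0 mult.assoc)
      finally show "(\<Sum>a<r j. B.ent i k k' (c j a l * star (c j a l))) =
        B.ent i k k' (B.cen i * e j l l)" .
    qed
    also have "\<dots> = B.ent i k k' (B.cen i * E)"
      using i k by (simp add: E_def sum_distrib_left B.ent_sum w_def)
    also have "(\<Sum>l<s. UQ $$ (k, l) * cnj (UQ $$ (k', l))) = B.ent i k k' Q"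
    proof -
      have "(\<Sum>l<s. UQ $$ (k, l) * cnj (UQ $$ (k', l))) = (\<Sum>l<s. B.ent i k k' (y l * star (y l)))"
        using k y(3,5) by (intro sum.cong refl) (simp add: UQ_def col)
      also have "\<dots> = B.ent i k k' (\<Sum>l<s. y l * star (y l))"
        using y(3) i k by (subst B.ent_sum) (auto simp: w_def)
      finally show ?thesis using y(2) by simp
    qed
    also have "B.ent i k k' (B.cen i * E) + B.ent i k k' Q = B.ent i k k' (B.cen i * E + Q)"
      using i k E_in QT by (simp add: B.ent_add w_def)
    also have "B.cen i * E + Q = B.cen i" by (simp add: Q_def)
    also have "B.ent i k k' (B.cen i) = (if k = k' then 1 else 0)"
      using i k by (simp add: B.cen_def w_def)
    finally show ?thesis .
  qed
  have cols: "(\<Sum>k<w. X $$ (k, l) * cnj (X $$ (k, l))) = 1" if "X \<in> set Us" "l < dim_col X" for X l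
    using that unit exT y(3,6) by (auto simp: Us_def U_def UQ_def)
  note H = hcat_unitary[OF rows cols]
  \<comment> \<open>For the concatenation H and the block diagonal matrix D the relation will be M H
    = H D. Hence D is obtained with the adjoint of H on the left, the place of \<open>v\<close> in
    the definition of R.\<close>
  define v where "v = mat_adjoint (hcat w Us)"
  have v: "v \<in> carrier_mat w w" using H(1) by (simp add: v_def mat_adjoint_carrier)
  have vv: "mat_adjoint v = hcat w Us" by (simp add: v_def mat_adjoint_mat_adjoint)
  have "unitary_mat v" using v H(2,3) unfolding unitary_mat_def vv by (auto simp: v_def)
  moreover have "v * (\<omega> (g z) ! i) * mat_adjoint v = multiplicity_diag r s (\<chi> z)" if z: "z \<in> S" for z
  proof -
    define M where "M = \<omega> (g z) ! i"
    have M: "M \<in> carrier_mat w w" unfolding M_def w_def using z i by (intro B.chart_carrier) auto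
    have len: "length (\<chi> z) = ?d" by (rule A.chart_carrier(1)[OF z])
    have Mprod: "(\<Sum>m<w. M $$ (k, m) * B.ent i m 0 t) = B.ent i k 0 (g z * t)" if "t \<in> T" "k < w" for t k
      using that z i w0 unfolding M_def w_def by (simp add: B.ent_mult) (simp add: B.ent_def)
    define R where "R X D \<longleftrightarrow> X \<in> carrier_mat w (dim_row D) \<and> square_mat D \<and> M * X = X * D"
      for X D :: "complex mat"
    have RU: "R (U j a) (\<chi> z ! j)" if ja: "j < ?d" "a < r j" for j a
    proof -
      have D: "\<chi> z ! j \<in> carrier_mat (V $ j) (V $ j)" by (rule A.chart_carrier(2)[OF z ja(1)])
      have "M * U j a = U j a * (\<chi> z ! j)"
      proof (rule eq_matI)
        fix k l assume "k < dim_row (U j a * (\<chi> z ! j))" "l < dim_col (U j a * (\<chi> z ! j))"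
        then have k: "k < w" and l: "l < V $ j" using D by (auto simp: U_def)
        have "(M * U j a) $$ (k, l) = (\<Sum>m<w. M $$ (k, m) * B.ent i m 0 (c j a l))"
          using k l M by (auto simp: U_def scalar_prod_def lessThan_atLeast0 intro!: sum.cong)
        also have "\<dots> = B.ent i k 0 (g z * c j a l)"
          using exT(1)[OF ja l] k by (rule Mprod)
        also have "g z * c j a l = (\<Sum>m<V $ j. scaleC (A.ent j m l z) (c j a m))"
          using g_mult_mu[OF z ja(1) l]
          by (simp add: c_def e_def sum_distrib_right mult_scaleC_left flip: mult.assoc)
        also have "B.ent i k 0 \<dots> = (\<Sum>m<V $ j. A.ent j m l z * B.ent i k 0 (c j a m))"
          using exT(1)[OF ja] i k w0 by (subst B.ent_sum) (auto simp: B.ent_scaleC w_def)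
        also have "\<dots> = (U j a * (\<chi> z ! j)) $$ (k, l)"
          using k l D by (auto simp: U_def A.ent_def scalar_prod_def lessThan_atLeast0 intro!: sum.cong)
        finally show "(M * U j a) $$ (k, l) = (U j a * (\<chi> z ! j)) $$ (k, l)" .
      qed (use M D in \<open>auto simp: U_def\<close>)
      then show ?thesis using D by (auto simp: R_def U_def)
    qed
    have RQ: "R UQ (0\<^sub>m s s)"
    proof -
      have "M * UQ = UQ * 0\<^sub>m s s"
      proof (rule eq_matI)
        fix k l assume "k < dim_row (UQ * 0\<^sub>m s s)" "l < dim_col (UQ * 0\<^sub>m s s)"
        then have k: "k < w" and l: "l < s" by (auto simp: UQ_def)
        have "(M * UQ) $$ (k, l) = (\<Sum>m<w. M $$ (k, m) * B.ent i m 0 (y l))"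
          using k l M by (auto simp: UQ_def scalar_prod_def lessThan_atLeast0 intro!: sum.cong)
        also have "\<dots> = B.ent i k 0 (g z * y l)" using y(3)[OF l] k by (rule Mprod)
        also have "g z * y l = 0" using y(4)[OF l] gQ[OF z] by (metis mult.assoc mult_zero_left)
        finally show "(M * UQ) $$ (k, l) = (UQ * 0\<^sub>m s s) $$ (k, l)"
          using k l i w0 by (simp add: B.ent_zero w_def UQ_def)
      qed (use M in \<open>auto simp: UQ_def\<close>)
      then show ?thesis by (simp add: R_def UQ_def)
    qed
    have "list_all2 R (concat (map (\<lambda>j. map (U j) [0..<r j]) [0..<n]))
        (concat (map (\<lambda>j. replicate (r j) (\<chi> z ! j)) [0..<n]))" if "n \<le> ?d" for n
      using that
    proof (induction n)
      case (Suc n)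
      have "list_all2 R (map (U n) [0..<r n]) (replicate (r n) (\<chi> z ! n))"
        using Suc.prems RU by (auto simp: list_all2_conv_all_nth)
      then show ?case using Suc by (simp add: list_all2_appendI)
    qed simp
    then have "list_all2 R Us (concat (map (\<lambda>j. replicate (r j) (\<chi> z ! j)) [0..<length (\<chi> z)]) @ [0\<^sub>m s s])"
      unfolding Us_def len using RQ by (intro list_all2_appendI) auto
    then have "M * hcat w Us = hcat w Us * multiplicity_diag r s (\<chi> z)"
      unfolding multiplicity_diag_def R_def by (rule mult_hcat[OF M])
    moreover have "multiplicity_diag r s (\<chi> z) \<in> carrier_mat w w"
    proof -
      have *: "list_all2 R Us Ds \<Longrightarrow> dim_row (diag_block_mat Ds) = dim_col (hcat w Us)"
        "list_all2 R Us Ds \<Longrightarrow> dim_col (diag_block_mat Ds) = dim_col (hcat w Us)" for Us Ds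
        unfolding dim_diag_block_mat hcat_dim
        by (induction rule: list_all2_induct) (auto simp: R_def)
      show ?thesis unfolding multiplicity_diag_def
        using *[OF \<open>list_all2 R Us _\<close>] H(1) by auto
    qed
    ultimately have "v * M * hcat w Us = v * hcat w Us * multiplicity_diag r s (\<chi> z)"
      using v M H(1) by (metis assoc_mult_mat)
    then show ?thesis
      unfolding M_def[symmetric] vv using H(3) \<open>multiplicity_diag r s (\<chi> z) \<in> _\<close>
      by (simp add: v_def)
  qed
  ultimately show ?thesis using v w_def by blast
qed

end

section \<open>Existence and uniqueness of R, and its trace formula\<close>

context fd_hom
begin

abbreviation coord_map :: "complex mat list \<Rightarrow> complex mat list" where
  "coord_map \<equiv> \<lambda>us. \<omega> (g (inv_into S \<chi> us))"

definition mult_mat :: "nat mat" where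
  "mult_mat = multiplicity_of V W coord_map"

lemma inv_chart:
  assumes "us \<in> matrix_sum V"
  shows "inv_into S \<chi> us \<in> S" "\<chi> (inv_into S \<chi> us) = us"
  using assms A.bij bij_betw_inv_into_right[OF A.bij] bij_betw_apply[OF bij_betw_inv_into[OF A.bij]]
  by auto

lemma ex_multiplicity: "\<exists>a. is_multiplicity_of a V W coord_map"
proof -
  have "\<forall>i. \<exists>t. i < dim_vec W \<longrightarrow> fst t \<in> carrier_mat (W $ i) (W $ i) \<and> unitary_mat (fst t) \<and>
    (\<forall>x\<in>S. fst t * (\<omega> (g x) ! i) * mat_adjoint (fst t) =
      multiplicity_diag (fst (snd t)) (snd (snd t)) (\<chi> x))"
    using ex_block_diagonal_column by fastforce
  from choice[OF this] obtain t where t: "\<forall>i. i < dim_vec W \<longrightarrow> fst (t i) \<in> carrier_mat (W $ i) (W $ i) \<and>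
    unitary_mat (fst (t i)) \<and> (\<forall>x\<in>S. fst (t i) * (\<omega> (g x) ! i) * mat_adjoint (fst (t i)) =
      multiplicity_diag (fst (snd (t i))) (snd (snd (t i))) (\<chi> x))"
    by blast
  define a where "a = mat (dim_vec W) (dim_vec V) (\<lambda>(i, j). fst (snd (t i)) j)"
  define v where "v = map (\<lambda>i. fst (t i)) [0..<dim_vec W]"
  have "v \<in> matrix_sum W" using t by (auto simp: v_def matrix_sum_def)
  moreover have "unitary_mat (v ! i) \<and> (\<forall>us\<in>matrix_sum V.
      v ! i * (\<omega> (g (inv_into S \<chi> us)) ! i) * mat_adjoint (v ! i) =
      multiplicity_diag (\<lambda>j. a $$ (i, j)) (snd (snd (t i))) us)" if i: "i < dim_vec W" for i
  proof (intro conjI ballI)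
    show "unitary_mat (v ! i)" using t i by (simp add: v_def)
    fix us assume us: "us \<in> matrix_sum V"
    have len: "length us = dim_vec V" using us by (simp add: matrix_sum_def)
    have "multiplicity_diag (\<lambda>j. a $$ (i, j)) (snd (snd (t i))) us =
        multiplicity_diag (fst (snd (t i))) (snd (snd (t i))) us"
      unfolding multiplicity_diag_def len
      by (intro arg_cong[where f = diag_block_mat] arg_cong2[where f = "(@)"]
          arg_cong[where f = concat] map_cong refl) (auto simp: a_def i)
    then show "v ! i * (\<omega> (g (inv_into S \<chi> us)) ! i) * mat_adjoint (v ! i) =
      multiplicity_diag (\<lambda>j. a $$ (i, j)) (snd (snd (t i))) us"
      using t i inv_chart[OF us] by (simp add: v_def)
  qed
  ultimately have "is_multiplicity_of a V W coord_map"
    unfolding is_multiplicity_of_def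
    by (intro conjI bexI[of _ v] exI[of _ "\<lambda>i. snd (snd (t i))"]) (auto simp: a_def)
  then show ?thesis ..
qed

lemma mtrace_multiplicity_diag:
  assumes "\<And>u. u \<in> set us \<Longrightarrow> square_mat u"
  shows "mtrace (multiplicity_diag a s us) = (\<Sum>j<length us. of_nat (a j) * mtrace (us ! j))"
proof -
  have *: "(\<Sum>u\<leftarrow>concat (map (\<lambda>j. replicate (a j) (us ! j)) [0..<n]). mtrace u) =
    (\<Sum>j<n. of_nat (a j) * mtrace (us ! j))" for n
    by (induction n) (auto simp: sum_list_replicate)
  have "mtrace (0\<^sub>m s s) = 0" by (simp add: mtrace_def)
  with * show ?thesis
    unfolding multiplicity_diag_def
    by (subst mtrace_diag_block_mat) (use assms in \<open>auto simp: square_mat.simps\<close>)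
qed

lemma dim_row_multiplicity_diag:
  "dim_row (multiplicity_diag a s us) = (\<Sum>j<length us. a j * dim_row (us ! j)) + s"
proof -
  have "(\<Sum>u\<leftarrow>concat (map (\<lambda>j. replicate (a j) (us ! j)) [0..<n]). dim_row u) =
    (\<Sum>j<n. a j * dim_row (us ! j))" for n
    by (induction n) (auto simp: sum_list_replicate)
  then show ?thesis unfolding multiplicity_diag_def by (simp add: dim_diag_block_mat)
qed

context
  fixes a assumes a: "is_multiplicity_of a V W coord_map"
begin

text \<open>Conjugation by the unitary does not change the trace, and the block diagonal form counts
  the trace of each summand of x with its multiplicity.\<close>

lemma multiplicity_tr:
  assumes i: "i < dim_vec W" and x: "x \<in> S"
  shows "B.tr i (g x) = (\<Sum>j<dim_vec V. of_nat (a $$ (i, j)) * A.tr j x)"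
proof -
  obtain v s where v: "v \<in> carrier_mat (W $ i) (W $ i)" "unitary_mat v"
    "\<And>us. us \<in> matrix_sum V \<Longrightarrow> v * (\<omega> (g (inv_into S \<chi> us)) ! i) * mat_adjoint v =
      multiplicity_diag (\<lambda>j. a $$ (i, j)) s us"
    using a i unfolding is_multiplicity_of_def matrix_sum_def by blast
  have xs: "\<chi> x \<in> matrix_sum V" using A.bij x by (auto simp: bij_betw_def)
  have len: "length (\<chi> x) = dim_vec V" by (rule A.chart_carrier(1)[OF x])
  have ix: "inv_into S \<chi> (\<chi> x) = x" using A.bij x by (rule bij_betw_inv_into_left)
  define M where "M = \<omega> (g x) ! i"
  have M: "M \<in> carrier_mat (W $ i) (W $ i)" unfolding M_def using x i by (intro B.chart_carrier) auto
  have va: "mat_adjoint v \<in> carrier_mat (W $ i) (W $ i)" using v(1) by (rule mat_adjoint_carrier)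
  have "mtrace M = mtrace (mat_adjoint v * v * M)"
    using v(1,2) M by (simp add: unitary_mat_def)
  also have "\<dots> = mtrace (mat_adjoint v * (v * M))" using v(1) va M by (simp add: assoc_mult_mat)
  also have "\<dots> = mtrace (v * M * mat_adjoint v)"
    using v(1) va M by (intro mtrace_mult_commute) auto
  also have "\<dots> = mtrace (multiplicity_diag (\<lambda>j. a $$ (i, j)) s (\<chi> x))"
    using v(3)[OF xs] by (simp add: M_def ix)
  also have "\<dots> = (\<Sum>j<dim_vec V. of_nat (a $$ (i, j)) * mtrace (\<chi> x ! j))"
    using xs by (subst mtrace_multiplicity_diag) (auto simp: len matrix_sum_def in_set_conv_nth)
  also have "mtrace M = B.tr i (g x)" using M by (simp add: mtrace_def B.tr_def B.ent_def M_def)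
  also have "(\<Sum>j<dim_vec V. of_nat (a $$ (i, j)) * mtrace (\<chi> x ! j)) =
      (\<Sum>j<dim_vec V. of_nat (a $$ (i, j)) * A.tr j x)"
    using A.chart_dim[OF x] by (intro sum.cong refl) (simp add: mtrace_def A.tr_def A.ent_def)
  finally show ?thesis .
qed

text \<open>The minimal projection has trace 1 in its own summand and 0 in the others. All entries
  of \<open>a\<close> are thereby forced, which will give uniqueness.\<close>

lemma multiplicity_entry:
  assumes "i < dim_vec W" "j < dim_vec V"
  shows "B.tr i (g (A.mu j 0 0)) = of_nat (a $$ (i, j))"
proof -
  have "B.tr i (g (A.mu j 0 0)) = (\<Sum>k<dim_vec V. of_nat (a $$ (i, k)) * (if k = j then 1 else 0))"
    using assms A.V_pos by (auto simp: multiplicity_tr A.tr_mu intro!: sum.cong)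
  then show ?thesis using assms by (simp add: sum_delta_mult)
qed

text \<open>Sizes on the two sides of the block form, read off at the element 0: W_i is the sum of
  the a_ij V_j plus the size \<open>s\<close> of the zero block.\<close>

lemma multiplicity_size: "multiplicity_matrix V a W"
  unfolding multiplicity_matrix_def less_eq_vec_def
proof (intro conjI allI impI)
  show ac: "a \<in> carrier_mat (dim_vec W) (dim_vec V)" using a by (simp add: is_multiplicity_of_def)
  then show "dim_vec (a *\<^sub>v V) = dim_vec W" by simp
  fix i assume i: "i < dim_vec W"
  obtain v s where v: "v \<in> carrier_mat (W $ i) (W $ i)"
    "\<And>us. us \<in> matrix_sum V \<Longrightarrow> v * (\<omega> (g (inv_into S \<chi> us)) ! i) * mat_adjoint v =
      multiplicity_diag (\<lambda>j. a $$ (i, j)) s us"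
    using a i unfolding is_multiplicity_of_def matrix_sum_def by blast
  have 0: "\<chi> 0 \<in> matrix_sum V" using A.bij by (auto simp: bij_betw_def)
  have "W $ i = dim_row (multiplicity_diag (\<lambda>j. a $$ (i, j)) s (\<chi> 0))"
    using v(1) by (simp flip: v(2)[OF 0])
  also have "\<dots> \<ge> (\<Sum>j<dim_vec V. a $$ (i, j) * V $ j)"
    unfolding dim_row_multiplicity_diag using 0
    by (auto simp: matrix_sum_def intro!: trans_le_add1 sum_mono)
  also have "(\<Sum>j<dim_vec V. a $$ (i, j) * V $ j) = (a *\<^sub>v V) $ i"
    using ac i by (auto simp: scalar_prod_def lessThan_atLeast0 intro!: sum.cong)
  finally show "(a *\<^sub>v V) $ i \<le> W $ i" .
qed

end

lemma is_multiplicity_mult_mat: "is_multiplicity_of mult_mat V W coord_map"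
  unfolding mult_mat_def multiplicity_of_def
proof (rule theI')
  show "\<exists>!a. is_multiplicity_of a V W coord_map"
  proof (rule ex_ex1I[OF ex_multiplicity])
    fix a b assume ab: "is_multiplicity_of a V W coord_map"
      "is_multiplicity_of b V W coord_map"
    then have c: "a \<in> carrier_mat (dim_vec W) (dim_vec V)" "b \<in> carrier_mat (dim_vec W) (dim_vec V)"
      by (auto simp: is_multiplicity_of_def)
    show "a = b"
    proof (rule eq_matI)
      fix i j assume "i < dim_row b" "j < dim_col b"
      then have "(of_nat (a $$ (i, j)) :: complex) = of_nat (b $$ (i, j))"
        using c ab by (simp flip: multiplicity_entry)
      then show "a $$ (i, j) = b $$ (i, j)" by simp
    qed (use c in auto)
  qed
qed

lemmas tr_mult_mat = multiplicity_tr[OF is_multiplicity_mult_mat]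
lemmas mult_mat_entry = multiplicity_entry[OF is_multiplicity_mult_mat]
lemmas mult_mat_size = multiplicity_size[OF is_multiplicity_mult_mat]

lemma mult_mat_carrier: "mult_mat \<in> carrier_mat (dim_vec W) (dim_vec V)"
  using is_multiplicity_mult_mat by (simp add: is_multiplicity_of_def)

text \<open>The way R is computed from here on: through traces of the images of minimal projections,
  without exhibiting a unitary.\<close>

lemma mult_mat_eqI:
  assumes "a \<in> carrier_mat (dim_vec W) (dim_vec V)"
    and "\<And>i j. i < dim_vec W \<Longrightarrow> j < dim_vec V \<Longrightarrow> B.tr i (g (A.mu j 0 0)) = of_nat (a $$ (i, j))"
  shows "mult_mat = a"
proof (rule eq_matI)
  fix i j assume "i < dim_row a" "j < dim_col a"
  then have "(of_nat (mult_mat $$ (i, j)) :: complex) = of_nat (a $$ (i, j))"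
    using assms mult_mat_entry by auto
  then show "mult_mat $$ (i, j) = a $$ (i, j)" by simp
qed (use assms mult_mat_carrier in auto)

text \<open>A zero column would make all traces of the projection g(e_00) vanish. A projection with
  vanishing traces is 0, against injectivity.\<close>

lemma mult_mat_embedding:
  assumes inj: "\<And>x. x \<in> S \<Longrightarrow> g x = 0 \<Longrightarrow> x = 0"
  shows "embedding_matrix V mult_mat W"
  unfolding embedding_matrix_def
proof (intro conjI mult_mat_size allI impI)
  fix j assume "j < dim_col mult_mat"
  then have j: "j < dim_vec V" using mult_mat_carrier by auto
  have v0: "0 < V $ j" by (rule A.V_pos[OF j])
  show "col mult_mat j \<noteq> 0\<^sub>v (dim_row mult_mat)"
  proof
    assume 0: "col mult_mat j = 0\<^sub>v (dim_row mult_mat)"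
    define p where "p = g (A.mu j 0 0)"
    have p: "p \<in> T" "star p = p" "p * p = p"
      using j v0 by (simp_all add: p_def A.star_mu A.mu_mult_mu flip: g_star g_mult)
    have "B.tr i p = 0" if i: "i < dim_vec W" for i
    proof -
      have "col mult_mat j $ i = 0" unfolding 0 using i mult_mat_carrier by auto
      then show ?thesis using i j mult_mat_carrier by (simp add: p_def mult_mat_entry)
    qed
    then have "p = 0"
      by (intro B.ent_eqI) (use p B.ent_zero_if_tr_zero in \<open>auto simp: B.ent_zero\<close>)
    then have "A.mu j 0 0 = 0" using inj by (simp add: p_def)
    then have "A.ent j 0 0 (A.mu j 0 0) = 0" using j v0 by (simp add: A.ent_zero)
    then show False using j v0 by (simp add: A.ent_mu)
  qed
qed

end

section \<open>Bratteli diagrams\<close>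

lemma nat_mult_mat_vec_mono:
  fixes A :: "nat mat"
  assumes "A \<in> carrier_mat n m" "v \<le> w" "dim_vec w = m"
  shows "A *\<^sub>v v \<le> A *\<^sub>v w"
  using assms unfolding less_eq_vec_def
  by (auto simp: scalar_prod_def intro!: sum_mono)

lemma multiplicity_matrix_mult:
  assumes "multiplicity_matrix V F W" "multiplicity_matrix W G U"
  shows "multiplicity_matrix V (G * F) U"
proof -
  have c: "F \<in> carrier_mat (dim_vec W) (dim_vec V)" "G \<in> carrier_mat (dim_vec U) (dim_vec W)"
    using assms by (auto simp: multiplicity_matrix_def)
  have "(G * F) *\<^sub>v V = G *\<^sub>v (F *\<^sub>v V)"
    using c by (intro assoc_mult_mat_vec) auto
  also have "\<dots> \<le> G *\<^sub>v W"
    using assms by (intro nat_mult_mat_vec_mono[OF c(2)]) (auto simp: multiplicity_matrix_def)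
  also have "\<dots> \<le> U" using assms by (simp add: multiplicity_matrix_def)
  finally show ?thesis using c by (auto simp: multiplicity_matrix_def)
qed

lemma unbounded_nat_seq:
  fixes f :: "nat \<Rightarrow> nat"
  assumes "\<not> bdd_above (range f)"
  obtains n where "N \<le> f n"
  using assms unfolding bdd_above_def by (metis imageE nat_le_linear)

text \<open>The assumption concerns shapes, which is what associativity of matrix products asks
  for.\<close>

locale diagram_seq =
  fixes V :: "nat \<Rightarrow> nat vec" and E :: "nat \<Rightarrow> nat mat"
  assumes E_carrier: "E n \<in> carrier_mat (dim_vec (V (Suc n))) (dim_vec (V n))"
begin

abbreviation conn :: "nat \<Rightarrow> nat \<Rightarrow> nat mat" where
  "conn \<equiv> connecting V E"

lemma connecting_refl [simp]: "conn n n = 1\<^sub>m (dim_vec (V n))"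
  by (simp add: connecting_def)

lemma connecting_Suc: "n \<le> m \<Longrightarrow> conn n (Suc m) = E m * conn n m"
  by (simp add: connecting_def Suc_diff_le)

lemma connecting_carrier:
  "n \<le> m \<Longrightarrow> conn n m \<in> carrier_mat (dim_vec (V m)) (dim_vec (V n))"
proof (induction m rule: dec_induct)
  case (step m)
  then show ?case using E_carrier[of m] by (simp add: connecting_Suc)
qed simp

lemma connecting_trans:
  assumes "n \<le> m" "m \<le> k"
  shows "conn m k * conn n m = conn n k"
  using assms(2)
proof (induction k rule: dec_induct)
  case base
  show ?case using connecting_carrier[OF assms(1)] by simp
next
  case (step k)
  have "conn m (Suc k) * conn n m = E k * (conn m k * conn n m)"
    using E_carrier[of k] connecting_carrier[OF step(1)] connecting_carrier[OF assms(1)] step(1)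
    by (simp add: connecting_Suc assoc_mult_mat)
  then show ?case using step assms(1) by (simp add: connecting_Suc)
qed

lemma connecting_trans_mult:
  assumes "n \<le> m" "m \<le> k" "F \<in> carrier_mat (dim_vec (V n)) l"
  shows "conn m k * (conn n m * F) = conn n k * F"
  using assoc_mult_mat[OF connecting_carrier[OF assms(2)] connecting_carrier[OF assms(1)] assms(3)]
  by (simp add: connecting_trans[OF assms(1,2)])

end

lemma diagram_seqI: "bratteli_diagram (Diagram V E) \<Longrightarrow> diagram_seq V E"
  by unfold_locales (auto simp: embedding_matrix_def multiplicity_matrix_def)

section \<open>Equivalence of premorphisms\<close>

context
  fixes D V E D' W S
  assumes D: "D = Diagram V E" "bratteli_diagram D" and D': "D' = Diagram W S" "bratteli_diagram D'"
begin

interpretation V: diagram_seq V E using D diagram_seqI by blast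
interpretation W: diagram_seq W S using D' diagram_seqI by blast

lemma premorphism_carrier:
  "premorphism D D' (F, f) \<Longrightarrow> F n \<in> carrier_mat (dim_vec (W (f n))) (dim_vec (V n))"
  by (auto simp: D D' multiplicity_matrix_def)

lemma premorphism_mono: "premorphism D D' (F, f) \<Longrightarrow> mono f"
  by (simp add: D D')

text \<open>The commuting squares of consecutive steps are stacked on each other.\<close>

lemma premorphism_connecting:
  assumes P: "premorphism D D' (F, f)" and "n \<le> m"
  shows "F m * V.conn n m = W.conn (f n) (f m) * F n"
  using assms(2)
proof (induction m rule: dec_induct)
  case base
  show ?case using premorphism_carrier[OF P, of n] by simp
next
  case (step m)
  note mf = monoD[OF premorphism_mono[OF P]]
  note c = premorphism_carrier[OF P]
  have "F (Suc m) * V.conn n (Suc m) = F (Suc m) * E m * V.conn n m"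
    using c[of "Suc m"] V.E_carrier[of m] V.connecting_carrier[OF step(1)] step(1)
    by (simp add: V.connecting_Suc assoc_mult_mat)
  also have "F (Suc m) * E m = W.conn (f m) (f (Suc m)) * F m"
    using P by (simp add: D D')
  also have "\<dots> * V.conn n m = W.conn (f m) (f (Suc m)) * (F m * V.conn n m)"
    using c[of m] W.connecting_carrier[OF mf[of m "Suc m"]] V.connecting_carrier[OF step(1)]
    by (simp add: assoc_mult_mat)
  also have "\<dots> = W.conn (f n) (f (Suc m)) * F n"
    unfolding step.IH using c[of n] mf[of n m] mf[of m "Suc m"] step(1)
    by (simp add: W.connecting_trans_mult)
  finally show ?case .
qed

lemma premor_equiv_refl: "premor_equiv D' P P"
  by (cases P) (auto simp: D')

lemma premor_equiv_sym: "premor_equiv D' P Q \<Longrightarrow> premor_equiv D' Q P"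
  by (cases P; cases Q) (simp add: D', metis)

lemma premor_equiv_later:
  assumes P: "premorphism D D' (F, f)" "premorphism D D' (G, g)"
    and m: "f n \<le> m" "g n \<le> m" "W.conn (f n) m * F n = W.conn (g n) m * G n" "m \<le> k"
  shows "W.conn (f n) k * F n = W.conn (g n) k * G n"
  using W.connecting_trans_mult[OF m(1,4) premorphism_carrier[OF P(1)]]
    W.connecting_trans_mult[OF m(2,4) premorphism_carrier[OF P(2)]] m(3) by simp

text \<open>The two equivalences provide equalities at unrelated stages m and k; both persist to
  every later stage, in particular to the maximum.\<close>

lemma premor_equiv_trans:
  assumes "premorphism D D' P" "premorphism D D' Q" "premorphism D D' R"
    and "premor_equiv D' P Q" "premor_equiv D' Q R"
  shows "premor_equiv D' P R"
proof -
  obtain F f G g H h where PQR: "P = (F, f)" "Q = (G, g)" "R = (H, h)" by (metis surj_pair)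
  note p = assms(1-3)[unfolded PQR]
  show ?thesis
    unfolding PQR D'(1) premor_equiv.simps
  proof
    fix n
    obtain m where m: "f n \<le> m" "g n \<le> m" "W.conn (f n) m * F n = W.conn (g n) m * G n"
      using assms(4) by (auto simp: PQR D')
    obtain k where k: "g n \<le> k" "h n \<le> k" "W.conn (g n) k * G n = W.conn (h n) k * H n"
      using assms(5) by (auto simp: PQR D')
    have "W.conn (f n) (max m k) * F n = W.conn (g n) (max m k) * G n"
      by (rule premor_equiv_later[OF p(1,2) m]) simp
    also have "\<dots> = W.conn (h n) (max m k) * H n"
      by (rule premor_equiv_later[OF p(2,3) k]) simp
    finally show "\<exists>m. f n \<le> m \<and> h n \<le> m \<and> W.conn (f n) m * F n = W.conn (h n) m * H n"
      using m k by (intro exI[of _ "max m k"]) auto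
  qed
qed

lemma premor_class_eq:
  assumes "premorphism D D' P" "premorphism D D' Q" "premor_equiv D' P Q"
  shows "premor_class D D' P = premor_class D D' Q"
  unfolding premor_class_def
  using assms premor_equiv_trans premor_equiv_sym by blast

end

section \<open>Composition of premorphisms and of their classes\<close>

context
  fixes D1 V E D2 W S D3 U T
  assumes D1: "D1 = Diagram V E" "bratteli_diagram D1" and D2: "D2 = Diagram W S" "bratteli_diagram D2"
    and D3: "D3 = Diagram U T" "bratteli_diagram D3"
begin

interpretation V: diagram_seq V E using D1 diagram_seqI by blast
interpretation W: diagram_seq W S using D2 diagram_seqI by blast
interpretation U: diagram_seq U T using D3 diagram_seqI by blast

lemma premorphism_comp:
  assumes "premorphism D1 D2 P" "premorphism D2 D3 Q"
  shows "premorphism D1 D3 (premor_comp Q P)"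
proof -
  obtain F f G g where PQ: "P = (F, f)" "Q = (G, g)" by (metis surj_pair)
  have P: "premorphism D1 D2 (F, f)" "premorphism D2 D3 (G, g)" using assms PQ by auto
  have mf: "mono f" and mg: "mono g" using P by (auto simp: D1 D2 D3)
  note cF = premorphism_carrier[OF D1 D2 P(1)] and cG = premorphism_carrier[OF D2 D3 P(2)]
  have "\<not> bdd_above (range (\<lambda>n. g (f n)))"
  proof
    assume "bdd_above (range (\<lambda>n. g (f n)))"
    then obtain B where B: "\<And>n. g (f n) \<le> B" by (auto simp: bdd_above_def)
    have "g N \<le> B" for N
    proof -
      have "\<not> bdd_above (range f)" using P(1) by (simp add: D1 D2)
      then obtain n where "N \<le> f n" by (rule unbounded_nat_seq)
      then show ?thesis using monoD[OF mg] B order_trans by blast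
    qed
    then have "bdd_above (range g)" by (auto simp: bdd_above_def)
    then show False using P(2) by (simp add: D2 D3)
  qed
  moreover have "mono (\<lambda>n. g (f n))" using mf mg by (simp add: mono_def)
  moreover have "multiplicity_matrix (V n) (G (f n) * F n) (U (g (f n)))" for n
    using P by (intro multiplicity_matrix_mult[where W = "W (f n)"]) (auto simp: D1 D2 D3)
  moreover have "G (f (Suc n)) * F (Suc n) * E n =
      U.conn (g (f n)) (g (f (Suc n))) * (G (f n) * F n)" for n
  proof -
    have le: "f n \<le> f (Suc n)" using monoD[OF mf] by simp
    have le': "g (f n) \<le> g (f (Suc n))" using monoD[OF mg] le by simp
    have "G (f (Suc n)) * F (Suc n) * E n = G (f (Suc n)) * (F (Suc n) * E n)"
      using cF[of "Suc n"] cG[of "f (Suc n)"] V.E_carrier[of n] by (simp add: assoc_mult_mat)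
    also have "F (Suc n) * E n = W.conn (f n) (f (Suc n)) * F n"
      using P(1) by (simp add: D1 D2)
    also have "G (f (Suc n)) * (W.conn (f n) (f (Suc n)) * F n) =
        G (f (Suc n)) * W.conn (f n) (f (Suc n)) * F n"
      using cF[of n] cG[of "f (Suc n)"] W.connecting_carrier[OF le] by (simp add: assoc_mult_mat)
    also have "G (f (Suc n)) * W.conn (f n) (f (Suc n)) =
        U.conn (g (f n)) (g (f (Suc n))) * G (f n)"
      by (rule premorphism_connecting[OF D2 D3 P(2) le])
    also have "\<dots> * F n = U.conn (g (f n)) (g (f (Suc n))) * (G (f n) * F n)"
      using cF[of n] cG[of "f n"] U.connecting_carrier[OF le'] by (simp add: assoc_mult_mat)
    finally show ?thesis .
  qed
  ultimately show ?thesis by (simp add: D1 D3 PQ premor_comp_def)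
qed

text \<open>By naturality of the second premorphism, each composite can be rewritten through a stage
  m at which the first premorphisms agree. There the second ones agree after a further passage to
  k.\<close>

lemma premor_comp_cong:
  assumes "premorphism D1 D2 P" "premorphism D1 D2 P'" "premorphism D2 D3 Q" "premorphism D2 D3 Q'"
    and "premor_equiv D2 P P'" "premor_equiv D3 Q Q'"
  shows "premor_equiv D3 (premor_comp Q P) (premor_comp Q' P')"
proof -
  obtain F f F' f' G g G' g' where PQ: "P = (F, f)" "P' = (F', f')" "Q = (G, g)" "Q' = (G', g')"
    by (metis surj_pair)
  have P: "premorphism D1 D2 (F, f)" "premorphism D1 D2 (F', f')"
    and Q: "premorphism D2 D3 (G, g)" "premorphism D2 D3 (G', g')" using assms PQ by auto
  note cF = premorphism_carrier[OF D1 D2 P(1)] premorphism_carrier[OF D1 D2 P(2)]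
  note cG = premorphism_carrier[OF D2 D3 Q(1)] premorphism_carrier[OF D2 D3 Q(2)]
  have mg: "mono g" "mono g'" using Q by (auto simp: D2 D3)
  have push: "U.conn (h l) k * (H l * A) = U.conn (h m) k * (H m * (W.conn l m * A))"
    if H: "premorphism D2 D3 (H, h)" and A: "A \<in> carrier_mat (dim_vec (W l)) (dim_vec (V n))"
      and m: "l \<le> m" "h m \<le> k" for H h l A n m k
  proof -
    note cH = premorphism_carrier[OF D2 D3 H]
    have le: "h l \<le> h m" using monoD[OF premorphism_mono[OF D2 D3 H]] m by simp
    have "H m * (W.conn l m * A) = H m * W.conn l m * A"
      using cH[of m] W.connecting_carrier[OF m(1)] A by (simp add: assoc_mult_mat)
    also have "H m * W.conn l m = U.conn (h l) (h m) * H l"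
      by (rule premorphism_connecting[OF D2 D3 H m(1)])
    also have "\<dots> * A = U.conn (h l) (h m) * (H l * A)"
      using cH[of l] A U.connecting_carrier[OF le] by (simp add: assoc_mult_mat)
    finally show ?thesis
      using cH[of l] A le m(2) by (simp add: U.connecting_trans_mult[of _ _ _ _ "dim_vec (V n)"])
  qed
  show ?thesis
    unfolding PQ D3(1) premor_comp_def premor_equiv.simps fst_conv snd_conv
  proof
    fix n
    obtain m where m: "f n \<le> m" "f' n \<le> m" "W.conn (f n) m * F n = W.conn (f' n) m * F' n"
      using assms(5) by (auto simp: PQ D2)
    obtain k where k: "g m \<le> k" "g' m \<le> k" "U.conn (g m) k * G m = U.conn (g' m) k * G' m"
      using assms(6) by (auto simp: PQ D3)
    let ?X = "W.conn (f n) m * F n"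
    have X: "?X \<in> carrier_mat (dim_vec (W m)) (dim_vec (V n))"
      using cF(1)[of n] W.connecting_carrier[OF m(1)] by simp
    have "U.conn (g (f n)) k * (G (f n) * F n) = U.conn (g m) k * (G m * ?X)"
      by (rule push[OF Q(1) cF(1)[of n] m(1) k(1)])
    also have "\<dots> = U.conn (g m) k * G m * ?X"
      using X cG(1)[of m] U.connecting_carrier[OF k(1)] by (simp add: assoc_mult_mat)
    also have "\<dots> = U.conn (g' m) k * G' m * (W.conn (f' n) m * F' n)"
      unfolding k(3) m(3) ..
    also have "\<dots> = U.conn (g' m) k * (G' m * (W.conn (f' n) m * F' n))"
      using X[unfolded m(3)] cG(2)[of m] U.connecting_carrier[OF k(2)] by (simp add: assoc_mult_mat)
    also have "\<dots> = U.conn (g' (f' n)) k * (G' (f' n) * F' n)"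
      by (rule push[OF Q(2) cF(2)[of n] m(2) k(2), symmetric])
    finally have "U.conn (g (f n)) k * (G (f n) * F n) = U.conn (g' (f' n)) k * (G' (f' n) * F' n)" .
    moreover have "g (f n) \<le> k" "g' (f' n) \<le> k"
      using monoD[OF mg(1) m(1)] monoD[OF mg(2) m(2)] k by auto
    ultimately show "\<exists>m. g (f n) \<le> m \<and> g' (f' n) \<le> m \<and>
        U.conn (g (f n)) m * (G (f n) * F n) = U.conn (g' (f' n)) m * (G' (f' n) * F' n)"
      by blast
  qed
qed

text \<open>All composites of representatives give the same class, and the union is over nonempty
  sets because each class contains its representative.\<close>

lemma bd_comp_class:
  assumes P: "premorphism D1 D2 P" and Q: "premorphism D2 D3 Q"
  shows "bd_comp D1 D2 D3 (Cls (premor_class D2 D3 Q)) (Cls (premor_class D1 D2 P)) =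
    Cls (premor_class D1 D3 (premor_comp Q P))"
proof -
  have *: "premor_class D1 D3 (premor_comp G F) = premor_class D1 D3 (premor_comp Q P)"
    if "F \<in> premor_class D1 D2 P" "G \<in> premor_class D2 D3 Q" for F G
  proof (rule premor_class_eq[OF D1 D3])
    have F: "premorphism D1 D2 F" and G: "premorphism D2 D3 G"
      and PF: "premor_equiv D2 P F" and QG: "premor_equiv D3 Q G"
      using that by (auto simp: premor_class_def)
    have FP: "premor_equiv D2 F P" by (rule premor_equiv_sym[OF D1 D2 PF])
    have GQ: "premor_equiv D3 G Q" by (rule premor_equiv_sym[OF D2 D3 QG])
    show "premorphism D1 D3 (premor_comp G F)" "premorphism D1 D3 (premor_comp Q P)"
      by (rule premorphism_comp; fact)+
    show "premor_equiv D3 (premor_comp G F) (premor_comp Q P)"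
      by (rule premor_comp_cong; fact)
  qed
  have "P \<in> premor_class D1 D2 P" "Q \<in> premor_class D2 D3 Q"
    unfolding premor_class_def using P Q premor_equiv_refl[OF D1 D2] premor_equiv_refl[OF D2 D3] by blast+
  then have "(\<Union>F\<in>premor_class D1 D2 P. \<Union>G\<in>premor_class D2 D3 Q. premor_class D1 D3 (premor_comp G F)) =
      premor_class D1 D3 (premor_comp Q P)"
    using * by blast
  then show ?thesis by (simp add: D1(1) D2(1) D3(1))
qed

end

section \<open>The functor\<close>

context fd_hom
begin

text \<open>The trace formula of \<open>h\<close> is applied to the projection g(e_00), whose own
  traces form a column of the matrix of \<open>g\<close>. The result is an entry of the matrix
  product.\<close>

lemma mult_mat_comp:
  assumes "fd_hom T W \<omega> X U \<zeta> h"
  shows "fd_hom.mult_mat S V \<chi> U \<zeta> (\<lambda>x. h (g x)) = fd_hom.mult_mat T W \<omega> U \<zeta> h * mult_mat"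
proof -
  interpret H: fd_hom T W \<omega> X U \<zeta> h by fact
  interpret C: fd_hom S V \<chi> X U \<zeta> "\<lambda>x. h (g x)"
    by unfold_locales (simp_all add: g_add H.g_add g_scaleC H.g_scaleC g_mult H.g_mult g_star H.g_star)
  show ?thesis
  proof (rule C.mult_mat_eqI)
    show "H.mult_mat * mult_mat \<in> carrier_mat (dim_vec U) (dim_vec V)"
      using H.mult_mat_carrier mult_mat_carrier by simp
    fix i j assume ij: "i < dim_vec U" "j < dim_vec V"
    have "H.B.tr i (h (g (A.mu j 0 0))) =
        (\<Sum>l<dim_vec W. of_nat (H.mult_mat $$ (i, l)) * of_nat (mult_mat $$ (l, j)))"
      using ij by (subst H.tr_mult_mat) (auto simp: mult_mat_entry)
    also have "\<dots> = of_nat ((H.mult_mat * mult_mat) $$ (i, j))"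
      using ij H.mult_mat_carrier mult_mat_carrier
      by (auto simp: scalar_prod_def lessThan_atLeast0 intro!: sum.cong)
    finally show "H.B.tr i (h (g (A.mu j 0 0))) = of_nat ((H.mult_mat * mult_mat) $$ (i, j))" .
  qed
qed

text \<open>The factors \<open>z p\<close> and \<open>z' p\<close> may lie outside \<open>T\<close>.
  This freedom matters: u \<phi>(p) belongs to B but in general to no B_m.\<close>

lemma mult_mat_close:
  assumes h: "fd_hom S V \<chi> T W \<omega> h"
    and z: "\<And>p. p \<in> S \<Longrightarrow> star p = p \<Longrightarrow> p * p = p \<Longrightarrow>
      g p = z p * star (z p) \<and> h p = z' p * star (z' p) \<and> norm (z p - z' p) < 1"
  shows "fd_hom.mult_mat S V \<chi> W \<omega> h = mult_mat"
proof -
  interpret H: fd_hom S V \<chi> T W \<omega> h by fact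
  show ?thesis
  proof (rule H.mult_mat_eqI[OF mult_mat_carrier])
    fix i j assume ij: "i < dim_vec W" "j < dim_vec V"
    define p where "p = A.mu j 0 0"
    have p: "p \<in> S" "star p = p" "p * p = p"
      using ij A.V_pos by (simp_all add: p_def A.star_mu A.mu_mult_mu)
    note zp = z[OF p]
    have gp: "g p \<in> T" "g p * g p = g p" "h p \<in> T" "h p * h p = h p"
      using p by (simp_all flip: g_mult H.g_mult)
    have "B.tr i (z p * star (z p)) = B.tr i (z' p * star (z' p))"
      using zp gp by (intro B.tr_eq_if_close[OF ij(1)]) auto
    then have "B.tr i (h p) = B.tr i (g p)" using zp by simp
    then show "B.tr i (h (A.mu j 0 0)) = of_nat (mult_mat $$ (i, j))"
      using mult_mat_entry[OF ij] by (simp add: p_def)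
  qed
qed

end

section \<open>R along the sequence of subalgebras of an AF algebra\<close>

lemma fd_algI: "AF \<A> \<Longrightarrow> fd_alg (sub \<A> n) (sizes \<A> n) (chart \<A> n)"
  by unfold_locales (auto simp: AF_def)

lemma AF_sub_mono: "AF \<A> \<Longrightarrow> n \<le> m \<Longrightarrow> sub \<A> n \<subseteq> sub \<A> m"
  by (rule lift_Suc_mono_le[of "sub \<A>"]) (auto simp: AF_def)

abbreviation af_hom :: "'a::cstar_algebra af_object \<Rightarrow> nat \<Rightarrow> 'b::cstar_algebra af_object \<Rightarrow> nat \<Rightarrow> ('a \<Rightarrow> 'b) \<Rightarrow> bool" where
  "af_hom \<A> n \<B> m \<equiv> fd_hom (sub \<A> n) (sizes \<A> n) (chart \<A> n) (sub \<B> m) (sizes \<B> m) (chart \<B> m)"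

abbreviation af_mult :: "'a::cstar_algebra af_object \<Rightarrow> nat \<Rightarrow> 'b::cstar_algebra af_object \<Rightarrow> nat \<Rightarrow> ('a \<Rightarrow> 'b) \<Rightarrow> nat mat" where
  "af_mult \<A> n \<B> m \<equiv> fd_hom.mult_mat (sub \<A> n) (sizes \<A> n) (chart \<A> n) (sizes \<B> m) (chart \<B> m)"

abbreviation af_steps :: "'a::cstar_algebra af_object \<Rightarrow> nat \<Rightarrow> nat mat" where
  "af_steps \<A> \<equiv> \<lambda>n. af_mult \<A> n \<A> (Suc n) (\<lambda>x. x)"

abbreviation af_connecting :: "'a::cstar_algebra af_object \<Rightarrow> nat \<Rightarrow> nat \<Rightarrow> nat mat" where
  "af_connecting \<A> \<equiv> connecting (sizes \<A>) (af_steps \<A>)"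

lemma af_homI:
  assumes "AF \<A>" "AF \<B>" "star_hom g" "\<And>x. x \<in> sub \<A> n \<Longrightarrow> g x \<in> sub \<B> m"
  shows "af_hom \<A> n \<B> m g"
proof -
  interpret A: fd_alg "sub \<A> n" "sizes \<A> n" "chart \<A> n" by (rule fd_algI[OF assms(1)])
  interpret B: fd_alg "sub \<B> m" "sizes \<B> m" "chart \<B> m" by (rule fd_algI[OF assms(2)])
  show ?thesis
    by unfold_locales (use assms in \<open>auto simp: star_hom_add star_hom_scaleC star_hom_mult star_hom_star\<close>)
qed

lemma star_hom_id: "star_hom (\<lambda>x. x)"
  by (simp add: star_hom_def)

lemma af_hom_inclusion: "AF \<A> \<Longrightarrow> n \<le> m \<Longrightarrow> af_hom \<A> n \<A> m (\<lambda>x. x)"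
  using AF_sub_mono by (intro af_homI star_hom_id) blast+

lemma af_mult_id:
  assumes "AF \<A>"
  shows "af_mult \<A> n \<A> n (\<lambda>x. x) = 1\<^sub>m (dim_vec (sizes \<A> n))"
proof -
  interpret fd_hom "sub \<A> n" "sizes \<A> n" "chart \<A> n" "sub \<A> n" "sizes \<A> n" "chart \<A> n" "\<lambda>x. x"
    using af_hom_inclusion[OF assms, of n n] by simp
  show ?thesis by (rule mult_mat_eqI) (auto simp: A.tr_mu A.V_pos)
qed

lemma B_obj_eq:
  fixes \<A> :: "'a::cstar_algebra af_object"
  assumes "AF \<A>" "\<not> is_zero_algebra TYPE('a)"
  shows "B_obj \<A> = Diagram (sizes \<A>) (af_steps \<A>)"
proof -
  have "af_hom \<A> n \<A> (Suc n) (\<lambda>x. x)" for n by (rule af_hom_inclusion[OF assms(1)]) simp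
  from fd_hom.mult_mat_def[OF this] show ?thesis using assms(2) by (simp add: B_obj_def o_def)
qed

lemma bratteli_diagram_B_obj:
  fixes \<A> :: "'a::cstar_algebra af_object"
  assumes "AF \<A>"
  shows "bratteli_diagram (B_obj \<A>)"
proof (cases "is_zero_algebra TYPE('a)")
  case True
  then show ?thesis by (simp add: B_obj_def)
next
  case False
  have "embedding_matrix (sizes \<A> n) (af_mult \<A> n \<A> (Suc n) (\<lambda>x. x)) (sizes \<A> (Suc n))" for n
    by (rule fd_hom.mult_mat_embedding[OF af_hom_inclusion[OF assms]]) auto
  then show ?thesis using assms False by (auto simp: B_obj_eq AF_def)
qed

context
  fixes \<B> :: "'b::cstar_algebra af_object"
  assumes AF: "AF \<B>" and nz: "\<not> is_zero_algebra TYPE('b)"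
begin

text \<open>Multiplicativity of R turns the product of the steps into R of the composite
  inclusion.\<close>

lemma connecting_eq_af_mult:
  assumes "n \<le> m"
  shows "af_connecting \<B> n m = af_mult \<B> n \<B> m (\<lambda>x. x)"
proof -
  interpret diagram_seq "sizes \<B>" "af_steps \<B>"
    by (rule diagram_seqI, fold B_obj_eq[OF AF nz], rule bratteli_diagram_B_obj[OF AF])
  show ?thesis
    using assms
  proof (induction m rule: dec_induct)
    case base
    show ?case using af_mult_id[OF AF] by simp
  next
    case (step m)
    show ?case
      using fd_hom.mult_mat_comp[OF af_hom_inclusion[OF AF step(1)] af_hom_inclusion[OF AF, of m "Suc m"]] step
      by (simp add: connecting_Suc)
  qed
qed

lemma connecting_mult_af_mult:
  assumes "af_hom \<A> n \<B> k g" "k \<le> m"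
  shows "af_connecting \<B> k m * af_mult \<A> n \<B> k g = af_mult \<A> n \<B> m g"
  using fd_hom.mult_mat_comp[OF assms(1) af_hom_inclusion[OF AF assms(2)]] connecting_eq_af_mult[OF assms(2)]
  by simp

end

text \<open>Multiplying by a connecting matrix only enlarges the codomain, so it is enough to
  compare two homomorphisms from A_n into a common B_m.\<close>

lemma af_premor_equivI:
  fixes \<B> :: "'b::cstar_algebra af_object"
  assumes "AF \<B>" "\<not> is_zero_algebra TYPE('b)"
    and F: "\<And>n. af_hom \<A> n \<B> (f n) (F n)" and G: "\<And>n. af_hom \<A> n \<B> (g n) (G n)"
    and eq: "\<And>n m. f n \<le> m \<Longrightarrow> g n \<le> m \<Longrightarrow> af_mult \<A> n \<B> m (F n) = af_mult \<A> n \<B> m (G n)"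
  shows "premor_equiv (B_obj \<B>) (\<lambda>n. af_mult \<A> n \<B> (f n) (F n), f) (\<lambda>n. af_mult \<A> n \<B> (g n) (G n), g)"
  unfolding B_obj_eq[OF assms(1,2)] premor_equiv.simps
proof
  fix n
  show "\<exists>m\<ge>f n. g n \<le> m \<and> af_connecting \<B> (f n) m * af_mult \<A> n \<B> (f n) (F n) =
      af_connecting \<B> (g n) m * af_mult \<A> n \<B> (g n) (G n)"
    using eq[of n "max (f n) (g n)"]
    by (intro exI[of _ "max (f n) (g n)"]) (simp add: connecting_mult_af_mult[OF assms(1,2)] F G)
qed

lemma admissible_in: "admissible \<A> \<B> \<phi> u f \<Longrightarrow> x \<in> sub \<A> n \<Longrightarrow> Ad (u n) (\<phi> x) \<in> sub \<B> (f n)"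
  by (simp add: admissible_def image_subset_iff)

lemma B_premor_eq:
  assumes "AF \<A>" "AF \<B>" "star_hom \<phi>" "admissible \<A> \<B> \<phi> u f"
  shows "B_premor \<A> \<B> \<phi> u f = (\<lambda>n. af_mult \<A> n \<B> (f n) (\<lambda>x. Ad (u n) (\<phi> x)), f)"
    "f n \<le> m \<Longrightarrow> af_hom \<A> n \<B> m (\<lambda>x. Ad (u n) (\<phi> x))"
proof -
  have hom: "af_hom \<A> n \<B> m (\<lambda>x. Ad (u n) (\<phi> x))" if "f n \<le> m" for n m
  proof (rule af_homI)
    show "star_hom (\<lambda>x. Ad (u n) (\<phi> x))"
      using star_hom_comp[OF star_hom_Ad assms(3)] assms(4) by (simp add: admissible_def o_def)
    show "Ad (u n) (\<phi> x) \<in> sub \<B> m" if "x \<in> sub \<A> n" for x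
      using admissible_in[OF assms(4) that] AF_sub_mono[OF assms(2) \<open>f n \<le> m\<close>] by blast
  qed (use assms in auto)
  show "B_premor \<A> \<B> \<phi> u f = (\<lambda>n. af_mult \<A> n \<B> (f n) (\<lambda>x. Ad (u n) (\<phi> x)), f)"
    using fd_hom.mult_mat_def[OF hom[OF order_refl]] by (simp add: B_premor_def o_def)
  show "f n \<le> m \<Longrightarrow> af_hom \<A> n \<B> m (\<lambda>x. Ad (u n) (\<phi> x))" by (rule hom)
qed

lemma Ad_star_hom_projection:
  assumes "star_hom \<phi>" "star p = p" "p * p = p"
  shows "Ad u (\<phi> p) = tilde_act u (\<phi> p) * star (tilde_act u (\<phi> p))" "norm (\<phi> p) \<le> 1"
proof -
  have p: "star (\<phi> p) = \<phi> p" "\<phi> p * \<phi> p = \<phi> p" using assms by (metis star_hom_star star_hom_mult)+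
  then show "norm (\<phi> p) \<le> 1" by (rule norm_projection_le_1)
  show "Ad u (\<phi> p) = tilde_act u (\<phi> p) * star (tilde_act u (\<phi> p))"
    using Ad_mult_star[of u "\<phi> p"] p by simp
qed

lemma norm_tilde_act_minus_le_const:
  assumes "tilde_unitary u" "tilde_norm (u - tilde_one) < r" "norm x \<le> 1" "0 \<le> r"
  shows "norm (tilde_act u x - x) \<le> r"
  using norm_tilde_act_minus_le[OF assms(1) less_imp_le[OF assms(2)], of x] mult_left_le[OF assms(3,4)]
  by linarith

text \<open>The place where the bound 1/2 enters, once for each unitary. The case x = 0 is separate
  because the strict bounds are multiplied by norm x.\<close>

lemma norm_tilde_act_diff_less:
  assumes "tilde_unitary u" "tilde_norm (u - tilde_one) < 1/2"
    "tilde_unitary v" "tilde_norm (v - tilde_one) < 1/2" "norm x \<le> 1"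
  shows "norm (tilde_act u x - tilde_act v x) < 1"
proof (cases "x = 0")
  case False
  have "norm (tilde_act u x - tilde_act v x) \<le> norm (tilde_act u x - x) + norm (tilde_act v x - x)"
    using norm_triangle_ineq4[of "tilde_act u x - x" "tilde_act v x - x"] by simp
  also have "\<dots> \<le> tilde_norm (u - tilde_one) * norm x + tilde_norm (v - tilde_one) * norm x"
    by (intro add_mono norm_tilde_act_minus_le assms order_refl)
  also have "\<dots> < 1/2 * norm x + 1/2 * norm x"
    using assms False by (intro add_strict_mono mult_strict_right_mono) auto
  finally show ?thesis using assms(5) by simp
qed simp

lemma af_mult_close:
  assumes AF: "AF \<A>" "AF \<B>" and \<phi>: "star_hom \<phi>"
    and u: "tilde_unitary u" "tilde_norm (u - tilde_one) < 1/2"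
    and v: "tilde_unitary v" "tilde_norm (v - tilde_one) < 1/2"
    and hom: "af_hom \<A> n \<B> m (\<lambda>x. Ad u (\<phi> x))" "af_hom \<A> n \<B> m (\<lambda>x. Ad v (\<phi> x))"
  shows "af_mult \<A> n \<B> m (\<lambda>x. Ad u (\<phi> x)) = af_mult \<A> n \<B> m (\<lambda>x. Ad v (\<phi> x))"
  by (rule fd_hom.mult_mat_close[OF hom(2,1), where z = "\<lambda>p. tilde_act v (\<phi> p)"
        and z' = "\<lambda>p. tilde_act u (\<phi> p)"])
    (use Ad_star_hom_projection[OF \<phi>] norm_tilde_act_diff_less[OF v u] in auto)

section \<open>Well-definedness of the assignment on morphisms\<close>

context
  fixes \<A> :: "'a::cstar_algebra af_object" and \<B> :: "'b::cstar_algebra af_object"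
    and \<phi> :: "'a \<Rightarrow> 'b"
  assumes AF: "AF \<A>" "AF \<B>" and hom: "star_hom \<phi>"
    and nz: "\<not> is_zero_algebra TYPE('a)" "\<not> is_zero_algebra TYPE('b)"
begin

text \<open>On A_n both \<open>u n\<close> and \<open>u (Suc n)\<close> give small perturbations of
  \<phi>, and the two sides of the square are R of these perturbations into B at stage
  \<open>f (Suc n)\<close>. Closeness identifies them.\<close>

lemma premorphism_B_premor:
  assumes adm: "admissible \<A> \<B> \<phi> u f"
  shows "premorphism (B_obj \<A>) (B_obj \<B>) (B_premor \<A> \<B> \<phi> u f)"
proof -
  note h = B_premor_eq(2)[OF AF hom adm]
  have mf: "mono f" and u: "tilde_unitary (u n)" "tilde_norm (u n - tilde_one) < 1/2" for n
    using adm by (auto simp: admissible_def)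
  have "af_mult \<A> (Suc n) \<B> (f (Suc n)) (\<lambda>x. Ad (u (Suc n)) (\<phi> x)) * af_mult \<A> n \<A> (Suc n) (\<lambda>x. x) =
      af_connecting \<B> (f n) (f (Suc n)) *
        af_mult \<A> n \<B> (f n) (\<lambda>x. Ad (u n) (\<phi> x))" for n
  proof -
    have le: "f n \<le> f (Suc n)" using monoD[OF mf] by simp
    have incl: "af_hom \<A> n \<A> (Suc n) (\<lambda>x. x)" by (rule af_hom_inclusion[OF AF(1)]) simp
    have h': "af_hom \<A> n \<B> (f (Suc n)) (\<lambda>x. Ad (u (Suc n)) (\<phi> x))"
    proof (rule af_homI[OF AF])
      show "star_hom (\<lambda>x. Ad (u (Suc n)) (\<phi> x))"
        using star_hom_comp[OF star_hom_Ad[OF u(1)] hom] by (simp add: o_def)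
      show "Ad (u (Suc n)) (\<phi> x) \<in> sub \<B> (f (Suc n))" if "x \<in> sub \<A> n" for x
        using AF_sub_mono[OF AF(1), of n "Suc n"] that by (intro admissible_in[OF adm]) auto
    qed
    have "af_mult \<A> (Suc n) \<B> (f (Suc n)) (\<lambda>x. Ad (u (Suc n)) (\<phi> x)) * af_mult \<A> n \<A> (Suc n) (\<lambda>x. x) =
        af_mult \<A> n \<B> (f (Suc n)) (\<lambda>x. Ad (u (Suc n)) (\<phi> x))"
      using fd_hom.mult_mat_comp[OF incl h[OF order_refl]] by simp
    also have "\<dots> = af_mult \<A> n \<B> (f (Suc n)) (\<lambda>x. Ad (u n) (\<phi> x))"
      by (rule af_mult_close[OF AF hom u u h' h[OF le]])
    also have "\<dots> = af_connecting \<B> (f n) (f (Suc n)) *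
        af_mult \<A> n \<B> (f n) (\<lambda>x. Ad (u n) (\<phi> x))"
      by (rule connecting_mult_af_mult[OF AF(2) nz(2) h[OF order_refl] le, symmetric])
    finally show ?thesis .
  qed
  moreover have "multiplicity_matrix (sizes \<A> n) (af_mult \<A> n \<B> (f n) (\<lambda>x. Ad (u n) (\<phi> x))) (sizes \<B> (f n))" for n
    by (rule fd_hom.mult_mat_size[OF h[OF order_refl]])
  ultimately show ?thesis
    using adm unfolding B_premor_eq(1)[OF AF hom adm] B_obj_eq[OF AF(1) nz(1)] B_obj_eq[OF AF(2) nz(2)]
    by (simp add: admissible_def)
qed

lemma premor_equiv_B_premor:
  assumes adm: "admissible \<A> \<B> \<phi> u f" "admissible \<A> \<B> \<phi> v g"
  shows "premor_equiv (B_obj \<B>) (B_premor \<A> \<B> \<phi> u f) (B_premor \<A> \<B> \<phi> v g)"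
  unfolding B_premor_eq(1)[OF AF hom adm(1)] B_premor_eq(1)[OF AF hom adm(2)]
proof (rule af_premor_equivI[OF AF(2) nz(2)])
  note h = B_premor_eq(2)[OF AF hom adm(1)] B_premor_eq(2)[OF AF hom adm(2)]
  show "af_hom \<A> n \<B> (f n) (\<lambda>x. Ad (u n) (\<phi> x))" "af_hom \<A> n \<B> (g n) (\<lambda>x. Ad (v n) (\<phi> x))" for n
    by (rule h[OF order_refl])+
  show "af_mult \<A> n \<B> m (\<lambda>x. Ad (u n) (\<phi> x)) = af_mult \<A> n \<B> m (\<lambda>x. Ad (v n) (\<phi> x))"
    if "f n \<le> m" "g n \<le> m" for n m
    by (rule af_mult_close[OF AF hom _ _ _ _ h(1)[OF that(1)] h(2)[OF that(2)]])
      (use adm in \<open>auto simp: admissible_def\<close>)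
qed

text \<open>The free \<epsilon> serves composition, where 1/2 is too coarse. Each n is treated
  separately by perturbing the images of the matrix units of A_n; no coherence between the unitaries
  is asked for.\<close>

lemma ex_admissible:
  assumes \<epsilon>: "0 < \<epsilon>" "\<epsilon> \<le> 1/2"
  shows "\<exists>u f. admissible \<A> \<B> \<phi> u f \<and> (\<forall>n. tilde_norm (u n - tilde_one) < \<epsilon>)"
proof -
  have "\<exists>um. tilde_unitary (fst um) \<and> tilde_norm (fst um - tilde_one) < \<epsilon> \<and>
      (\<forall>x\<in>sub \<A> n. Ad (fst um) (\<phi> x) \<in> sub \<B> (snd um))" for n
  proof -
    interpret A: fd_alg "sub \<A> n" "sizes \<A> n" "chart \<A> n" by (rule fd_algI[OF AF(1)])
    let ?d = "dim_vec (sizes \<A> n)"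
    \<comment> \<open>An index (j, k) is row k of summand j. Some of the images \<open>e a\<close>
      may be 0, which the relations permit.\<close>
    define I where "I = (SIGMA j:{..<?d}. {..<sizes \<A> n $ j})"
    define e where "e a = \<phi> (A.mu (fst a) (snd a) 0)" for a
    define q where "q j = \<phi> (A.mu j 0 0)" for j
    have ee: "e a * star (e b) = \<phi> (A.mu (fst a) (snd a) (snd b))" if "a \<in> I" "b \<in> I" "fst a = fst b" for a b
      using that A.V_pos
      by (auto simp: e_def I_def A.star_mu A.mu_mult_mu simp flip: star_hom_star[OF hom] star_hom_mult[OF hom])
    obtain b m where b: "b + star b + star b * b = 0" "b + star b + b * star b = 0" "norm b < \<epsilon>"
      "\<And>a a' x. a \<in> I \<Longrightarrow> a' \<in> I \<Longrightarrow> fst a = fst a' \<Longrightarrow> x = e a * star (e a') \<Longrightarrow>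
        x + b * x + x * star b + b * x * star b \<in> sub \<B> m"
    proof (rule ex_small_unitary_into_union[where I = I and e = e and q = q and blk = fst
          and base = "\<lambda>j. (j, 0)" and D = "sub \<B>" and \<epsilon> = \<epsilon>])
      show "star (e a) * e b = (if a = b then q (fst a) else 0)" if "a \<in> I" "b \<in> I" for a b
        using that A.V_pos
        by (auto simp: e_def q_def I_def A.star_mu A.mu_mult_mu star_hom_zero[OF hom] prod_eq_iff
            simp flip: star_hom_star[OF hom] star_hom_mult[OF hom])
      show "star (q (fst a)) = q (fst a)" "q (fst a) * q (fst a) = q (fst a)"
        "(fst a, 0) \<in> I" "e (fst a, 0) = q (fst a)" if "a \<in> I" for a
        using that A.V_pos
        by (auto simp: q_def e_def I_def A.star_mu A.mu_mult_mu simp flip: star_hom_star[OF hom] star_hom_mult[OF hom])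
    qed (use AF(2) \<epsilon> in \<open>auto simp: I_def AF_def\<close>)
    obtain u where u: "tilde_unitary u" "tilde_norm (u - tilde_one) \<le> norm b"
      "\<And>x. tilde_act u x = x + b * x"
      using ex_tilde_unitary[OF b(1,2)] by metis
    have Adu: "Ad u x = x + b * x + x * star b + b * x * star b" for x
      by (simp add: Ad_eq u(3) star_simps distrib_left distrib_right mult.assoc add_ac)
    have hom': "star_hom (\<lambda>x. Ad u (\<phi> x))"
      using star_hom_comp[OF star_hom_Ad[OF u(1)] hom] by (simp add: o_def)
    note subB = cstar_subalgebraD[of "sub \<B> m"]
    have cs: "cstar_subalgebra (sub \<B> m)" using AF(2) by (simp add: AF_def)
    have "Ad u (\<phi> x) \<in> sub \<B> m" if x: "x \<in> sub \<A> n" for x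
    proof -
      have mu: "Ad u (\<phi> (A.mu j k l)) \<in> sub \<B> m" if "j < ?d" "k < sizes \<A> n $ j" "l < sizes \<A> n $ j" for j k l
      proof -
        have I: "(j, k) \<in> I" "(j, l) \<in> I" using that by (auto simp: I_def)
        show ?thesis using b(4)[OF I] ee[OF I] by (simp add: Adu)
      qed
      have "Ad u (\<phi> x) = (\<Sum>j<?d. \<Sum>k<sizes \<A> n $ j. \<Sum>l<sizes \<A> n $ j.
          scaleC (A.ent j k l x) (Ad u (\<phi> (A.mu j k l))))"
        by (subst A.expand[OF x]) (simp add: star_hom_sum[OF hom'] star_hom_scaleC[OF hom'])
      also have "\<dots> \<in> sub \<B> m"
        by (intro subB(9)[OF cs] subB(3)[OF cs] mu) auto
      finally show ?thesis .
    qed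
    then show ?thesis using u b(3) by (intro exI[of _ "(u, m)"]) auto
  qed
  then obtain um where um: "\<And>n. tilde_unitary (fst (um n))" "\<And>n. tilde_norm (fst (um n) - tilde_one) < \<epsilon>"
    "\<And>n x. x \<in> sub \<A> n \<Longrightarrow> Ad (fst (um n)) (\<phi> x) \<in> sub \<B> (snd (um n))"
    by metis
  \<comment> \<open>The stages found for the individual n need not increase. Their partial sums do
    and dominate each of them, and the summand n makes \<open>f\<close> unbounded.\<close>
  define f where "f n = n + (\<Sum>i\<le>n. snd (um i))" for n
  have "mono f" unfolding mono_iff_le_Suc by (simp add: f_def)
  moreover have "\<not> bdd_above (range f)"
  proof
    assume "bdd_above (range f)"
    then obtain B where "\<And>n. f n \<le> B" by (auto simp: bdd_above_def)
    from this[of "Suc B"] show False by (simp add: f_def)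
  qed
  moreover have "(\<lambda>a. Ad (fst (um n)) (\<phi> a)) ` sub \<A> n \<subseteq> sub \<B> (f n)" for n
  proof -
    have "snd (um n) \<le> f n" unfolding f_def by (rule trans_le_add2, rule member_le_sum) auto
    then show ?thesis using um(3) AF_sub_mono[OF AF(2)] by blast
  qed
  moreover have "tilde_norm (fst (um n) - tilde_one) < 1/2" for n
    using um(2)[of n] \<epsilon>(2) by linarith
  ultimately have "admissible \<A> \<B> \<phi> (\<lambda>n. fst (um n)) f"
    using um(1) by (simp add: admissible_def)
  then show ?thesis using um(2) by blast
qed

text \<open>\<open>B_mor\<close> selects its data by choice and treats the zero map apart.
  Independence of the data settles the former; for the zero map the data u = 1, f n = n give exactly
  the zero matrices of \<open>bd_zero\<close>.\<close>

lemma B_mor_eq: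
  assumes adm: "admissible \<A> \<B> \<phi> u f"
  shows "B_mor \<A> \<B> \<phi> = Cls (premor_class (B_obj \<A>) (B_obj \<B>) (B_premor \<A> \<B> \<phi> u f))"
proof -
  note D = B_obj_eq[OF AF(1) nz(1)] bratteli_diagram_B_obj[OF AF(1)]
  note D' = B_obj_eq[OF AF(2) nz(2)] bratteli_diagram_B_obj[OF AF(2)]
  have "\<exists>v g. admissible \<A> \<B> \<phi> v g \<and>
      B_mor \<A> \<B> \<phi> = Cls (premor_class (B_obj \<A>) (B_obj \<B>) (B_premor \<A> \<B> \<phi> v g))"
  proof (cases "\<phi> = (\<lambda>_. 0)")
    case False
    define vg where "vg = (SOME (u, f). admissible \<A> \<B> \<phi> u f)"
    have "case vg of (v, g) \<Rightarrow> admissible \<A> \<B> \<phi> v g"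
      unfolding vg_def by (rule someI[of _ "(u, f)"]) (simp add: adm)
    then show ?thesis
      using False by (auto simp: B_mor_def vg_def[symmetric] split: prod.splits)
  next
    case True
    have adm0: "admissible \<A> \<B> \<phi> (\<lambda>_. tilde_one) (\<lambda>n. n)"
      using True AF(2) cstar_subalgebraD(1)
      by (auto simp: admissible_def mono_def bdd_above_nat tilde_unitary_one tilde_norm_zero AF_def)
    have "af_mult \<A> n \<B> n (\<lambda>x. Ad tilde_one (\<phi> x)) = 0\<^sub>m (dim_vec (sizes \<B> n)) (dim_vec (sizes \<A> n))" for n
    proof -
      interpret fd_hom "sub \<A> n" "sizes \<A> n" "chart \<A> n" "sub \<B> n" "sizes \<B> n" "chart \<B> n"
        "\<lambda>x. Ad tilde_one (\<phi> x)"
        by (rule B_premor_eq(2)[OF AF hom adm0 order_refl])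
      show ?thesis by (rule mult_mat_eqI) (auto simp: True B.tr_zero)
    qed
    then show ?thesis
      using adm0 by (intro exI[of _ "\<lambda>_. tilde_one"] exI[of _ "\<lambda>n. n"])
        (simp add: B_premor_eq(1)[OF AF hom adm0] B_mor_def True[symmetric] D(1) D'(1))
  qed
  then obtain v g where vg: "admissible \<A> \<B> \<phi> v g"
    "B_mor \<A> \<B> \<phi> = Cls (premor_class (B_obj \<A>) (B_obj \<B>) (B_premor \<A> \<B> \<phi> v g))"
    by blast
  show ?thesis
    unfolding vg(2) bd_morphism.inject
    by (intro premor_class_eq[OF D D'] premorphism_B_premor premor_equiv_B_premor adm vg(1))
qed

end

lemma star_hom_zero_algebra:
  fixes \<phi> :: "'a::cstar_algebra \<Rightarrow> 'b::cstar_algebra"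
  assumes "star_hom \<phi>" "is_zero_algebra TYPE('a) \<or> is_zero_algebra TYPE('b)"
  shows "\<phi> = (\<lambda>_. 0)"
proof
  fix x
  show "\<phi> x = 0"
  proof (cases "is_zero_algebra TYPE('a)")
    case True
    then have "x = 0" unfolding is_zero_algebra_def by (metis UNIV_I singletonD)
    then show ?thesis using star_hom_zero[OF assms(1)] by simp
  next
    case False
    then show ?thesis using assms(2) unfolding is_zero_algebra_def by (metis UNIV_I singletonD)
  qed
qed

text \<open>The representatives are compared through \<open>z = w \<psi>(u \<phi>(p))\<close> and \<open>z' = v \<psi>(\<phi>(p))\<close>. Three
  unitaries enter, so the bound \<open>1/2\<close> would not give \<open>\<parallel>z - z'\<parallel> < 1\<close>; the bound \<open>1/4\<close> does.\<close>

lemma premor_equiv_B_premor_comp: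
  fixes \<A> :: "'a::cstar_algebra af_object" and \<B> :: "'b::cstar_algebra af_object"
    and \<C> :: "'c::cstar_algebra af_object"
  assumes AF: "AF \<A>" "AF \<B>" "AF \<C>" and \<phi>: "star_hom \<phi>" and \<psi>: "star_hom \<psi>"
    and nz: "\<not> is_zero_algebra TYPE('a)" "\<not> is_zero_algebra TYPE('b)" "\<not> is_zero_algebra TYPE('c)"
    and u: "admissible \<A> \<B> \<phi> u f" "\<And>n. tilde_norm (u n - tilde_one) < 1/4"
    and w: "admissible \<B> \<C> \<psi> w g" "\<And>n. tilde_norm (w n - tilde_one) < 1/4"
    and v: "admissible \<A> \<C> (\<psi> \<circ> \<phi>) v h" "\<And>n. tilde_norm (v n - tilde_one) < 1/4"
  shows "premor_equiv (B_obj \<C>) (B_premor \<A> \<C> (\<psi> \<circ> \<phi>) v h)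
    (premor_comp (B_premor \<B> \<C> \<psi> w g) (B_premor \<A> \<B> \<phi> u f))"
proof -
  note hom = star_hom_comp[OF \<psi> \<phi>]
  note hu = B_premor_eq(2)[OF AF(1,2) \<phi> u(1)] and hw = B_premor_eq(2)[OF AF(2,3) \<psi> w(1)]
    and hv = B_premor_eq(2)[OF AF(1,3) hom v(1)]
  have uni: "tilde_unitary (u n)" "tilde_unitary (v n)" "tilde_unitary (w n)" for n
    using u v w by (auto simp: admissible_def)
  let ?g = "\<lambda>n x. Ad (w (f n)) (\<psi> (Ad (u n) (\<phi> x)))"
  have hg: "af_hom \<A> n \<C> m (?g n)" if "g (f n) \<le> m" for n m
  proof (rule af_homI[OF AF(1,3)])
    have "star_hom ((Ad (w (f n)) \<circ> \<psi>) \<circ> (Ad (u n) \<circ> \<phi>))"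
      by (intro star_hom_comp star_hom_Ad uni \<phi> \<psi>)
    then show "star_hom (?g n)" by (simp add: o_def)
    show "?g n x \<in> sub \<C> m" if "x \<in> sub \<A> n" for x
      using admissible_in[OF w(1) admissible_in[OF u(1) that]] AF_sub_mono[OF AF(3) \<open>g (f n) \<le> m\<close>] by blast
  qed
  have eq: "af_mult \<A> n \<C> m (\<lambda>x. Ad (v n) ((\<psi> \<circ> \<phi>) x)) = af_mult \<A> n \<C> m (?g n)"
    if m: "h n \<le> m" "g (f n) \<le> m" for n m
  proof (rule fd_hom.mult_mat_close[OF hg[OF m(2)] hv[OF m(1)],
        where z = "\<lambda>p. tilde_act (w (f n)) (\<psi> (tilde_act (u n) (\<phi> p)))"
          and z' = "\<lambda>p. tilde_act (v n) ((\<psi> \<circ> \<phi>) p)"], intro conjI)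
    fix p :: 'a assume p: "star p = p" "p * p = p"
    \<comment> \<open>\<open>y\<close> lies in B, so \<psi> can be applied to it, and Ad u (\<phi>
      p) is \<open>y * star y\<close>. Its image under \<psi>, conjugated by w, is therefore
      \<open>z * star z\<close> for z = w \<psi>(y).\<close>
    define y where "y = tilde_act (u n) (\<phi> p)"
    have P: "norm (\<phi> p) \<le> 1" by (rule Ad_star_hom_projection(2)[OF \<phi> p])
    have P2: "norm ((\<psi> \<circ> \<phi>) p) \<le> 1" by (rule Ad_star_hom_projection(2)[OF hom p])
    have "Ad (u n) (\<phi> p) = y * star y" unfolding y_def by (rule Ad_star_hom_projection(1)[OF \<phi> p])
    then show "?g n p = tilde_act (w (f n)) (\<psi> (tilde_act (u n) (\<phi> p))) *
        star (tilde_act (w (f n)) (\<psi> (tilde_act (u n) (\<phi> p))))"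
      by (simp add: star_hom_mult[OF \<psi>] star_hom_star[OF \<psi>] Ad_mult_star y_def)
    show "Ad (v n) ((\<psi> \<circ> \<phi>) p) = tilde_act (v n) ((\<psi> \<circ> \<phi>) p) * star (tilde_act (v n) ((\<psi> \<circ> \<phi>) p))"
      by (rule Ad_star_hom_projection(1)[OF hom p])
    have y: "norm y \<le> 1" unfolding y_def norm_tilde_unitary_act[OF uni(1)] by (rule P)
    have 1: "norm (tilde_act (w (f n)) (\<psi> y) - \<psi> y) \<le> 1/4"
      by (rule norm_tilde_act_minus_le_const[OF uni(3) w(2)])
        (use order_trans[OF norm_star_hom_le[OF \<psi>] y] in auto)
    have "norm (\<psi> y - \<psi> (\<phi> p)) \<le> norm (y - \<phi> p)"
      using norm_star_hom_le[OF \<psi>, of "y - \<phi> p"] by (simp add: star_hom_diff[OF \<psi>])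
    also have "\<dots> \<le> 1/4"
      unfolding y_def by (rule norm_tilde_act_minus_le_const[OF uni(1) u(2) P]) simp
    finally have 2: "norm (\<psi> y - \<psi> (\<phi> p)) \<le> 1/4" .
    have 3: "norm (tilde_act (v n) ((\<psi> \<circ> \<phi>) p) - (\<psi> \<circ> \<phi>) p) \<le> 1/4"
      by (rule norm_tilde_act_minus_le_const[OF uni(2) v(2) P2]) simp
    \<comment> \<open>The path from w \<psi>(y) over \<psi>(y) and \<psi>(\<phi>(p)) to v
      \<psi>(\<phi>(p)) has three steps of length at most 1/4. In the middle one, contractivity of
      \<psi> transports the estimate for u.\<close>
    have "norm (a - d) \<le> norm (a - b) + norm (b - c) + norm (d - c)" for a b c d :: 'c
      using norm_triangle_ineq4[of "a - c" "d - c"] norm_triangle_ineq[of "a - b" "b - c"] by simp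
    from this[of "tilde_act (w (f n)) (\<psi> y)" "tilde_act (v n) ((\<psi> \<circ> \<phi>) p)" "\<psi> y" "(\<psi> \<circ> \<phi>) p"]
    show "norm (tilde_act (w (f n)) (\<psi> (tilde_act (u n) (\<phi> p))) - tilde_act (v n) ((\<psi> \<circ> \<phi>) p)) < 1"
      using 1 2 3 by (simp add: y_def)
  qed
  have comp: "premor_comp (B_premor \<B> \<C> \<psi> w g) (B_premor \<A> \<B> \<phi> u f) =
      (\<lambda>n. af_mult \<A> n \<C> (g (f n)) (?g n), \<lambda>n. g (f n))"
    unfolding B_premor_eq(1)[OF AF(2,3) \<psi> w(1)] B_premor_eq(1)[OF AF(1,2) \<phi> u(1)] premor_comp_def
    using fd_hom.mult_mat_comp[OF hu[OF order_refl] hw[OF order_refl]] by (simp add: fun_eq_iff)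
  show ?thesis
    unfolding comp B_premor_eq(1)[OF AF(1,3) hom v(1)]
    by (rule af_premor_equivI[OF AF(3) nz(3) hv[OF order_refl] hg[OF order_refl] eq])
qed

text \<open>The class of a morphism may be computed from any admissible data, so all three are taken
  with bound 1/4. If one of the algebras is zero, the composite homomorphism vanishes and both sides
  are the zero morphism.\<close>

lemma B_mor_comp:
  fixes \<A> :: "'a::cstar_algebra af_object" and \<B> :: "'b::cstar_algebra af_object"
    and \<C> :: "'c::cstar_algebra af_object"
  assumes AF: "AF \<A>" "AF \<B>" "AF \<C>" and \<phi>: "star_hom \<phi>" and \<psi>: "star_hom \<psi>"
  shows "B_mor \<A> \<C> (\<psi> \<circ> \<phi>) =
    bd_comp (B_obj \<A>) (B_obj \<B>) (B_obj \<C>) (B_mor \<B> \<C> \<psi>) (B_mor \<A> \<B> \<phi>)"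
proof (cases "is_zero_algebra TYPE('a) \<or> is_zero_algebra TYPE('b) \<or> is_zero_algebra TYPE('c)")
  case True
  have "\<psi> \<circ> \<phi> = (\<lambda>_. 0)"
    using True star_hom_zero_algebra[OF \<phi>] star_hom_zero_algebra[OF \<psi>] star_hom_zero[OF \<psi>]
    by (auto simp: fun_eq_iff)
  then have "B_mor \<A> \<C> (\<psi> \<circ> \<phi>) = bd_zero (B_obj \<A>) (B_obj \<C>)" by (simp add: B_mor_def)
  moreover have "B_obj \<A> = Zero_Diagram \<or> B_obj \<B> = Zero_Diagram \<or> B_obj \<C> = Zero_Diagram"
    using True by (auto simp: B_obj_def)
  then have "bd_comp (B_obj \<A>) (B_obj \<B>) (B_obj \<C>) X Y = bd_zero (B_obj \<A>) (B_obj \<C>)" for X Y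
    by (cases "B_obj \<A>"; cases "B_obj \<B>"; cases "B_obj \<C>") auto
  ultimately show ?thesis by simp
next
  case False
  then have nz: "\<not> is_zero_algebra TYPE('a)" "\<not> is_zero_algebra TYPE('b)" "\<not> is_zero_algebra TYPE('c)"
    by auto
  note hom = star_hom_comp[OF \<psi> \<phi>]
  note D1 = B_obj_eq[OF AF(1) nz(1)] bratteli_diagram_B_obj[OF AF(1)]
  note D2 = B_obj_eq[OF AF(2) nz(2)] bratteli_diagram_B_obj[OF AF(2)]
  note D3 = B_obj_eq[OF AF(3) nz(3)] bratteli_diagram_B_obj[OF AF(3)]
  obtain u f where u: "admissible \<A> \<B> \<phi> u f" "\<And>n. tilde_norm (u n - tilde_one) < 1/4"
    using ex_admissible[OF AF(1,2) \<phi> nz(1,2), of "1/4"] by auto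
  obtain w g where w: "admissible \<B> \<C> \<psi> w g" "\<And>n. tilde_norm (w n - tilde_one) < 1/4"
    using ex_admissible[OF AF(2,3) \<psi> nz(2,3), of "1/4"] by auto
  obtain v h where v: "admissible \<A> \<C> (\<psi> \<circ> \<phi>) v h" "\<And>n. tilde_norm (v n - tilde_one) < 1/4"
    using ex_admissible[OF AF(1,3) hom nz(1,3), of "1/4"] by auto
  note pu = premorphism_B_premor[OF AF(1,2) \<phi> nz(1,2) u(1)]
  note pw = premorphism_B_premor[OF AF(2,3) \<psi> nz(2,3) w(1)]
  note pv = premorphism_B_premor[OF AF(1,3) hom nz(1,3) v(1)]
  have "B_mor \<A> \<C> (\<psi> \<circ> \<phi>) = Cls (premor_class (B_obj \<A>) (B_obj \<C>) (B_premor \<A> \<C> (\<psi> \<circ> \<phi>) v h))"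
    by (rule B_mor_eq[OF AF(1,3) hom nz(1,3) v(1)])
  also have "premor_class (B_obj \<A>) (B_obj \<C>) (B_premor \<A> \<C> (\<psi> \<circ> \<phi>) v h) =
      premor_class (B_obj \<A>) (B_obj \<C>) (premor_comp (B_premor \<B> \<C> \<psi> w g) (B_premor \<A> \<B> \<phi> u f))"
    by (rule premor_class_eq[OF D1 D3 pv premorphism_comp[OF D1 D2 D3 pu pw]
          premor_equiv_B_premor_comp[OF AF \<phi> \<psi> nz u w v]])
  also have "Cls \<dots> = bd_comp (B_obj \<A>) (B_obj \<B>) (B_obj \<C>) (B_mor \<B> \<C> \<psi>) (B_mor \<A> \<B> \<phi>)"
    unfolding B_mor_eq[OF AF(1,2) \<phi> nz(1,2) u(1)] B_mor_eq[OF AF(2,3) \<psi> nz(2,3) w(1)]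
    by (rule bd_comp_class[OF D1 D2 D3 pu pw, symmetric])
  finally show ?thesis .
qed

text \<open>The data u = 1, f n = n are admissible for the identity, and R of the identity of A_n is
  the identity matrix.\<close>

lemma B_mor_id:
  fixes \<A> :: "'a::cstar_algebra af_object"
  assumes AF: "AF \<A>"
  shows "B_mor \<A> \<A> id = bd_id (B_obj \<A>)"
proof (cases "is_zero_algebra TYPE('a)")
  case True
  have "(id :: 'a \<Rightarrow> 'a) = (\<lambda>_. 0)" using True by (intro star_hom_zero_algebra) (auto simp: star_hom_def)
  then show ?thesis using True by (simp add: B_mor_def B_obj_def)
next
  case False
  have hom: "star_hom (id :: 'a \<Rightarrow> 'a)" by (simp add: star_hom_def)
  have adm: "admissible \<A> \<A> id (\<lambda>_. tilde_one) (\<lambda>n. n)"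
    by (auto simp: admissible_def mono_def bdd_above_nat tilde_unitary_one tilde_norm_zero)
  have "B_premor \<A> \<A> id (\<lambda>_. tilde_one) (\<lambda>n. n) = (\<lambda>n. 1\<^sub>m (dim_vec (sizes \<A> n)), \<lambda>n. n)"
    unfolding B_premor_eq(1)[OF AF AF hom adm] by (simp add: af_mult_id[OF AF])
  then show ?thesis
    using B_mor_eq[OF AF AF hom False False adm] by (simp add: B_obj_eq[OF AF False])
qed

theorem proposition3p8:
  fixes \<A> :: "'a::cstar_algebra af_object"
    and \<B> :: "'b::cstar_algebra af_object"
    and \<C> :: "'c::cstar_algebra af_object"
    and \<phi> :: "'a \<Rightarrow> 'b" and \<psi> :: "'b \<Rightarrow> 'c"
  assumes "AF \<A>" and "AF \<B>" and "AF \<C>"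
    and "star_hom \<phi>" and "star_hom \<psi>"
  shows "bratteli_diagram (B_obj \<A>) \<and>
    (\<not> is_zero_algebra TYPE('a) \<and> \<not> is_zero_algebra TYPE('b) \<longrightarrow>
       (\<exists>u f. admissible \<A> \<B> \<phi> u f) \<and>
       (\<forall>u f. admissible \<A> \<B> \<phi> u f \<longrightarrow>
          premorphism (B_obj \<A>) (B_obj \<B>) (B_premor \<A> \<B> \<phi> u f) \<and>
          B_mor \<A> \<B> \<phi> =
            Cls (premor_class (B_obj \<A>) (B_obj \<B>) (B_premor \<A> \<B> \<phi> u f)))) \<and>
    B_mor \<A> \<B> \<phi> \<in> bd_hom (B_obj \<A>) (B_obj \<B>) \<and>
    B_mor \<A> \<C> (\<psi> \<circ> \<phi>) =
      bd_comp (B_obj \<A>) (B_obj \<B>) (B_obj \<C>) (B_mor \<B> \<C> \<psi>) (B_mor \<A> \<B> \<phi>) \<and>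
    B_mor \<A> \<A> id = bd_id (B_obj \<A>)"
proof (intro conjI impI allI)
  show "bratteli_diagram (B_obj \<A>)" by (rule bratteli_diagram_B_obj[OF assms(1)])
  show "B_mor \<A> \<C> (\<psi> \<circ> \<phi>) =
      bd_comp (B_obj \<A>) (B_obj \<B>) (B_obj \<C>) (B_mor \<B> \<C> \<psi>) (B_mor \<A> \<B> \<phi>)"
    by (rule B_mor_comp[OF assms])
  show "B_mor \<A> \<A> id = bd_id (B_obj \<A>)" by (rule B_mor_id[OF assms(1)])
  show "B_mor \<A> \<B> \<phi> \<in> bd_hom (B_obj \<A>) (B_obj \<B>)"
  proof (cases "is_zero_algebra TYPE('a) \<or> is_zero_algebra TYPE('b)")
    case True
    then show ?thesis
      using star_hom_zero_algebra[OF assms(4) True] by (cases "B_obj \<A>") (auto simp: B_mor_def B_obj_def)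
  next
    case False
    then have nz: "\<not> is_zero_algebra TYPE('a)" "\<not> is_zero_algebra TYPE('b)" by auto
    obtain u f where adm: "admissible \<A> \<B> \<phi> u f"
      using ex_admissible[OF assms(1,2,4) nz, of "1/2"] by auto
    show ?thesis
      using B_mor_eq[OF assms(1,2,4) nz adm] premorphism_B_premor[OF assms(1,2,4) nz adm]
      unfolding B_obj_eq[OF assms(1) nz(1)] B_obj_eq[OF assms(2) nz(2)] bd_hom.simps by blast
  qed
next
  assume "\<not> is_zero_algebra TYPE('a) \<and> \<not> is_zero_algebra TYPE('b)"
  then have nz: "\<not> is_zero_algebra TYPE('a)" "\<not> is_zero_algebra TYPE('b)" by auto
  show "\<exists>u f. admissible \<A> \<B> \<phi> u f" using ex_admissible[OF assms(1,2,4) nz, of "1/2"] by auto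
  fix u f assume adm: "admissible \<A> \<B> \<phi> u f"
  show "premorphism (B_obj \<A>) (B_obj \<B>) (B_premor \<A> \<B> \<phi> u f)"
    by (rule premorphism_B_premor[OF assms(1,2,4) nz adm])
  show "B_mor \<A> \<B> \<phi> = Cls (premor_class (B_obj \<A>) (B_obj \<B>) (B_premor \<A> \<B> \<phi> u f))"
    by (rule B_mor_eq[OF assms(1,2,4) nz adm])
qed

end
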